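(* Let $(\lambda_{i,1},Q_{i,1})_{i\in\{1,\dots,\ell_1\}}$ and $(\lambda_{i,2},Q_{i,2})_{i\in\{1,\dots,\ell_2\}}$ be two families of jump mechanisms on $\mathsf M$. Suppose that for all $(t,x,A)\in\mathbb R_+\times\mathsf M\times\mathcal B(\mathsf M)$, $$\sum_{i=1}^{\ell_1}\lambda_{i,1}(t,x)\big(Q_{i,1}(t,x,A)-\delta_x(A)\big)=\sum_{i=1}^{\ell_2}\lambda_{i,2}(t,x)\big(Q_{i,2}(t,x,A)-\delta_x(A)\big).$$ Then, for every differential flow $\varphi$ on $\mathsf M$ and every initial distribution $\mu_0\in\mathcal P(\mathsf M)$, $$\mathrm{PDMP}\big(\varphi,(\lambda_{i,1},Q_{i,1})_{i\in\{1,\dots,\ell_1\}},\mu_0\big)=\mathrm{PDMP}\big(\varphi,(\lambda_{i,2},Q_{i,2})_{i\in\{1,\dots,\ell_2\}},\mu_0\big).$$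
   Context: $\mathsf M$ is a smooth closed Riemannian submanifold of $\mathbb R^N$ with Borel $\sigma$-field $\mathcal B(\mathsf M)$; $\infty\notin\mathsf M$ is a cemetery point; $\mathcal P(\mathsf M)$ is the set of probability measures on $\mathsf M$; $\inf\emptyset=+\infty$; $\mathbb N=\{0,1,\dots\}$, $\mathbb N^*=\mathbb N\setminus\{0\}$. A differential flow on $\mathsf M$ is a measurable map $\varphi:(t,h,x)\mapsto\varphi_{t,t+h}(x)$ from $\mathbb R_+\times\mathbb R_+\times\mathsf M$ to $\mathsf M$ with $\varphi_{t,t}=\mathrm{Id}$, $\varphi_{t+h_1,t+h_1+h_2}\circ\varphi_{t,t+h_1}=\varphi_{t,t+h_1+h_2}$, such that $h\mapsto\varphi_{t,t+h}(x)$ is continuously differentiable for all $(t,x)$ and $\varphi_{t,t+h}$ is a $C^1$-diffeomorphism of $\mathsf M$ for all $t,h\ge0$. A jump mechanism is a pair $(\lambda,Q)$ where $\lambda:\mathbb R_+\times\mathsf M\to\mathbb R_+$ (jump rate) is measurable and bounded on every compact subset of $\mathbb R_+\times\mathsf M$, and $Q:\mathbb R_+\times\mathsf M\times\mathcal B(\mathsf M)\to[0,1]$ is an inhomogeneous Markov kernel ($(t,x)\mapsto Q(t,x,A)$ measurable, $Q(t,x,\cdot)\in\mathcal P(\mathsf M)$). Given a flow $\varphi$, jump mechanisms $(\lambda_i,Q_i)_{i\in\{1,\dots,\ell\}}$ and $\mu_0$, $\mathrm{PDMP}(\varphi,(\lambda_i,Q_i)_{i\in\{1,\dots,\ell\}},\mu_0)$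 denotes the distribution, on the space $D(\mathbb R_+,\mathsf M\cup\{\infty\})$ of càdlàg functions with the Skorokhod topology, of the following process. For each $i$ let $G_i:\mathbb R_+\times\mathsf M\times[0,1]\to\mathsf M$ be measurable with $Q_i(t,x,A)=\mathbb P(G_i(t,x,U)\in A)$, $U$ uniform on $[0,1]$. Let $W_0\sim\mu_0$ and, independently, let $((E_{j,k})_{j\in\{1,\dots,\ell\}},U_k)_{k\in\mathbb N^*}$ be i.i.d. in $k$, with $U_k$ uniform on $[0,1]$, $E_{j,k}$ exponential with parameter $1$, all independent. Set $S_0=0$, $X_0=X_0'=W_0$. Given $X'_k\in\mathsf M$, $S_k<\infty$, set $S_{j,k+1}=\inf\{t\ge S_k: E_{j,k+1}<\int_{S_k}^t\lambda_j(s,\varphi_{S_k,s}(X_k'))\,ds\}$ and $S_{k+1}=\min_jS_{j,k+1}$. If $S_{k+1}=+\infty$, set $S_m=+\infty$, $X'_m=\infty$ for all $m>k$ and $X_t=\varphi_{S_k,t}(X_k')$ for all $t\ge S_k$. If $S_{k+1}<+\infty$, set $I_{k+1}=\min\{j:S_{j,k+1}=S_{k+1}\}$, $X'_{k+1}=G_{I_{k+1}}(S_{k+1},\varphi_{S_k,S_{k+1}}(X'_k),U_{k+1})$, $X_t=\varphi_{S_k,t}(X'_k)$ for $t\in(S_k,S_{k+1})$ and $X_{S_{k+1}}=X'_{k+1}$. For $t\ge\sup_kS_k$, set $X_t=\infty$. *)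

theory Defs
  imports "HOL-Probability.Probability"
begin

section \<open>Submanifolds of a Euclidean space\<close>

primrec Ck_on :: "nat \<Rightarrow> ('a::euclidean_space \<Rightarrow> 'b::euclidean_space) \<Rightarrow> 'a set \<Rightarrow> bool" where
  "Ck_on 0 f U \<longleftrightarrow> continuous_on U f"
| "Ck_on (Suc k) f U \<longleftrightarrow>
     (\<exists>f'. (\<forall>x\<in>U. (f has_derivative f' x) (at x)) \<and> (\<forall>v. Ck_on k (\<lambda>x. f' x v) U))"

definition smooth_submanifold :: "nat \<Rightarrow> 'a::euclidean_space set \<Rightarrow> bool" where
  "smooth_submanifold d M \<longleftrightarrow>
     (\<forall>p\<in>M. \<exists>U V \<psi> \<theta> (L::'a set).
        open U \<and> p \<in> U \<and> open V \<and> homeomorphism U V \<psi> \<theta> \<and>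
        (\<forall>k. Ck_on k \<psi> U) \<and> (\<forall>k. Ck_on k \<theta> V) \<and>
        subspace L \<and> dim L = d \<and> \<psi> ` (U \<inter> M) = V \<inter> L)"

text \<open>The Riemannian metric is the one induced by the ambient inner product, so it is not
  additional data. Closed means closed as a subset of the ambient space; in particular
  noncompact submanifolds such as the whole space are allowed.\<close>

definition smooth_closed_submanifold :: "'a::euclidean_space set \<Rightarrow> bool" where
  "smooth_closed_submanifold M \<longleftrightarrow> closed M \<and> (\<exists>d. smooth_submanifold d M)"

definition C1_map :: "'a::euclidean_space set \<Rightarrow> ('a \<Rightarrow> 'a) \<Rightarrow> bool" where
  "C1_map M f \<longleftrightarrow> f ` M \<subseteq> M \<and>
     (\<forall>p\<in>M. \<exists>U F. open U \<and> p \<in> U \<and> Ck_on 1 F U \<and> (\<forall>x\<in>U \<inter> M. F x = f x))"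

definition C1_diffeomorphism :: "'a::euclidean_space set \<Rightarrow> ('a \<Rightarrow> 'a) \<Rightarrow> bool" where
  "C1_diffeomorphism M f \<longleftrightarrow> bij_betw f M M \<and> C1_map M f \<and> C1_map M (the_inv_into M f)"


section \<open>Differential flows and jump mechanisms\<close>

abbreviation half_line :: "real measure" where
  "half_line \<equiv> restrict_space borel {0..}"

abbreviation borel_on :: "'a::topological_space set \<Rightarrow> 'a measure" where
  "borel_on M \<equiv> restrict_space borel M"

text \<open>The map from time s to time t is \<open>\<phi> s t\<close>; only the values for 0 \<open>\<le>\<close> s \<open>\<le>\<close> t and points
  of M are constrained or used.\<close>

definition differential_flow ::
    "'a::euclidean_space set \<Rightarrow> (real \<Rightarrow> real \<Rightarrow> 'a \<Rightarrow> 'a) \<Rightarrow> bool" where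
  "differential_flow M \<phi> \<longleftrightarrow>
     (\<lambda>(t, h, x). \<phi> t (t + h) x) \<in> half_line \<Otimes>\<^sub>M half_line \<Otimes>\<^sub>M borel_on M \<rightarrow>\<^sub>M borel_on M \<and>
     (\<forall>t\<ge>0. \<forall>x\<in>M. \<phi> t t x = x) \<and>
     (\<forall>t\<ge>0. \<forall>h\<^sub>1\<ge>0. \<forall>h\<^sub>2\<ge>0. \<forall>x\<in>M.
        \<phi> (t + h\<^sub>1) (t + h\<^sub>1 + h\<^sub>2) (\<phi> t (t + h\<^sub>1) x) = \<phi> t (t + h\<^sub>1 + h\<^sub>2) x) \<and>
     (\<forall>t\<ge>0. \<forall>x\<in>M. \<exists>v. continuous_on {0..} v \<and>
        (\<forall>h\<ge>0. ((\<lambda>h. \<phi> t (t + h) x) has_vector_derivative v h) (at h within {0..}))) \<and>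
     (\<forall>t\<ge>0. \<forall>h\<ge>0. C1_diffeomorphism M (\<phi> t (t + h)))"

definition jump_mechanism ::
    "'a::euclidean_space set \<Rightarrow> (real \<Rightarrow> 'a \<Rightarrow> real) \<Rightarrow> (real \<Rightarrow> 'a \<Rightarrow> 'a measure) \<Rightarrow> bool" where
  "jump_mechanism M lam Q \<longleftrightarrow>
     (\<lambda>(t, x). lam t x) \<in> half_line \<Otimes>\<^sub>M borel_on M \<rightarrow>\<^sub>M borel \<and>
     (\<forall>t\<ge>0. \<forall>x\<in>M. 0 \<le> lam t x) \<and>
     (\<forall>K. compact K \<and> K \<subseteq> {0..} \<times> M \<longrightarrow> bounded ((\<lambda>(t, x). lam t x) ` K)) \<and>
     (\<lambda>(t, x). Q t x) \<in> half_line \<Otimes>\<^sub>M borel_on M \<rightarrow>\<^sub>M prob_algebra (borel_on M)"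

abbreviation uniform01 :: "real measure" where
  "uniform01 \<equiv> restrict_space lborel {0..1}"

definition represents_kernel :: "'a::euclidean_space set \<Rightarrow> (real \<Rightarrow> 'a \<Rightarrow> real \<Rightarrow> 'a) \<Rightarrow>
    (real \<Rightarrow> 'a \<Rightarrow> 'a measure) \<Rightarrow> bool" where
  "represents_kernel M G Q \<longleftrightarrow>
     (\<lambda>(t, x, u). G t x u) \<in> half_line \<Otimes>\<^sub>M borel_on M \<Otimes>\<^sub>M borel_on {0..1} \<rightarrow>\<^sub>M borel_on M \<and>
     (\<forall>t\<ge>0. \<forall>x\<in>M. \<forall>A\<in>sets (borel_on M).
        measure (Q t x) A = measure uniform01 {u\<in>{0..1}. G t x u \<in> A})"


section \<open>The Skorokhod space of paths on the half-line\<close>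

definition cadlag_paths :: "'s topology \<Rightarrow> (real \<Rightarrow> 's) set" where
  "cadlag_paths S = {x \<in> {0..} \<rightarrow>\<^sub>E topspace S.
     (\<forall>t\<ge>0. limitin S x (x t) (at_right t)) \<and>
     (\<forall>t>0. \<exists>l. limitin S x l (at_left t))}"

definition time_changes :: "(real \<Rightarrow> real) set" where
  "time_changes = {\<tau>. continuous_on {0..} \<tau> \<and> strict_mono_on {0..} \<tau> \<and> bij_betw \<tau> {0..} {0..}}"

definition diagonal_neighbourhood :: "'s topology \<Rightarrow> ('s \<times> 's) set \<Rightarrow> bool" where
  "diagonal_neighbourhood S W \<longleftrightarrow>
     openin (prod_topology S S) W \<and> (\<forall>a\<in>topspace S. (a, a) \<in> W)"

definition skorokhod_nbhd ::
    "'s topology \<Rightarrow> (real \<Rightarrow> 's) \<Rightarrow> real \<Rightarrow> real \<Rightarrow> ('s \<times> 's) set \<Rightarrow> (real \<Rightarrow> 's) set" where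
  "skorokhod_nbhd S x T \<epsilon> W = {y \<in> cadlag_paths S. \<exists>\<tau>\<in>time_changes.
     (\<forall>s\<ge>0. \<bar>\<tau> s - s\<bar> < \<epsilon>) \<and> (\<forall>s\<in>{0..T}. (x s, y (\<tau> s)) \<in> W)}"

text \<open>The Skorokhod J1 topology for a compact metrizable state space S. There the open
  neighbourhoods of the diagonal generate the only compatible uniformity, so for any compatible
  metric d they may be replaced by the sets \<open>{(a, b). d a b < \<delta>}\<close>. Hence \<open>y n\<close> converges to x
  iff there are time changes \<open>\<tau> n\<close> with \<open>\<tau> n s - s\<close> tending to 0 uniformly in s and
  \<open>d (y n (\<tau> n s)) (x s)\<close> tending to 0 uniformly in s on every \<open>{0..T}\<close>, which is the usual
  characterization of J1 convergence on the half-line.\<close>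

definition skorokhod_open :: "'s topology \<Rightarrow> (real \<Rightarrow> 's) set \<Rightarrow> bool" where
  "skorokhod_open S \<U> \<longleftrightarrow> \<U> \<subseteq> cadlag_paths S \<and>
     (\<forall>x\<in>\<U>. \<exists>T \<epsilon> W. 0 < \<epsilon> \<and> diagonal_neighbourhood S W \<and> skorokhod_nbhd S x T \<epsilon> W \<subseteq> \<U>)"

definition skorokhod_topology :: "'s topology \<Rightarrow> (real \<Rightarrow> 's) topology" where
  "skorokhod_topology S = topology (skorokhod_open S)"

lemma istopology_skorokhod_open: "istopology (skorokhod_open S)"
  unfolding istopology_def
proof (intro conjI allI impI)
  fix A B assume A: "skorokhod_open S A" and B: "skorokhod_open S B"
  have "\<exists>T \<epsilon> W. 0 < \<epsilon> \<and> diagonal_neighbourhood S W \<and> skorokhod_nbhd S x T \<epsilon> W \<subseteq> A \<inter> B"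
    if x: "x \<in> A \<inter> B" for x
  proof -
    obtain T \<epsilon> W where 1: "0 < \<epsilon>" "diagonal_neighbourhood S W" "skorokhod_nbhd S x T \<epsilon> W \<subseteq> A"
      using A x unfolding skorokhod_open_def by blast
    obtain T' \<epsilon>' W' where 2: "0 < \<epsilon>'" "diagonal_neighbourhood S W'"
      "skorokhod_nbhd S x T' \<epsilon>' W' \<subseteq> B"
      using B x unfolding skorokhod_open_def by blast
    have "skorokhod_nbhd S x (max T T') (min \<epsilon> \<epsilon>') (W \<inter> W')
        \<subseteq> skorokhod_nbhd S x T \<epsilon> W \<inter> skorokhod_nbhd S x T' \<epsilon>' W'"
      unfolding skorokhod_nbhd_def by fastforce
    moreover have "diagonal_neighbourhood S (W \<inter> W')"
      using 1 2 unfolding diagonal_neighbourhood_def by blast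
    moreover have "0 < min \<epsilon> \<epsilon>'"
      using 1 2 by simp
    ultimately show ?thesis
      using 1(3) 2(3) by blast
  qed
  then show "skorokhod_open S (A \<inter> B)"
    using A unfolding skorokhod_open_def by blast
next
  fix \<K> assume K: "\<forall>A\<in>\<K>. skorokhod_open S A"
  show "skorokhod_open S (\<Union>\<K>)"
    unfolding skorokhod_open_def
  proof (intro conjI ballI)
    show "\<Union>\<K> \<subseteq> cadlag_paths S"
      using K unfolding skorokhod_open_def by blast
  next
    fix x assume "x \<in> \<Union>\<K>"
    then obtain A where A: "A \<in> \<K>" "x \<in> A" by blast
    then obtain T \<epsilon> W where "0 < \<epsilon>" "diagonal_neighbourhood S W" "skorokhod_nbhd S x T \<epsilon> W \<subseteq> A"
      using K unfolding skorokhod_open_def by blast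
    then show "\<exists>T \<epsilon> W. 0 < \<epsilon> \<and> diagonal_neighbourhood S W \<and> skorokhod_nbhd S x T \<epsilon> W \<subseteq> \<Union>\<K>"
      using A by blast
  qed
qed

lemma openin_skorokhod_topology: "openin (skorokhod_topology S) = skorokhod_open S"
  unfolding skorokhod_topology_def
  using istopology_skorokhod_open by (rule topology_inverse')

lemma topspace_skorokhod_topology: "topspace (skorokhod_topology S) = cadlag_paths S"
proof (rule subset_antisym)
  show "topspace (skorokhod_topology S) \<subseteq> cadlag_paths S"
    unfolding topspace_def openin_skorokhod_topology skorokhod_open_def by blast
next
  have "skorokhod_nbhd S x 0 1 (topspace S \<times> topspace S) \<subseteq> cadlag_paths S" for x
    unfolding skorokhod_nbhd_def by blast
  moreover have "diagonal_neighbourhood S (topspace S \<times> topspace S)"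
    unfolding diagonal_neighbourhood_def by (simp add: openin_prod_Times_iff)
  ultimately have "skorokhod_open S (cadlag_paths S)"
    unfolding skorokhod_open_def by (meson order_refl zero_less_one)
  then show "cadlag_paths S \<subseteq> topspace (skorokhod_topology S)"
    unfolding topspace_def openin_skorokhod_topology by blast
qed

definition borel_sigma :: "'s topology \<Rightarrow> 's measure" where
  "borel_sigma X = sigma (topspace X) {U. openin X U}"


section \<open>Construction of the process\<close>

text \<open>The cemetery is \<open>None\<close>. It is attached to M as the point at infinity of the one-point
  compactification (an isolated point when M is compact): the jump rates being bounded on compact
  sets, an explosion goes along with leaving the compact subsets of M, so this is the topology in
  which the process has a left limit at the explosion time.\<close>

abbreviation with_cemetery :: "'a::euclidean_space set \<Rightarrow> 'a option topology" where
  "with_cemetery M \<equiv> Alexandroff_compactification (top_of_set M)"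

context
  fixes \<phi> :: "real \<Rightarrow> real \<Rightarrow> 'a::euclidean_space \<Rightarrow> 'a"
    and l :: nat
    and lam :: "nat \<Rightarrow> real \<Rightarrow> 'a \<Rightarrow> real"
    and G :: "nat \<Rightarrow> real \<Rightarrow> 'a \<Rightarrow> real \<Rightarrow> 'a"
begin

text \<open>\<open>clock e j s x\<close> is the ringing time of clock j with threshold e for the flow started from x
  at time s; it is \<open>\<infinity>\<close> if the clock never rings.\<close>

definition clock :: "real \<Rightarrow> nat \<Rightarrow> real \<Rightarrow> 'a \<Rightarrow> ereal" where
  "clock e j s x = (INF t \<in> {t. s \<le> t \<and> e < (LBINT r:{s..t}. lam j r (\<phi> s r x))}. ereal t)"

definition next_time :: "(nat \<Rightarrow> real) \<Rightarrow> real \<Rightarrow> 'a \<Rightarrow> ereal" where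
  "next_time e s x = (INF j\<in>{1..l}. clock (e j) j s x)"

definition next_index :: "(nat \<Rightarrow> real) \<Rightarrow> real \<Rightarrow> 'a \<Rightarrow> nat" where
  "next_index e s x = (LEAST j. j \<in> {1..l} \<and> clock (e j) j s x = next_time e s x)"

text \<open>\<open>skeleton w \<eta> k\<close> is \<open>Some (s, x)\<close> when the k-th jump occurs at the finite time s with
  post-jump position x, and \<open>None\<close> when the k-th jump time is infinite and the position is the
  cemetery. The noise \<open>\<eta> k\<close> is the pair of the thresholds of the k-th round (a function of the
  clock) and of the uniform variable of the k-th round.\<close>

primrec skeleton :: "'a \<Rightarrow> (nat \<Rightarrow> (nat \<Rightarrow> real) \<times> real) \<Rightarrow> nat \<Rightarrow> (real \<times> 'a) option" where
  "skeleton w \<eta> 0 = Some (0, w)"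
| "skeleton w \<eta> (Suc k) = (case skeleton w \<eta> k of
      None \<Rightarrow> None
    | Some (s, x) \<Rightarrow>
        (let e = fst (\<eta> (Suc k)); u = snd (\<eta> (Suc k)); S' = next_time e s x in
         if S' = \<infinity> then None
         else let t = real_of_ereal S' in Some (t, G (next_index e s x) t (\<phi> s t x) u)))"

definition jump_time :: "'a \<Rightarrow> (nat \<Rightarrow> (nat \<Rightarrow> real) \<times> real) \<Rightarrow> nat \<Rightarrow> ereal" where
  "jump_time w \<eta> k = (case skeleton w \<eta> k of None \<Rightarrow> \<infinity> | Some (s, x) \<Rightarrow> ereal s)"

text \<open>Before the explosion time, the least k whose successor jump time exceeds t satisfies
  \<open>jump_time k \<le> t < jump_time (Suc k)\<close>; at a jump time s the value is \<open>\<phi> s s x = x\<close>, the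
  post-jump position.\<close>

definition pdmp_path :: "'a \<Rightarrow> (nat \<Rightarrow> (nat \<Rightarrow> real) \<times> real) \<Rightarrow> real \<Rightarrow> 'a option" where
  "pdmp_path w \<eta> = (\<lambda>t\<in>{0..}.
     if (SUP k. jump_time w \<eta> k) \<le> ereal t then None
     else map_option (\<lambda>(s, x). \<phi> s t x)
            (skeleton w \<eta> (LEAST k. ereal t < jump_time w \<eta> (Suc k))))"

end

text \<open>The noise is realized on the canonical product space; the law of the process depends only
  on the joint law of the noise.\<close>

definition noise :: "nat \<Rightarrow> (nat \<Rightarrow> (nat \<Rightarrow> real) \<times> real) measure" where
  "noise l = (\<Pi>\<^sub>M k\<in>{1..}.
     (\<Pi>\<^sub>M j\<in>{1..l}. density lborel (exponential_density 1)) \<Otimes>\<^sub>M uniform01)"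

text \<open>A path can fail to be cadlag only by having no left limit at a finite explosion time. Such
  exceptional paths are sent to the constant cemetery path, so that the distribution is a
  probability measure on the Skorokhod space. The kernels enter through the maps G
  representing them.\<close>

definition PDMP :: "'a::euclidean_space set \<Rightarrow> (real \<Rightarrow> real \<Rightarrow> 'a \<Rightarrow> 'a) \<Rightarrow> nat \<Rightarrow>
    (nat \<Rightarrow> real \<Rightarrow> 'a \<Rightarrow> real) \<Rightarrow> (nat \<Rightarrow> real \<Rightarrow> 'a \<Rightarrow> real \<Rightarrow> 'a) \<Rightarrow> 'a measure \<Rightarrow>
    (real \<Rightarrow> 'a option) measure" where
  "PDMP M \<phi> l lam G \<mu>\<^sub>0 =
     distr (\<mu>\<^sub>0 \<Otimes>\<^sub>M noise l) (borel_sigma (skorokhod_topology (with_cemetery M)))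
       (\<lambda>(w, \<eta>). let X = pdmp_path \<phi> l lam G w \<eta> in
          if X \<in> cadlag_paths (with_cemetery M) then X else (\<lambda>t\<in>{0..}. None))"

end

theory Submission
  imports Defs
begin

text \<open>Fix finitely many observation times and Borel sets of M, and let u(s, x) be the probability
  that the process started from x at time s is in the prescribed sets at the remaining times.
  Decomposing at the first jump, u is the least nonnegative solution of a renewal equation. Along a
  flow line this equation is equivalent, by the product rule for primitives of bounded functions, to
  one in which the jump mechanisms enter only through the sum of \<open>\<lambda>\<^sub>i (Q\<^sub>i - id)\<close>. Hence the function u
  of one family also solves the renewal equation of the other family, and minimality in both
  directions gives the equality of the finite-dimensional distributions; jumps to the same point and
  explosions need no separate treatment, since a path in the cemetery meets no observation.

  On cadlag paths, every Skorokhod open set is a countable union of events about finitely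
  many exit times from small balls with centres in a countable dense set, and these events belong to
  the \<open>\<sigma>\<close>-field of the coordinates. So the finite-dimensional distributions determine the law.\<close>

text \<open>The rates are only bounded on compact sets, so jumps may accumulate in finite time: when
  every observed set is all of \<open>M\<close>, the constant 1 always solves the equation, whereas
  the probability sought is that of no explosion up to the last observation. Minimality selects the
  right solution because observed paths are alive, hence have finitely many jumps up to that time,
  and counting these jumps gives approximations from below. The two families have no common jump
  count, since one of them may make jumps that leave the point fixed; so the approximations are not
  compared with each other, only the full solution of one family with the equation of the other. The
  second obstacle is that a path may lack a left limit at its explosion. The set of such paths has
  to be an event of the coordinates itself, which calls for a criterion at rational times. The third
  is that the rates are merely measurable in time, so that derivatives along a flow line exist at
  best almost everywhere.\<close>

section \<open>The one-point compactification\<close>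

text \<open>An embedding of the one-point compactification into a Euclidean space, which makes the
  metric arguments below possible without a metrization theorem.\<close>

definition stereo :: "'a::euclidean_space option \<Rightarrow> 'a \<times> real" where
  "stereo z = (case z of None \<Rightarrow> 0 | Some x \<Rightarrow> (1 / (1 + (norm x)\<^sup>2)) *\<^sub>R (x, 1))"

lemma stereo_simps:
  "stereo None = 0" "stereo (Some x) = (1 / (1 + (norm x)\<^sup>2)) *\<^sub>R (x, 1)"
  by (simp_all add: stereo_def)

lemma one_plus_norm_sq_pos: "1 + (norm (x::'a::real_normed_vector))\<^sup>2 > 0"
  by (simp add: add_pos_nonneg)

lemma one_plus_norm_sq_neq_0 [simp]: "1 + (norm (x::'a::real_normed_vector))\<^sup>2 \<noteq> 0"
  using one_plus_norm_sq_pos[of x] by simp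

lemma inj_stereo: "inj stereo"
proof (rule injI)
  fix a b :: "'a option" assume ab: "stereo a = stereo b"
  show "a = b"
  proof (cases a; cases b)
    fix x y assume xy: "a = Some x" "b = Some y"
    have "1 / (1 + (norm x)\<^sup>2) = 1 / (1 + (norm y)\<^sup>2)"
      using ab xy by (simp add: stereo_simps)
    moreover have "1 / (1 + (norm x)\<^sup>2) \<noteq> 0"
      using one_plus_norm_sq_pos[of x] by simp
    ultimately show "a = b" using ab xy by (auto simp: stereo_simps)
  next
    fix x assume "a = Some x" "b = None"
    then show "a = b" using ab by (simp add: prod_eq_iff stereo_simps)
  next
    fix x assume "a = None" "b = Some x"
    then show "a = b" using ab by (simp add: prod_eq_iff stereo_simps)
  qed simp
qed

lemma continuous_on_stereo_Some: "continuous_on A (\<lambda>x. stereo (Some x))"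
  unfolding stereo_simps by (intro continuous_intros) simp

text \<open>This decay is what makes \<open>stereo\<close> continuous at the cemetery, which is sent
  to 0.\<close>

lemma norm_stereo_le:
  assumes "x \<noteq> 0"
  shows "norm (stereo (Some x)) \<le> 2 / norm x"
proof -
  let ?c = "1 + (norm x)\<^sup>2"
  have n: "norm x > 0" using assms by simp
  have "norm (stereo (Some x)) = (1 / ?c) * norm (x, 1::real)"
    unfolding stereo_simps norm_scaleR using one_plus_norm_sq_pos[of x] by simp
  also have "\<dots> \<le> (1 / ?c) * (norm x + 1)"
    using norm_Pair_le[of x "1::real"] one_plus_norm_sq_pos[of x]
    by (intro mult_left_mono) auto
  also have "\<dots> \<le> 2 / norm x"
  proof -
    have "0 \<le> (norm x - 1)\<^sup>2" by simp
    then have "2 * norm x \<le> (norm x)\<^sup>2 + 1" unfolding power2_diff by simp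
    moreover have "0 \<le> (norm x)\<^sup>2" by simp
    ultimately have "norm x * (norm x + 1) \<le> 2 * ?c"
      unfolding distrib_left power2_eq_square[symmetric] using n by linarith
    then show ?thesis
      using n one_plus_norm_sq_pos[of x] by (simp add: divide_simps mult.commute)
  qed
  finally show ?thesis .
qed

lemma topspace_with_cemetery: "topspace (with_cemetery M) = insert None (Some ` M)"
  by (simp add: topspace_Alexandroff_compactification)

text \<open>At points of \<open>M\<close> continuity is that of a rational map. At the cemetery, the
  part of \<open>M\<close> mapped outside a neighbourhood of 0 is bounded by the decay of
  \<open>stereo\<close>, and compact because \<open>M\<close> is closed; its complement is thus a
  neighbourhood of the point at infinity.\<close>

lemma continuous_map_stereo:
  fixes M :: "'a::euclidean_space set"
  assumes "closed M"
  shows "continuous_map (with_cemetery M) euclidean stereo"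
  unfolding continuous_map_def
proof (intro conjI allI impI)
  show "stereo \<in> topspace (with_cemetery M) \<rightarrow> topspace euclidean" by simp
  fix V :: "('a \<times> real) set" assume "openin euclidean V"
  then have V: "open V" by simp
  have o: "openin (top_of_set M) {x \<in> M. stereo (Some x) \<in> V}"
    using continuous_openin_preimage_gen[OF continuous_on_stereo_Some V, of M]
    by (simp add: vimage_def Int_def)
  show "openin (with_cemetery M) {z \<in> topspace (with_cemetery M). stereo z \<in> V}"
  proof (cases "stereo (None::'a option) \<in> V")
    case False
    then have "{z \<in> topspace (with_cemetery M). stereo z \<in> V} = Some ` {x \<in> M. stereo (Some x) \<in> V}"
      unfolding topspace_with_cemetery by auto
    then show ?thesis using o unfolding openin_Alexandroff_compactification by blast
  next
    case True
    then obtain \<epsilon> where \<epsilon>: "\<epsilon> > 0" "ball 0 \<epsilon> \<subseteq> V"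
      using V unfolding open_contains_ball by (metis stereo_simps(1))
    let ?C = "{x \<in> M. stereo (Some x) \<notin> V}"
    have cl: "closedin (top_of_set M) ?C"
    proof -
      have "?C = M - {x \<in> M. stereo (Some x) \<in> V}" by auto
      then show ?thesis using o by (metis closedin_diff closedin_topspace topspace_euclidean_subtopology)
    qed
    have "norm x \<le> 2 / \<epsilon>" if "x \<in> ?C" for x
    proof (cases "x = 0")
      case False
      have "\<not> norm (stereo (Some x)) < \<epsilon>"
      proof
        assume "norm (stereo (Some x)) < \<epsilon>"
        then have "stereo (Some x) \<in> ball 0 \<epsilon>" by simp
        then show False using that \<epsilon> by blast
      qed
      then have "\<epsilon> \<le> 2 / norm x" using norm_stereo_le[OF False] by linarith
      then show ?thesis using False \<epsilon>(1) by (simp add: field_simps)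
    qed (use \<epsilon> in simp)
    then have "bounded ?C" unfolding bounded_iff by blast
    moreover have "closed ?C" using cl assms closedin_closed_trans by blast
    ultimately have "compactin (top_of_set M) ?C"
      by (simp add: compactin_subtopology compact_eq_bounded_closed)
    moreover have "{z \<in> topspace (with_cemetery M). stereo z \<in> V}
        = insert None (Some ` (topspace (top_of_set M) - ?C))"
      unfolding topspace_with_cemetery using True by auto
    ultimately show ?thesis using cl unfolding openin_Alexandroff_compactification by blast
  qed
qed

abbreviation stereo_image :: "'a::euclidean_space set \<Rightarrow> ('a \<times> real) set" where
  "stereo_image M \<equiv> stereo ` topspace (with_cemetery M)"

lemma compact_stereo_image:
  assumes "closed M" shows "compact (stereo_image M)"
proof -
  have "compactin (with_cemetery M) (topspace (with_cemetery M))"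
    using compact_space_Alexandroff_compactification[of "top_of_set M"] unfolding compact_space_def .
  from image_compactin[OF this continuous_map_stereo[OF assms]] show ?thesis
    unfolding compactin_euclidean_iff .
qed

text \<open>A continuous injection of a compact space into a Hausdorff space is an embedding. Limits
  and neighbourhoods of the diagonal can from here on be read in a compact Euclidean set.\<close>

lemma homeomorphic_map_stereo:
  assumes "closed M"
  shows "homeomorphic_map (with_cemetery M) (top_of_set (stereo_image M)) stereo"
proof (rule continuous_imp_homeomorphic_map)
  show "compact_space (with_cemetery M)" by (rule compact_space_Alexandroff_compactification)
  show "Hausdorff_space (top_of_set (stereo_image M))"
    by (simp add: Hausdorff_space_subtopology)
  show "continuous_map (with_cemetery M) (top_of_set (stereo_image M)) stereo"
    using continuous_map_stereo[OF assms] unfolding continuous_map_in_subtopology by blast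
  show "stereo ` topspace (with_cemetery M) = topspace (top_of_set (stereo_image M))"
    unfolding topspace_euclidean_subtopology ..
  show "inj_on stereo (topspace (with_cemetery M))"
    by (rule inj_on_subset[OF inj_stereo]) simp
qed

lemma limitin_with_cemetery_iff:
  assumes M: "closed M" and X: "\<forall>\<^sub>F s in F. X s \<in> topspace (with_cemetery M)"
    and l: "l \<in> topspace (with_cemetery M)"
  shows "limitin (with_cemetery M) X l F \<longleftrightarrow> ((\<lambda>s. stereo (X s)) \<longlongrightarrow> stereo l) F"
proof
  assume "limitin (with_cemetery M) X l F"
  from continuous_map_limit[OF continuous_map_stereo[OF M] this]
  show "((\<lambda>s. stereo (X s)) \<longlongrightarrow> stereo l) F" by (simp add: comp_def)
next
  assume *: "((\<lambda>s. stereo (X s)) \<longlongrightarrow> stereo l) F"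
  from homeomorphic_map_stereo[OF M] obtain g where
    g: "homeomorphic_maps (with_cemetery M) (top_of_set (stereo_image M)) stereo g"
    unfolding homeomorphic_map_maps by blast
  have inv: "g (stereo z) = z" if "z \<in> topspace (with_cemetery M)" for z
    using g that unfolding homeomorphic_maps_def by blast
  have "limitin (top_of_set (stereo_image M)) (\<lambda>s. stereo (X s)) (stereo l) F"
    using * l X by (auto simp: limitin_subtopology elim: eventually_mono)
  from continuous_map_limit[OF _ this, of "with_cemetery M" g] g inv[OF l]
  have "limitin (with_cemetery M) (g \<circ> (\<lambda>s. stereo (X s))) l F"
    unfolding homeomorphic_maps_def by simp
  then show "limitin (with_cemetery M) X l F"
    by (rule limitin_transform_eventually[rotated])
      (use X in \<open>auto elim!: eventually_mono simp: inv\<close>)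
qed

text \<open>The Euclidean limit \<open>z\<close> may be arbitrary on the right-hand side: the image
  of \<open>stereo\<close> is compact, so a limit of its points stays in it.\<close>

lemma left_limit_with_cemetery_iff:
  fixes X :: "real \<Rightarrow> 'a::euclidean_space option"
  assumes M: "closed M" and t: "0 < t" and X: "\<And>s. 0 \<le> s \<Longrightarrow> X s \<in> topspace (with_cemetery M)"
  shows "(\<exists>l. limitin (with_cemetery M) X l (at_left t)) \<longleftrightarrow>
         (\<exists>z. ((\<lambda>s. stereo (X s)) \<longlongrightarrow> z) (at_left t))"
proof -
  have ev: "\<forall>\<^sub>F s in at_left t. X s \<in> topspace (with_cemetery M)"
    using eventually_at_left_real[OF t] by eventually_elim (use X in auto)
  show ?thesis
  proof
    assume "\<exists>l. limitin (with_cemetery M) X l (at_left t)"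
    then obtain l where l: "limitin (with_cemetery M) X l (at_left t)" by blast
    then show "\<exists>z. ((\<lambda>s. stereo (X s)) \<longlongrightarrow> z) (at_left t)"
      using limitin_with_cemetery_iff[OF M ev] limitin_topspace by metis
  next
    assume "\<exists>z. ((\<lambda>s. stereo (X s)) \<longlongrightarrow> z) (at_left t)"
    then obtain z where z: "((\<lambda>s. stereo (X s)) \<longlongrightarrow> z) (at_left t)" by blast
    have "\<forall>\<^sub>F s in at_left t. stereo (X s) \<in> stereo_image M"
      using ev by eventually_elim auto
    then have "z \<in> stereo_image M"
      using Lim_in_closed_set[OF compact_imp_closed[OF compact_stereo_image[OF M]] _ _ z] by simp
    then show "\<exists>l. limitin (with_cemetery M) X l (at_left t)"
      using z limitin_with_cemetery_iff[OF M ev] by auto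
  qed
qed

text \<open>A Lebesgue number argument: on the compact set of pairs of image points that come from
  outside \<open>W\<close>, the distance attains its minimum, which is positive because the diagonal
  lies in \<open>W\<close>. That minimum serves as \<delta>.\<close>

lemma diagonal_neighbourhood_dist:
  assumes M: "closed M" and W: "diagonal_neighbourhood (with_cemetery M) W"
  obtains \<delta> where "\<delta> > 0"
    "\<And>a b. a \<in> topspace (with_cemetery M) \<Longrightarrow> b \<in> topspace (with_cemetery M) \<Longrightarrow>
       dist (stereo a) (stereo b) < \<delta> \<Longrightarrow> (a, b) \<in> W"
proof -
  let ?S = "with_cemetery M"
  define K where "K = stereo_image M"
  from homeomorphic_map_stereo[OF M, folded K_def] obtain g where
    g: "homeomorphic_maps ?S (top_of_set K) stereo g"
    unfolding homeomorphic_map_maps by blast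
  have inv: "g (stereo z) = z" if "z \<in> topspace ?S" for z
    using g that unfolding homeomorphic_maps_def by blast
  have K: "stereo z \<in> K" if "z \<in> topspace ?S" for z
    using that unfolding K_def by blast
  have gc: "continuous_map (top_of_set K) ?S g"
    using g unfolding homeomorphic_maps_def by blast
  have W': "openin (prod_topology ?S ?S) W" "\<And>a. a \<in> topspace ?S \<Longrightarrow> (a, a) \<in> W"
    using W unfolding diagonal_neighbourhood_def by auto
  define P where "P = {p \<in> K \<times> K. (\<lambda>(a, b). (g a, g b)) p \<in> W}"
  have gg: "continuous_map (top_of_set (K \<times> K)) (prod_topology ?S ?S) (\<lambda>(a, b). (g a, g b))"
    unfolding prod_topology_subtopology_eu[symmetric] continuous_map_prod_top using gc by blast
  have "openin (top_of_set (K \<times> K)) P"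
    using openin_continuous_map_preimage[OF gg W'(1)] unfolding P_def by simp
  then have "closedin (top_of_set (K \<times> K)) (K \<times> K - P)"
    by (metis closedin_diff closedin_topspace topspace_euclidean_subtopology)
  moreover have "compact (K \<times> K)"
    using compact_Times compact_stereo_image[OF M] unfolding K_def by blast
  ultimately have C: "compact (K \<times> K - P)" using closedin_compact by blast
  have notP: "(stereo a, stereo b) \<in> K \<times> K - P" 
    if "a \<in> topspace ?S" "b \<in> topspace ?S" "(a, b) \<notin> W" for a b
    using K that inv unfolding P_def by simp
  show thesis
  proof (cases "K \<times> K - P = {}")
    case True
    then have "(a, b) \<in> W" if "a \<in> topspace ?S" "b \<in> topspace ?S" for a b
      using notP[OF that] by blast
    then show ?thesis using that[OF zero_less_one] by blast
  next
    case False
    have "continuous_on (K \<times> K - P) (\<lambda>p. dist (fst p) (snd p))" by (intro continuous_intros)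
    from continuous_attains_inf[OF C False this] obtain p where
      p: "p \<in> K \<times> K - P" "\<And>q. q \<in> K \<times> K - P \<Longrightarrow> dist (fst p) (snd p) \<le> dist (fst q) (snd q)" by blast
    have "fst p \<noteq> snd p"
    proof
      assume "fst p = snd p"
      moreover have "fst p \<in> K" using p(1) by auto
      then obtain a where a: "a \<in> topspace ?S" "fst p = stereo a" unfolding K_def by blast
      ultimately have "p = (stereo a, stereo a)" by (metis prod.collapse)
      then show False using p(1) inv[OF a(1)] W'(2)[OF a(1)] unfolding P_def by simp
    qed
    then have "dist (fst p) (snd p) > 0" by simp
    moreover have "(a, b) \<in> W" if "a \<in> topspace ?S" "b \<in> topspace ?S"
      "dist (stereo a) (stereo b) < dist (fst p) (snd p)" for a b
      using p(2)[OF notP[OF that(1,2)]] that(3) by fastforce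
    ultimately show ?thesis using that by blast
  qed
qed

section \<open>Time changes\<close>

lemma composed_time_change:
  assumes "\<tau> \<in> time_changes" "\<sigma> \<in> time_changes"
  shows "\<sigma> \<circ> \<tau> \<in> time_changes"
proof -
  have im: "\<tau> ` {0..} = {0..}" "\<sigma> ` {0..} = {0..}"
    using assms unfolding time_changes_def bij_betw_def by auto
  have "continuous_on {0..} (\<sigma> \<circ> \<tau>)"
    using assms im unfolding time_changes_def by (intro continuous_on_compose) auto
  moreover have "strict_mono_on {0..} (\<sigma> \<circ> \<tau>)"
  proof (rule strict_mono_onI)
    fix r s :: real assume "r \<in> {0..}" "s \<in> {0..}" "r < s"
    moreover from this have "\<tau> r < \<tau> s"
      using assms unfolding time_changes_def by (auto simp: strict_mono_on_def)
    moreover have "\<tau> r \<in> {0..}" "\<tau> s \<in> {0..}" using calculation im by blast+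
    moreover have "0 \<le> \<tau> s" using calculation by simp
    moreover have "strict_mono_on {0..} \<sigma>" using assms unfolding time_changes_def by blast
    ultimately show "(\<sigma> \<circ> \<tau>) r < (\<sigma> \<circ> \<tau>) s"
      by (simp add: strict_mono_on_def)
  qed
  moreover have "bij_betw (\<sigma> \<circ> \<tau>) {0..} {0..}"
    using assms unfolding time_changes_def by (auto intro: bij_betw_trans)
  ultimately show ?thesis unfolding time_changes_def by blast
qed

lemma time_changesI:
  assumes c: "continuous_on {0..} \<tau>" and m: "strict_mono_on {0..} \<tau>" and z: "\<tau> 0 = 0"
    and u: "\<And>y. \<exists>x\<ge>0. y \<le> \<tau> x"
  shows "\<tau> \<in> time_changes"
proof -
  have "\<tau> ` {0..} = {0..}"
  proof (intro equalityI subsetI)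
    fix y assume "y \<in> \<tau> ` {0..}"
    then show "y \<in> {0..}"
      using strict_mono_on_leD[OF m, of 0] z by auto
  next
    fix y :: real assume y: "y \<in> {0..}"
    obtain x where x: "x \<ge> 0" "y \<le> \<tau> x" using u by blast
    have "continuous_on {0..x} \<tau>" by (rule continuous_on_subset[OF c]) auto
    from IVT'[of \<tau> 0 y x, OF _ x(2,1) this] y z obtain x' where "0 \<le> x'" "\<tau> x' = y" by auto
    then show "y \<in> \<tau> ` {0..}" by blast
  qed
  then show ?thesis
    using c m strict_mono_on_imp_inj_on[OF m] unfolding time_changes_def bij_betw_def by blast
qed

text \<open>The elementary correction behind \<open>time_change_matching\<close>: it changes the
  length of one interval, leaves the past alone and only translates the future.\<close>

lemma piecewise_time_change:
  fixes p \<alpha> \<beta> :: real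
  assumes "0 \<le> p" "0 < \<alpha>" "0 < \<beta>"
  obtains \<sigma> where "\<sigma> \<in> time_changes"
    and "\<And>u. u \<le> p \<Longrightarrow> \<sigma> u = u"
    and "\<And>u. p \<le> u \<Longrightarrow> u \<le> p + \<alpha> \<Longrightarrow> \<sigma> u = p + (\<beta> / \<alpha>) * (u - p)"
    and "\<And>u. p + \<alpha> \<le> u \<Longrightarrow> \<sigma> u = u + \<beta> - \<alpha>"
proof -
  \<comment> \<open>The summands measure the time spent before \<open>p\<close>, inside the window
    and after it; only the middle one is rescaled. Each is nondecreasing, and on each of the three
    ranges one of them increases strictly.\<close>
  define \<sigma> where "\<sigma> = (\<lambda>u. min u p + (\<beta> / \<alpha>) * min (max (u - p) 0) \<alpha> + max (u - p - \<alpha>) 0)"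
  have 1: "\<sigma> u = u" if "u \<le> p" for u
  proof -
    have "min u p = u" "max (u - p) 0 = 0" "max (u - p - \<alpha>) 0 = 0" using that assms by auto
    then show ?thesis using assms unfolding \<sigma>_def by simp
  qed
  have 2: "\<sigma> u = p + (\<beta> / \<alpha>) * (u - p)" if "p \<le> u" "u \<le> p + \<alpha>" for u
  proof -
    have "min u p = p" "max (u - p) 0 = u - p" "min (u - p) \<alpha> = u - p" "max (u - p - \<alpha>) 0 = 0"
      using that assms by auto
    then show ?thesis unfolding \<sigma>_def by simp
  qed
  have 3: "\<sigma> u = u + \<beta> - \<alpha>" if "p + \<alpha> \<le> u" for u
  proof -
    have "min u p = p" "max (u - p) 0 = u - p" "min (u - p) \<alpha> = \<alpha>" "max (u - p - \<alpha>) 0 = u - p - \<alpha>"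
      using that assms by auto
    then show ?thesis using assms unfolding \<sigma>_def by simp
  qed
  have slope: "\<beta> / \<alpha> > 0" using assms by simp
  have lt: "\<sigma> u < \<sigma> v" if "u < v" for u v
  proof -
    have m: "min u p \<le> min v p" "(\<beta> / \<alpha>) * min (max (u - p) 0) \<alpha> \<le> (\<beta> / \<alpha>) * min (max (v - p) 0) \<alpha>"
      "max (u - p - \<alpha>) 0 \<le> max (v - p - \<alpha>) 0"
      by (intro mult_left_mono min.mono max.mono less_imp_le[OF slope]; use that in simp)+
    consider "u < p" | "p \<le> u" "u < p + \<alpha>" | "p + \<alpha> \<le> u" by linarith
    then show ?thesis
    proof cases
      case 1
      then have "min u p < min v p" using that by auto
      then show ?thesis using m unfolding \<sigma>_def by linarith
    next
      case 2
      then have "(\<beta> / \<alpha>) * min (max (u - p) 0) \<alpha> < (\<beta> / \<alpha>) * min (max (v - p) 0) \<alpha>"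
        by (intro mult_strict_left_mono slope) (use that assms in \<open>auto simp: min_def max_def\<close>)
      then show ?thesis using m unfolding \<sigma>_def by linarith
    next
      case 3
      then have "max (u - p - \<alpha>) 0 < max (v - p - \<alpha>) 0" using that by auto
      then show ?thesis using m unfolding \<sigma>_def by linarith
    qed
  qed
  have "\<sigma> \<in> time_changes"
  proof (rule time_changesI)
    show "continuous_on {0..} \<sigma>" unfolding \<sigma>_def by (intro continuous_intros) (use assms in auto)
    show "strict_mono_on {0..} \<sigma>" using lt by (auto intro: strict_mono_onI)
    show "\<sigma> 0 = 0" using 1 assms by simp
    show "\<exists>x\<ge>0. y \<le> \<sigma> x" for y
      using 3[of "max y 0 + p + \<alpha>"] assms by (intro exI[of _ "max y 0 + p + \<alpha>"]) auto
  qed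
  then show thesis using 1 2 3 that by blast
qed

lemma id_time_change: "(\<lambda>s. s) \<in> time_changes"
proof (rule time_changesI)
  show "\<exists>x\<ge>0. y \<le> x" for y :: real by (intro exI[of _ "max y 0"]) auto
qed (auto intro: strict_mono_onI)

text \<open>Induction on \<open>m\<close>: the change built for the first \<open>m\<close> intervals
  is a translation after \<open>a m\<close>, an invariant kept in the statement, so composing it
  with a rescaling of the next interval leaves earlier intervals untouched. On the new interval the
  displacement is a convex combination of the displacements at its end points, so the bound
  \<epsilon> does not deteriorate.\<close>

lemma time_change_matching:
  fixes a b :: "nat \<Rightarrow> real"
  assumes "a 0 = 0" "b 0 = 0" "\<And>i. i < m \<Longrightarrow> a i < a (Suc i)" "\<And>i. i < m \<Longrightarrow> b i < b (Suc i)"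
    and "\<And>i. i \<le> m \<Longrightarrow> \<bar>b i - a i\<bar> < \<epsilon>"
  shows "\<exists>\<tau>\<in>time_changes. (\<forall>s\<ge>0. \<bar>\<tau> s - s\<bar> < \<epsilon>) \<and> (\<forall>s\<ge>a m. \<tau> s = s + (b m - a m)) \<and>
           (\<forall>i<m. \<forall>s\<in>{a i..<a (Suc i)}. \<tau> s \<in> {b i..<b (Suc i)})"
  using assms
proof (induction m)
  case 0
  then show ?case using id_time_change by (intro bexI[of _ "\<lambda>s. s"]) auto
next
  case (Suc m)
  obtain \<tau> where \<tau>: "\<tau> \<in> time_changes" "\<And>s. s \<ge> 0 \<Longrightarrow> \<bar>\<tau> s - s\<bar> < \<epsilon>"
    "\<And>s. s \<ge> a m \<Longrightarrow> \<tau> s = s + (b m - a m)"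
    "\<And>i s. i < m \<Longrightarrow> s \<in> {a i..<a (Suc i)} \<Longrightarrow> \<tau> s \<in> {b i..<b (Suc i)}"
  proof -
    have "\<exists>\<tau>\<in>time_changes. (\<forall>s\<ge>0. \<bar>\<tau> s - s\<bar> < \<epsilon>) \<and> (\<forall>s\<ge>a m. \<tau> s = s + (b m - a m)) \<and>
        (\<forall>i<m. \<forall>s\<in>{a i..<a (Suc i)}. \<tau> s \<in> {b i..<b (Suc i)})"
      by (rule Suc.IH; use Suc.prems in simp)
    then show thesis using that by blast
  qed
  have a0: "a 0 = 0" and mono_step: "\<And>i. i < m \<Longrightarrow> a i < a (Suc i)" using Suc.prems by auto
  have mono: "a i \<le> a m \<and> b i \<le> b m" if "i \<le> m" for i
    using that
  proof (induction rule: inc_induct)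
    case (step n) then show ?case using Suc.prems(3,4)[of n] by auto
  qed simp
  have nonneg: "0 \<le> a m" "0 \<le> b m" using mono[of 0] Suc.prems by auto
  let ?\<alpha> = "a (Suc m) - a m" and ?\<beta> = "b (Suc m) - b m"
  have pos: "0 < ?\<alpha>" "0 < ?\<beta>" using Suc.prems(3,4)[of m] by auto
  obtain \<sigma> where \<sigma>: "\<sigma> \<in> time_changes"
    "\<And>u. u \<le> b m \<Longrightarrow> \<sigma> u = u"
    "\<And>u. b m \<le> u \<Longrightarrow> u \<le> b m + ?\<alpha> \<Longrightarrow> \<sigma> u = b m + (?\<beta> / ?\<alpha>) * (u - b m)"
    "\<And>u. b m + ?\<alpha> \<le> u \<Longrightarrow> \<sigma> u = u + ?\<beta> - ?\<alpha>"
    using piecewise_time_change[OF nonneg(2) pos] by blast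
  have before: "\<sigma> (\<tau> s) = \<tau> s" if "0 \<le> s" "s < a m" for s
  proof -
    have "\<tau> s < \<tau> (a m)"
      using \<tau>(1) that unfolding time_changes_def by (auto simp: strict_mono_on_def)
    then show ?thesis using \<sigma>(2) \<tau>(3)[of "a m"] by simp
  qed
  have mid: "\<sigma> (\<tau> s) = b m + (?\<beta> / ?\<alpha>) * (s - a m)" if "a m \<le> s" "s \<le> a (Suc m)" for s
    using \<sigma>(3)[of "\<tau> s"] \<tau>(3)[of s] that by simp
  have after: "\<sigma> (\<tau> s) = s + (b (Suc m) - a (Suc m))" if "a (Suc m) \<le> s" for s
    using \<sigma>(4)[of "\<tau> s"] \<tau>(3)[of s] that pos by simp
  have frac: "0 \<le> (s - a m) / ?\<alpha>" "(s - a m) / ?\<alpha> < 1" if "a m \<le> s" "s < a (Suc m)" for s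
    using that pos by simp_all
  have close: "\<bar>\<sigma> (\<tau> s) - s\<bar> < \<epsilon>" if "s \<ge> 0" for s
  proof -
    consider "s < a m" | "a m \<le> s" "s < a (Suc m)" | "a (Suc m) \<le> s" by linarith
    then show ?thesis
    proof cases
      case 1 then show ?thesis using before \<tau>(2) that by simp
    next
      case 2
      \<comment> \<open>The relative position of \<open>s\<close> in the new interval; both
        \<open>s\<close> and its image are affine in it.\<close>
      define \<theta> where "\<theta> = (s - a m) / ?\<alpha>"
      have \<theta>: "0 \<le> \<theta>" "\<theta> < 1" using frac[OF 2] unfolding \<theta>_def by auto
      have s: "s = a m + \<theta> * ?\<alpha>" using pos unfolding \<theta>_def by simp
      have "\<sigma> (\<tau> s) = b m + \<theta> * ?\<beta>" using mid 2 unfolding \<theta>_def by (simp add: mult.commute)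
      then have "\<sigma> (\<tau> s) - (a m + \<theta> * ?\<alpha>) = (1 - \<theta>) * (b m - a m) + \<theta> * (b (Suc m) - a (Suc m))"
        by (simp add: algebra_simps)
      then have "\<bar>\<sigma> (\<tau> s) - s\<bar> = \<bar>(1 - \<theta>) * (b m - a m) + \<theta> * (b (Suc m) - a (Suc m))\<bar>"
        unfolding s[symmetric] by simp
      also have "\<dots> \<le> (1 - \<theta>) * \<bar>b m - a m\<bar> + \<theta> * \<bar>b (Suc m) - a (Suc m)\<bar>"
        using \<theta> abs_triangle_ineq[of "(1 - \<theta>) * (b m - a m)" "\<theta> * (b (Suc m) - a (Suc m))"]
        by (simp add: abs_mult)
      also have "\<dots> < \<epsilon>"
        using convex_bound_lt[of "\<bar>b m - a m\<bar>" \<epsilon> "\<bar>b (Suc m) - a (Suc m)\<bar>" "1 - \<theta>" \<theta>]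
          \<theta> Suc.prems(5)[of m] Suc.prems(5)[of "Suc m"] by simp
      finally show ?thesis .
    next
      case 3 then show ?thesis using after Suc.prems(5)[of "Suc m"] by simp
    qed
  qed
  have "(\<sigma> \<circ> \<tau>) s \<in> {b i..<b (Suc i)}" if i: "i < Suc m" and s: "s \<in> {a i..<a (Suc i)}" for i s
  proof (cases "i = m")
    case True
    then have sm: "a m \<le> s" "s < a (Suc m)" using s by auto
    define \<theta> where "\<theta> = (s - a m) / ?\<alpha>"
    have \<theta>: "0 \<le> \<theta>" "\<theta> < 1" using frac[OF sm] unfolding \<theta>_def by auto
    have "\<sigma> (\<tau> s) = b m + \<theta> * ?\<beta>"
      using mid[OF sm(1) less_imp_le[OF sm(2)]] unfolding \<theta>_def by simp
    moreover have "0 \<le> \<theta> * ?\<beta>" "\<theta> * ?\<beta> < 1 * ?\<beta>"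
      using \<theta> pos by (intro mult_nonneg_nonneg mult_strict_right_mono; simp)+
    ultimately show ?thesis unfolding True by simp
  next
    case False
    then have im: "i < m" using i by simp
    have "0 \<le> a i" using im
    proof (induction i)
      case (Suc j)
      then show ?case using Suc_lessD[of j m] Suc.prems Suc.IH mono_step[of j] by simp
    qed (simp add: a0)
    then have "0 \<le> s" using s by simp
    moreover have "s < a m" using s mono[of "Suc i"] im by auto
    ultimately show ?thesis using \<tau>(4)[OF im s] before by simp
  qed
  then have "\<forall>i<Suc m. \<forall>s\<in>{a i..<a (Suc i)}. (\<sigma> \<circ> \<tau>) s \<in> {b i..<b (Suc i)}" by blast
  moreover have "\<forall>s\<ge>0. \<bar>(\<sigma> \<circ> \<tau>) s - s\<bar> < \<epsilon>" using close by simp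
  moreover have "\<forall>s\<ge>a (Suc m). (\<sigma> \<circ> \<tau>) s = s + (b (Suc m) - a (Suc m))" using after by simp
  ultimately show ?case using composed_time_change[OF \<tau>(1) \<sigma>(1)] by blast
qed

section \<open>Exit times and cylinder events\<close>

text \<open>The infimum runs over rational times, so that exit times depend on countably many
  coordinates; for a right-continuous path this loses nothing, as being farther than \<eta> from a
  centre is an open condition. The alternative \<open>T \<le> r\<close> caps the times at
  \<open>T\<close> and, for rational \<open>T\<close>, keeps the set nonempty.\<close>

primrec exit_time :: "(real \<Rightarrow> 'b::metric_space) \<Rightarrow> real \<Rightarrow> real \<Rightarrow> (nat \<Rightarrow> 'b) \<Rightarrow> nat \<Rightarrow> real" where
  "exit_time Z \<eta> T v 0 = 0"
| "exit_time Z \<eta> T v (Suc i) =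
     Inf {r \<in> \<rat>. exit_time Z \<eta> T v i \<le> r \<and> (\<eta> < dist (Z r) (v i) \<or> T \<le> r)}"

declare exit_time.simps(2) [simp del]

lemma exit_time_bounds:
  assumes "T \<in> \<rat>" "0 < T"
  shows "0 \<le> exit_time Z \<eta> T v i" "exit_time Z \<eta> T v i \<le> T"
    and "exit_time Z \<eta> T v i \<le> exit_time Z \<eta> T v (Suc i)"
proof -
  have *: "0 \<le> exit_time Z \<eta> T v i \<and> exit_time Z \<eta> T v i \<le> T \<and>
      exit_time Z \<eta> T v i \<le> exit_time Z \<eta> T v (Suc i)" for i
  proof (induction i)
    case 0
    have "0 \<le> exit_time Z \<eta> T v (Suc 0)"
      unfolding exit_time.simps
    proof (rule cInf_greatest)
      show "{r \<in> \<rat>. 0 \<le> r \<and> (\<eta> < dist (Z r) (v 0) \<or> T \<le> r)} \<noteq> {}"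
        using assms by (intro ex_in_conv[THEN iffD1] exI[of _ T]) simp
    qed simp
    then show ?case using assms by simp
  next
    case (Suc i)
    let ?S = "\<lambda>i. {r \<in> \<rat>. exit_time Z \<eta> T v i \<le> r \<and> (\<eta> < dist (Z r) (v i) \<or> T \<le> r)}"
    have 1: "exit_time Z \<eta> T v (Suc i) \<le> T"
      unfolding exit_time.simps using Suc assms
      by (intro cInf_lower bdd_belowI[of _ "exit_time Z \<eta> T v i"]) auto
    have "exit_time Z \<eta> T v (Suc i) \<le> exit_time Z \<eta> T v (Suc (Suc i))"
      unfolding exit_time.simps(2)[of Z \<eta> T v "Suc i"]
      using 1 assms by (intro cInf_greatest) auto
    then show ?case using 1 Suc by linarith
  qed
  show "0 \<le> exit_time Z \<eta> T v i" "exit_time Z \<eta> T v i \<le> T"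
    "exit_time Z \<eta> T v i \<le> exit_time Z \<eta> T v (Suc i)" using * by auto
qed

text \<open>Strict sublevel sets of an infimum are unions, here countable ones, whether or not the
  infimum is attained. This form yields measurability.\<close>

lemma exit_time_Suc_less_iff:
  assumes "T \<in> \<rat>" "0 < T"
  shows "exit_time Z \<eta> T v (Suc i) < t \<longleftrightarrow>
     (\<exists>r\<in>\<rat> \<inter> {0..<t}. exit_time Z \<eta> T v i \<le> r \<and> (\<eta> < dist (Z r) (v i) \<or> T \<le> r))"
proof -
  let ?S = "{r \<in> \<rat>. exit_time Z \<eta> T v i \<le> r \<and> (\<eta> < dist (Z r) (v i) \<or> T \<le> r)}"
  have "T \<in> ?S" using exit_time_bounds(2)[OF assms] assms by auto
  moreover have "bdd_below ?S" by (rule bdd_belowI[of _ "exit_time Z \<eta> T v i"]) auto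
  ultimately have "Inf ?S < t \<longleftrightarrow> (\<exists>r\<in>?S. r < t)" by (intro cInf_less_iff) auto
  also have "\<dots> \<longleftrightarrow> (\<exists>r\<in>\<rat> \<inter> {0..<t}. exit_time Z \<eta> T v i \<le> r \<and> (\<eta> < dist (Z r) (v i) \<or> T \<le> r))"
    using order_trans[OF exit_time_bounds(1)[OF assms, of Z \<eta> v i]] by auto
  finally show ?thesis unfolding exit_time.simps .
qed

lemma exit_time_measurable:
  fixes Z :: "'w \<Rightarrow> real \<Rightarrow> 'b::{metric_space, second_countable_topology}"
  assumes T: "T \<in> \<rat>" "0 < T"
    and Z: "\<And>r. 0 \<le> r \<Longrightarrow> (\<lambda>\<omega>. Z \<omega> r) \<in> borel_measurable N"
  shows "(\<lambda>\<omega>. exit_time (Z \<omega>) \<eta> T v i) \<in> borel_measurable N"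
proof (induction i)
  case (Suc i)
  note Suc[measurable]
  show ?case
    unfolding borel_measurable_iff_less
  proof
    fix t :: real
    have "{\<omega> \<in> space N. exit_time (Z \<omega>) \<eta> T v (Suc i) < t} =
      (\<Union>r\<in>\<rat> \<inter> {0..<t}. {\<omega> \<in> space N. exit_time (Z \<omega>) \<eta> T v i \<le> r \<and> (\<eta> < dist (Z \<omega> r) (v i) \<or> T \<le> r)})"
      by (auto simp: exit_time_Suc_less_iff[OF T])
    also have "\<dots> \<in> sets N"
    proof (rule sets.countable_UN'')
      show "countable (\<rat> \<inter> {0..<t})" by (intro countable_Int1 countable_rat)
      fix r :: real assume "r \<in> \<rat> \<inter> {0..<t}"
      then have [measurable]: "(\<lambda>\<omega>. Z \<omega> r) \<in> borel_measurable N" using Z by auto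
      show "{\<omega> \<in> space N. exit_time (Z \<omega>) \<eta> T v i \<le> r \<and> (\<eta> < dist (Z \<omega> r) (v i) \<or> T \<le> r)} \<in> sets N"
        by measurable
    qed
    finally show "{\<omega> \<in> space N. exit_time (Z \<omega>) \<eta> T v (Suc i) < t} \<in> sets N" .
  qed
qed simp

text \<open>The claim includes irrational \<open>r\<close>: a distance above \<eta> at
  \<open>r\<close> would persist by right continuity at some rational time still before the
  exit.\<close>

lemma dist_before_exit_time:
  assumes T: "T \<in> \<rat>" "0 < T" and r: "exit_time Z \<eta> T v i \<le> r" "r < exit_time Z \<eta> T v (Suc i)"
    and rc: "(Z \<longlongrightarrow> Z r) (at_right r)"
  shows "dist (Z r) (v i) \<le> \<eta>"
proof (rule ccontr)
  assume "\<not> ?thesis"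
  moreover have "((\<lambda>s. dist (Z s) (v i)) \<longlongrightarrow> dist (Z r) (v i)) (at_right r)"
    by (intro tendsto_intros rc)
  ultimately have "\<forall>\<^sub>F s in at_right r. \<eta> < dist (Z s) (v i)"
    by (intro order_tendstoD(1)) auto
  then obtain b where b: "b > r" "\<And>s. r < s \<Longrightarrow> s < b \<Longrightarrow> \<eta> < dist (Z s) (v i)"
    unfolding eventually_at_right_field by blast
  obtain q where q: "q \<in> \<rat>" "r < q" "q < min b (exit_time Z \<eta> T v (Suc i))"
    using Rats_dense_in_real[of r "min b (exit_time Z \<eta> T v (Suc i))"] b r by auto
  have "0 \<le> q" using exit_time_bounds(1)[OF T, of Z \<eta> v i] r q by linarith
  then have "exit_time Z \<eta> T v (Suc i) < exit_time Z \<eta> T v (Suc i)"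
    unfolding exit_time_Suc_less_iff[OF T] using q r b by (intro bexI[of _ q]) auto
  then show False by simp
qed

text \<open>The centres are chosen greedily: each one approximates the value at the previous exit time.
  Infinitely many exits before \<open>T\<close> would accumulate at a point without left limit.\<close>

lemma exit_times_reach:
  fixes Z :: "real \<Rightarrow> 'b::metric_space"
  assumes T: "T \<in> \<rat>" "0 < T" and \<eta>: "0 < \<eta>"
    and rc: "\<And>t. 0 \<le> t \<Longrightarrow> (Z \<longlongrightarrow> Z t) (at_right t)"
    and ll: "\<And>t. 0 < t \<Longrightarrow> \<exists>z. (Z \<longlongrightarrow> z) (at_left t)"
    and D: "\<And>z \<epsilon>. 0 < \<epsilon> \<Longrightarrow> \<exists>d\<in>D. dist z d < \<epsilon>"
  obtains m v where "exit_time Z \<eta> T v m = T" "\<And>i. v i \<in> D"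
    "\<And>i. i < m \<Longrightarrow> exit_time Z \<eta> T v i < exit_time Z \<eta> T v (Suc i)"
proof -
  define near where "near z = (SOME d. d \<in> D \<and> dist z d < \<eta> / 2)" for z
  have near: "near z \<in> D" "dist z (near z) < \<eta> / 2" for z
    using someI_ex[of "\<lambda>d. d \<in> D \<and> dist z d < \<eta> / 2"] D[of "\<eta>/2" z] \<eta> unfolding near_def by auto
  \<comment> \<open>Each centre depends on the previous exit time and each exit time on the centre,
    so both are produced by one recursion on the times; the next facts identify \<open>c\<close>
    with the exit times for the centres \<open>v\<close>.\<close>
  define c where "c = rec_nat 0 (\<lambda>_ c. Inf {r \<in> \<rat>. c \<le> r \<and> (\<eta> < dist (Z r) (near (Z c)) \<or> T \<le> r)})"
  define v where "v i = near (Z (c i))" for i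
  have c: "exit_time Z \<eta> T v i = c i" for i
    by (induction i) (simp_all add: c_def v_def exit_time.simps(2))
  note bounds = exit_time_bounds[OF T, of Z \<eta> v, unfolded c]
  \<comment> \<open>The path starts each round within \<eta>/2 of its centre, so right continuity
    keeps it within \<eta> for a positive time.\<close>
  have strict: "c i < c (Suc i)" if "c i < T" for i
  proof -
    have "((\<lambda>s. dist (Z s) (v i)) \<longlongrightarrow> dist (Z (c i)) (v i)) (at_right (c i))"
      by (intro tendsto_intros rc bounds)
    then have "\<forall>\<^sub>F s in at_right (c i). dist (Z s) (v i) < \<eta>"
      using near(2)[of "Z (c i)"] \<eta> by (auto simp: v_def dest!: order_tendstoD(2)[where a = \<eta>])
    then obtain b where b: "b > c i" "\<And>s. c i < s \<Longrightarrow> s < b \<Longrightarrow> dist (Z s) (v i) < \<eta>"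
      unfolding eventually_at_right_field by blast
    have "\<not> c (Suc i) < min b T"
      unfolding exit_time_Suc_less_iff[OF T, of Z \<eta> v i, unfolded c]
    proof
      assume "\<exists>r\<in>\<rat> \<inter> {0..<min b T}. c i \<le> r \<and> (\<eta> < dist (Z r) (v i) \<or> T \<le> r)"
      then obtain r where r: "r < b" "r < T" "c i \<le> r" "\<eta> < dist (Z r) (v i)" by auto
      moreover have "r \<noteq> c i" using r near(2)[of "Z (c i)"] \<eta> by (auto simp: v_def)
      ultimately show False using b(2)[of r] by simp
    qed
    then have "min b T \<le> c (Suc i)" by (simp only: not_less)
    then show ?thesis using b(1) that by linarith
  qed
  have "\<exists>m. c m = T"
  proof (rule ccontr)
    assume "\<nexists>m. c m = T"
    then have less: "c i < T" for i using bounds(2)[of i] by (metis less_le)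
    have inc: "incseq c" by (intro incseq_SucI less_imp_le strict less)
    moreover have "bdd_above (range c)" using less by (intro bdd_aboveI[of _ T]) (auto intro: less_imp_le)
    ultimately have lim: "c \<longlonglongrightarrow> (SUP i. c i)" by (intro LIMSEQ_incseq_SUP)
    define b where "b = (SUP i. c i)"
    have le: "c i \<le> b" for i unfolding b_def by (rule incseq_le[OF inc lim])
    have cb: "c i < b" for i using strict[OF less, of i] le[of "Suc i"] by simp
    have "0 < b" using cb[of 0] bounds(1)[of 0] by linarith
    then obtain z where z: "(Z \<longlongrightarrow> z) (at_left b)" using ll by blast
    \<comment> \<open>Close to the accumulation point \<open>b\<close>, the value at an exit time
      and all later values are within \<eta>/8 of the left limit, and the centre is within \<eta>/2
      of the former. The sum stays below \<eta>, so the next exit cannot happen before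
      \<open>b\<close>.\<close>
    then have "\<forall>\<^sub>F s in at_left b. dist (Z s) z < \<eta> / 8" using tendstoD[OF z, of "\<eta>/8"] \<eta> by simp
    then obtain a where a: "a < b" "\<And>s. a < s \<Longrightarrow> s < b \<Longrightarrow> dist (Z s) z < \<eta> / 8"
      unfolding eventually_at_left_field by blast
    have "\<forall>\<^sub>F i in sequentially. a < c i" using order_tendstoD(1)[OF lim] a unfolding b_def by blast
    then obtain i where i: "a < c i" by (auto simp: eventually_sequentially)
    have "c (Suc i) < b" by (rule cb)
    then obtain r where r: "r < b" "c i \<le> r" "\<eta> < dist (Z r) (v i) \<or> T \<le> r"
      unfolding exit_time_Suc_less_iff[OF T, of Z \<eta> v i, unfolded c] by auto
    have "b \<le> T" unfolding b_def using less by (intro cSUP_least) (auto intro: less_imp_le)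
    then have "\<eta> < dist (Z r) (v i)" using r by auto
    also have "\<dots> \<le> dist (Z r) z + dist (Z (c i)) z + dist (Z (c i)) (v i)"
      by (metis add.commute add_le_cancel_left dist_commute dist_triangle dist_triangle_le group_cancel.add1)
    also have "\<dots> < \<eta> / 8 + \<eta> / 8 + \<eta> / 2"
      using a(2)[of r] a(2)[of "c i"] r i cb[of i] near(2)[of "Z (c i)"] unfolding v_def by (intro add_strict_mono) auto
    finally show False using \<eta> by simp
  qed
  then obtain k where k: "c k = T" by blast
  define m where "m = (LEAST m. c m = T)"
  have "c m = T" unfolding m_def by (rule LeastI[of _ k]) (rule k)
  moreover have "c i < c (Suc i)" if "i < m" for i
    using not_less_Least[OF that[unfolded m_def]] bounds(2)[of i] by (intro strict) (simp add: less_le)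
  ultimately show thesis using that[of v m] near(1) c unfolding v_def by simp
qed

section \<open>The sigma-field generated by the coordinates\<close>

definition cylinder :: "real set \<Rightarrow> (real \<Rightarrow> 'a set) \<Rightarrow> (real \<Rightarrow> 'a option) set" where
  "cylinder I A = {X. \<forall>t\<in>I. X t \<in> Some ` A t}"

text \<open>Only living values are prescribed; the event of being in the cemetery at a given time
  comes back as a complement. The empty index set is allowed so that \<open>UNIV\<close> belongs to
  the family, as the uniqueness theorem for measures requires.\<close>

definition cylinders :: "(real \<Rightarrow> 'a::topological_space option) set set" where
  "cylinders = {cylinder I A | I A. finite I \<and> I \<subseteq> {0..} \<and> (\<forall>t\<in>I. A t \<in> sets borel)}"

text \<open>The base space consists of all functions, because being cadlag involves uncountably many
  coordinates. Skorokhod events are matched with events of this sigma-field only on the paths that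
  matter.\<close>

definition path_sigma :: "(real \<Rightarrow> 'a::topological_space option) measure" where
  "path_sigma = sigma UNIV cylinders"

lemma space_path_sigma [simp]: "space path_sigma = UNIV"
  unfolding path_sigma_def by simp

lemma sets_path_sigma: "sets path_sigma = sigma_sets UNIV cylinders"
  unfolding path_sigma_def by simp

lemma Int_stable_cylinders: "Int_stable cylinders"
proof (rule Int_stableI)
  fix C D :: "(real \<Rightarrow> 'a option) set" assume "C \<in> cylinders" "D \<in> cylinders"
  then obtain I A J B where *: "C = cylinder I A" "D = cylinder J B" "finite I" "finite J"
    "I \<subseteq> {0..}" "J \<subseteq> {0..}" "\<And>t. t \<in> I \<Longrightarrow> A t \<in> sets borel" "\<And>t. t \<in> J \<Longrightarrow> B t \<in> sets borel"
    unfolding cylinders_def by blast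
  let ?E = "\<lambda>t. (if t \<in> I then A t else UNIV) \<inter> (if t \<in> J then B t else UNIV)"
  have "C \<inter> D = cylinder (I \<union> J) ?E"
  proof (rule set_eqI)
    fix X :: "real \<Rightarrow> 'a option"
    have "X t \<in> Some ` ?E t \<longleftrightarrow> (t \<in> I \<longrightarrow> X t \<in> Some ` A t) \<and> (t \<in> J \<longrightarrow> X t \<in> Some ` B t)"
      if "t \<in> I \<union> J" for t
      using that by (cases "X t") auto
    then show "X \<in> C \<inter> D \<longleftrightarrow> X \<in> cylinder (I \<union> J) ?E"
      unfolding * cylinder_def by blast
  qed
  moreover have "?E t \<in> sets borel" for t using *(7,8)[of t] by auto
  ultimately show "C \<inter> D \<in> cylinders" unfolding cylinders_def using *(3-6) by blast
qed

lemma coordinate_in_path_sigma: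
  assumes "0 \<le> t" "A \<in> sets borel"
  shows "{X. X t \<in> Some ` A} \<in> sets path_sigma"
proof -
  have "cylinder {t} (\<lambda>_. A) \<in> cylinders"
    unfolding cylinders_def using assms by blast
  then show ?thesis
    unfolding sets_path_sigma cylinder_def by (intro sigma_sets.Basic) simp
qed

lemma coordinate_None_in_path_sigma:
  fixes t :: real
  assumes "0 \<le> t"
  shows "{X::real \<Rightarrow> 'a::topological_space option. X t = None} \<in> sets path_sigma"
proof -
  have "space path_sigma - {X. X t \<in> Some ` (UNIV :: 'a set)} \<in> sets path_sigma"
    by (intro sets.compl_sets coordinate_in_path_sigma assms borel_open open_UNIV)
  also have "space path_sigma - {X. X t \<in> Some ` (UNIV :: 'a set)} = {X. X t = None}"
    by (auto simp: notin_range_Some)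
  finally show ?thesis .
qed

lemma stereo_coordinate_measurable:
  fixes t :: real
  assumes "0 \<le> t"
  shows "(\<lambda>X. stereo (X t)) \<in> borel_measurable (path_sigma :: (real \<Rightarrow> 'a::euclidean_space option) measure)"
proof (rule measurableI)
  fix C :: "('a \<times> real) set" assume C: "C \<in> sets borel"
  have "{x. stereo (Some x) \<in> C} \<in> sets borel"
    using measurable_sets[OF borel_measurable_continuous_onI[OF continuous_on_stereo_Some] C]
    by (simp add: vimage_def)
  note coordinate_in_path_sigma[OF assms this]
  moreover have "(\<lambda>X::real \<Rightarrow> 'a option. stereo (X t)) -` C \<inter> space path_sigma =
      {X. X t \<in> Some ` {x. stereo (Some x) \<in> C}} \<union> (if stereo (None :: 'a option) \<in> C then {X. X t = None} else {})"
  proof (rule set_eqI)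
    fix X :: "real \<Rightarrow> 'a option"
    show "X \<in> (\<lambda>X. stereo (X t)) -` C \<inter> space path_sigma \<longleftrightarrow> X \<in>
      {X. X t \<in> Some ` {x. stereo (Some x) \<in> C}} \<union> (if stereo (None :: 'a option) \<in> C then {X. X t = None} else {})"
      by (cases "X t") auto
  qed
  ultimately show "(\<lambda>X::real \<Rightarrow> 'a option. stereo (X t)) -` C \<inter> space path_sigma \<in> sets path_sigma"
    using coordinate_None_in_path_sigma[OF assms, where 'a = 'a] by auto
qed simp

section \<open>Skorokhod open sets and exit patterns\<close>

lemma cadlag_paths_stereo:
  fixes X :: "real \<Rightarrow> 'a::euclidean_space option"
  assumes M: "closed M" and X: "X \<in> cadlag_paths (with_cemetery M)"
  shows "\<And>t. 0 \<le> t \<Longrightarrow> X t \<in> topspace (with_cemetery M)"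
    and "\<And>t. 0 \<le> t \<Longrightarrow> ((\<lambda>s. stereo (X s)) \<longlongrightarrow> stereo (X t)) (at_right t)"
    and "\<And>t. 0 < t \<Longrightarrow> \<exists>z. ((\<lambda>s. stereo (X s)) \<longlongrightarrow> z) (at_left t)"
proof -
  note cad = CollectD[OF X[unfolded cadlag_paths_def]]
  have ext: "X \<in> {0..} \<rightarrow>\<^sub>E topspace (with_cemetery M)"
    and right: "\<And>t. t \<ge> 0 \<Longrightarrow> limitin (with_cemetery M) X (X t) (at_right t)"
    and left: "\<And>t. t > 0 \<Longrightarrow> \<exists>l. limitin (with_cemetery M) X l (at_left t)"
    using cad[THEN conjunct1] cad[THEN conjunct2, THEN conjunct1, rule_format]
      cad[THEN conjunct2, THEN conjunct2, rule_format] by - assumption+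
  show S: "X t \<in> topspace (with_cemetery M)" if "0 \<le> t" for t
    by (rule PiE_mem[OF ext]) (use that in simp)
  show "((\<lambda>s. stereo (X s)) \<longlongrightarrow> stereo (X t)) (at_right t)" if "0 \<le> t" for t
  proof -
    have ev: "\<forall>\<^sub>F s in at_right t. X s \<in> topspace (with_cemetery M)"
      using eventually_at_right_less[of t] by (rule eventually_mono) (rule S, use that in linarith)
    show ?thesis by (rule iffD1[OF limitin_with_cemetery_iff[OF M ev S[OF that]] right[OF that]])
  qed
  show "\<exists>z. ((\<lambda>s. stereo (X s)) \<longlongrightarrow> z) (at_left t)" if "0 < t" for t
    by (rule iffD1[OF left_limit_with_cemetery_iff[OF M that S] left[OF that]])
qed

text \<open>A finite description of a path up to \<open>T\<close>: \<open>vs\<close> lists the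
  centres of the balls it visits, \<open>cs\<close> the approximate exit times. With centres in a
  countable dense set and rational times there are only countably many patterns for given
  precisions.\<close>

definition exit_pattern :: "real \<Rightarrow> real \<Rightarrow> real \<Rightarrow> ('a::euclidean_space \<times> real) list \<Rightarrow> real list \<Rightarrow>
    (real \<Rightarrow> 'a option) set" where
  "exit_pattern \<eta> \<epsilon> T vs cs = {X. let b = exit_time (stereo \<circ> X) \<eta> T (nth vs) in
     b (length vs) = T \<and> (\<forall>i<length vs. b i < b (Suc i)) \<and> (\<forall>i\<le>length vs. \<bar>b i - cs ! i\<bar> < \<epsilon>)}"

lemma exit_pattern_in_path_sigma:
  assumes T: "T \<in> \<rat>" "0 < T"
  shows "exit_pattern \<eta> \<epsilon> T vs cs \<in> sets path_sigma"
proof -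
  have [measurable]: "(\<lambda>X. exit_time (stereo \<circ> X) \<eta> T (nth vs) i) \<in> borel_measurable path_sigma" for i
    by (intro exit_time_measurable T) (simp add: stereo_coordinate_measurable)
  have "exit_pattern \<eta> \<epsilon> T vs cs = {X \<in> space path_sigma.
     exit_time (stereo \<circ> X) \<eta> T (nth vs) (length vs) = T \<and>
     (\<forall>i<length vs. exit_time (stereo \<circ> X) \<eta> T (nth vs) i < exit_time (stereo \<circ> X) \<eta> T (nth vs) (Suc i)) \<and>
     (\<forall>i\<le>length vs. \<bar>exit_time (stereo \<circ> X) \<eta> T (nth vs) i - cs ! i\<bar> < \<epsilon>)}"
    unfolding exit_pattern_def Let_def by simp
  also have "\<dots> \<in> sets path_sigma" by measurable
  finally show ?thesis .
qed

lemma exit_time_cong: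
  assumes "\<And>j. j < i \<Longrightarrow> v j = w j"
  shows "exit_time Z \<eta> T v i = exit_time Z \<eta> T w i"
  using assms by (induction i) (simp_all add: exit_time.simps(2))

text \<open>Corresponding exit times of \<open>X\<close> and \<open>Y\<close> differ by less than
  \<open>2 * \<epsilon>\<close>, so one time change matches them all; at matched times both paths
  are within \<eta> of the same centre.\<close>

lemma exit_pattern_close:
  fixes X Y :: "real \<Rightarrow> 'a::euclidean_space option"
  assumes M: "closed M" and T: "T \<in> \<rat>" "0 < T"
    and X: "X \<in> cadlag_paths (with_cemetery M)" "X \<in> exit_pattern \<eta> \<epsilon> T vs cs"
    and Y: "Y \<in> cadlag_paths (with_cemetery M)" "Y \<in> exit_pattern \<eta> \<epsilon> T vs cs"
  shows "\<exists>\<tau>\<in>time_changes. (\<forall>s\<ge>0. \<bar>\<tau> s - s\<bar> < 2 * \<epsilon>) \<and>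
    (\<forall>s\<in>{0..<T}. dist (stereo (X s)) (stereo (Y (\<tau> s))) \<le> 2 * \<eta>)"
proof -
  define a where "a = exit_time (stereo \<circ> X) \<eta> T (nth vs)"
  define b where "b = exit_time (stereo \<circ> Y) \<eta> T (nth vs)"
  let ?m = "length vs"
  have a: "a ?m = T" "\<And>i. i < ?m \<Longrightarrow> a i < a (Suc i)" "\<And>i. i \<le> ?m \<Longrightarrow> \<bar>a i - cs ! i\<bar> < \<epsilon>"
    and b: "b ?m = T" "\<And>i. i < ?m \<Longrightarrow> b i < b (Suc i)" "\<And>i. i \<le> ?m \<Longrightarrow> \<bar>b i - cs ! i\<bar> < \<epsilon>"
    using X(2) Y(2) unfolding exit_pattern_def Let_def a_def b_def by auto
  have "\<bar>b i - a i\<bar> < 2 * \<epsilon>" if "i \<le> ?m" for i using a(3)[OF that] b(3)[OF that] by linarith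
  then obtain \<tau> where \<tau>: "\<tau> \<in> time_changes" "\<And>s. s \<ge> 0 \<Longrightarrow> \<bar>\<tau> s - s\<bar> < 2 * \<epsilon>"
     "\<And>i s. i < ?m \<Longrightarrow> s \<in> {a i..<a (Suc i)} \<Longrightarrow> \<tau> s \<in> {b i..<b (Suc i)}"
    using time_change_matching[of a b ?m "2 * \<epsilon>"] a b unfolding a_def b_def by auto
  have "dist (stereo (X s)) (stereo (Y (\<tau> s))) \<le> 2 * \<eta>" if s: "s \<in> {0..<T}" for s
  proof -
    \<comment> \<open>The interval between consecutive exit times that contains \<open>s\<close> has
      index \<open>k - 1\<close>; \<open>k\<close> is positive because the zeroth exit time is
      0.\<close>
    define k where "k = (LEAST k. s < a k)"
    have k: "s < a k" unfolding k_def by (rule LeastI[of _ ?m]) (use s a(1) in simp)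
    have k0: "k \<noteq> 0" using k s unfolding a_def by (intro notI) simp
    then obtain i where i: "k = Suc i" by (cases k) auto
    have km: "k \<le> ?m" unfolding k_def by (rule Least_le) (use s a(1) in simp)
    have "\<not> s < a i" using not_less_Least[of i "\<lambda>k. s < a k"] i unfolding k_def by simp
    then have si: "s \<in> {a i..<a (Suc i)}" using k i by simp
    have im: "i < ?m" using km i by simp
    have ti: "\<tau> s \<in> {b i..<b (Suc i)}" by (rule \<tau>(3)[OF im si])
    have "0 \<le> \<tau> s" using ti exit_time_bounds(1)[OF T] unfolding b_def by (meson atLeastLessThan_iff order_trans)
    then have "dist ((stereo \<circ> X) s) (vs ! i) \<le> \<eta>" "dist ((stereo \<circ> Y) (\<tau> s)) (vs ! i) \<le> \<eta>"
      using si ti s cadlag_paths_stereo(2)[OF M X(1)] cadlag_paths_stereo(2)[OF M Y(1)]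
      unfolding a_def b_def by (intro dist_before_exit_time[OF T]; simp add: comp_def)+
    then show ?thesis using dist_triangle2[of "stereo (X s)" "stereo (Y (\<tau> s))" "vs ! i"] by simp
  qed
  then show ?thesis using \<tau>(1,2) by blast
qed

lemma skorokhod_open_in_path_sigma:
  fixes M :: "'a::euclidean_space set"
  assumes M: "closed M" and U: "skorokhod_open (with_cemetery M) U"
  shows "\<exists>A\<in>sets path_sigma. \<forall>X\<in>cadlag_paths (with_cemetery M). X \<in> U \<longleftrightarrow> X \<in> A"
proof -
  obtain D :: "('a \<times> real) set" where D: "countable D" "\<And>O'. open O' \<Longrightarrow> O' \<noteq> {} \<Longrightarrow> \<exists>d\<in>D. d \<in> O'"
    using countable_dense_exists by metis
  have dense: "\<exists>d\<in>D. dist z d < \<epsilon>" if "0 < \<epsilon>" for z \<epsilon>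
    using D(2)[of "ball z \<epsilon>"] that by auto
  define P where "P = (UNIV :: nat set) \<times> (UNIV :: nat set) \<times> (UNIV :: nat set) \<times> lists D \<times> lists (\<rat>::real set)"
  have P: "countable P"
    unfolding P_def by (intro countable_SIGMA countable_lists D countable_rat countableI_type)
  define V :: "nat \<times> nat \<times> nat \<times> ('a \<times> real) list \<times> real list \<Rightarrow> (real \<Rightarrow> 'a option) set"
    where "V = (\<lambda>(j, k, n, vs, cs). exit_pattern (1 / Suc j) (1 / Suc k) (real (Suc n)) vs cs)"
  let ?C = "cadlag_paths (with_cemetery M)"
  have rat: "real (Suc n) \<in> \<rat>" "0 < real (Suc n)" for n by (auto simp: Rats_of_nat simp del: of_nat_Suc)
  have V: "V p \<in> sets path_sigma" for p
    unfolding V_def using exit_pattern_in_path_sigma[OF rat] by (cases p) simp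
  have main: "\<exists>p\<in>P. X \<in> V p \<and> V p \<inter> ?C \<subseteq> U" if X: "X \<in> ?C" "X \<in> U" for X
  proof -
    obtain T \<epsilon> W where *: "0 < \<epsilon>" "diagonal_neighbourhood (with_cemetery M) W"
      "skorokhod_nbhd (with_cemetery M) X T \<epsilon> W \<subseteq> U"
      using bspec[OF conjunct2[OF U[unfolded skorokhod_open_def]] X(2)] by (elim exE conjE)
    obtain \<delta> where \<delta>: "\<delta> > 0"
      "\<And>a b. a \<in> topspace (with_cemetery M) \<Longrightarrow> b \<in> topspace (with_cemetery M) \<Longrightarrow>
       dist (stereo a) (stereo b) < \<delta> \<Longrightarrow> (a, b) \<in> W"
    proof -
      show thesis by (rule diagonal_neighbourhood_dist[OF M *(2)]) (rule that)
    qed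
    \<comment> \<open>Two paths of one pattern differ by up to twice each precision, whence the
      halves of \<delta> and \<epsilon>.\<close>
    obtain j where j: "1 / Suc j < \<delta> / 2" using nat_approx_posE[of "\<delta> / 2"] \<delta>(1) by auto
    obtain k where k: "1 / Suc k < \<epsilon> / 2" using nat_approx_posE[of "\<epsilon> / 2"] *(1) by auto
    \<comment> \<open>The horizon of the pattern is \<open>Suc n\<close>, strictly beyond
      \<open>T\<close>: patterns control the path on a half-open interval, while the Skorokhod
      neighbourhood includes the end point \<open>T\<close>.\<close>
    obtain n where n: "T < real n" using reals_Archimedean2 by blast
    let ?T = "real (Suc n)" and ?\<eta> = "1 / real (Suc j)" and ?\<epsilon> = "1 / real (Suc k)"
    obtain m v where mv: "exit_time (stereo \<circ> X) ?\<eta> ?T v m = ?T" "\<And>i. v i \<in> D"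
      "\<And>i. i < m \<Longrightarrow> exit_time (stereo \<circ> X) ?\<eta> ?T v i < exit_time (stereo \<circ> X) ?\<eta> ?T v (Suc i)"
    proof (rule exit_times_reach[OF rat, of ?\<eta> "stereo \<circ> X" D n])
      show "0 < ?\<eta>" by simp
      show "((stereo \<circ> X) \<longlongrightarrow> (stereo \<circ> X) t) (at_right t)" if "0 \<le> t" for t
        using cadlag_paths_stereo(2)[OF M X(1) that] by (simp add: comp_def)
      show "\<exists>z. ((stereo \<circ> X) \<longlongrightarrow> z) (at_left t)" if "0 < t" for t
        using cadlag_paths_stereo(3)[OF M X(1) that] by (simp add: comp_def)
    qed (use dense in auto)
    define vs where "vs = map v [0..<m]"
    have ex: "exit_time (stereo \<circ> X) ?\<eta> ?T (nth vs) i = exit_time (stereo \<circ> X) ?\<eta> ?T v i" if "i \<le> m" for i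
      by (rule exit_time_cong) (use that in \<open>simp add: vs_def\<close>)
    have "\<exists>c\<in>\<rat>. \<bar>exit_time (stereo \<circ> X) ?\<eta> ?T (nth vs) i - c\<bar> < ?\<epsilon>" for i
      using Rats_dense_in_real[of "exit_time (stereo \<circ> X) ?\<eta> ?T (nth vs) i" "exit_time (stereo \<circ> X) ?\<eta> ?T (nth vs) i + ?\<epsilon>"]
      by force
    then obtain c where c: "\<And>i. c i \<in> \<rat>" "\<And>i. \<bar>exit_time (stereo \<circ> X) ?\<eta> ?T (nth vs) i - c i\<bar> < ?\<epsilon>"
      by metis
    define cs where "cs = map c [0..<Suc m]"
    have len: "length vs = m" and cs: "\<And>i. i \<le> m \<Longrightarrow> cs ! i = c i"
      unfolding vs_def cs_def by (auto simp del: upt_Suc)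
    have XV: "X \<in> exit_pattern ?\<eta> ?\<epsilon> ?T vs cs"
      unfolding exit_pattern_def Let_def len mem_Collect_eq
    proof (intro conjI allI impI)
      show "exit_time (stereo \<circ> X) ?\<eta> ?T (nth vs) m = ?T" using mv(1) ex[OF order_refl] by simp
      fix i assume i: "i < m"
      show "exit_time (stereo \<circ> X) ?\<eta> ?T (nth vs) i < exit_time (stereo \<circ> X) ?\<eta> ?T (nth vs) (Suc i)"
        unfolding ex[OF less_imp_le[OF i]] ex[OF Suc_leI[OF i]] by (rule mv(3)[OF i])
    next
      fix i assume "i \<le> m"
      then show "\<bar>exit_time (stereo \<circ> X) ?\<eta> ?T (nth vs) i - cs ! i\<bar> < ?\<epsilon>"
        using c(2)[of i] cs by simp
    qed
    have "Y \<in> U" if Y: "Y \<in> exit_pattern ?\<eta> ?\<epsilon> ?T vs cs" "Y \<in> ?C" for Y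
    proof -
      obtain \<tau> where \<tau>: "\<tau> \<in> time_changes" "\<And>s. s \<ge> 0 \<Longrightarrow> \<bar>\<tau> s - s\<bar> < 2 * ?\<epsilon>"
        "\<And>s. s \<in> {0..<?T} \<Longrightarrow> dist (stereo (X s)) (stereo (Y (\<tau> s))) \<le> 2 * ?\<eta>"
        using exit_pattern_close[OF M rat X(1) XV Y(2,1)] by (elim bexE conjE) simp
      have "(X s, Y (\<tau> s)) \<in> W" if s: "s \<in> {0..T}" for s
      proof (rule \<delta>(2))
        have "\<tau> s \<in> {0..}" using \<tau>(1) s unfolding time_changes_def by (auto dest!: bij_betwE)
        then show "X s \<in> topspace (with_cemetery M)" "Y (\<tau> s) \<in> topspace (with_cemetery M)"
          using cadlag_paths_stereo(1)[OF M X(1), of s] cadlag_paths_stereo(1)[OF M Y(2), of "\<tau> s"] s by auto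
        show "dist (stereo (X s)) (stereo (Y (\<tau> s))) < \<delta>"
          using \<tau>(3)[of s] s n j by simp
      qed
      moreover have "\<bar>\<tau> s - s\<bar> < \<epsilon>" if "0 \<le> s" for s using \<tau>(2)[OF that] k by simp
      ultimately have "Y \<in> skorokhod_nbhd (with_cemetery M) X T \<epsilon> W"
        unfolding skorokhod_nbhd_def mem_Collect_eq
        by (intro conjI Y(2) bexI[OF _ \<tau>(1)] allI ballI impI) assumption+
      then show "Y \<in> U" using *(3) by blast
    qed
    moreover have "(j, k, n, vs, cs) \<in> P"
      unfolding P_def vs_def cs_def using mv(2) c(1) by auto
    ultimately show ?thesis
      using XV by (intro bexI[of _ "(j, k, n, vs, cs)"]) (auto simp: V_def)
  qed
  \<comment> \<open>All patterns whose cadlag members lie in \<open>U\<close>; countability of the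
    parameters makes their union an event, although \<open>U\<close> itself may be an uncountable
    union of basic neighbourhoods.\<close>
  define A where "A = (\<Union>p\<in>{p\<in>P. V p \<inter> ?C \<subseteq> U}. V p)"
  have "A \<in> sets path_sigma"
    unfolding A_def using V P by (intro sets.countable_UN'' countable_subset[OF _ P]) auto
  moreover have "X \<in> U \<longleftrightarrow> X \<in> A" if "X \<in> ?C" for X
    using main[OF that] that unfolding A_def by (intro iffI) (fast, fast)
  ultimately show ?thesis by (intro bexI[of _ A] ballI)
qed

section \<open>Regular paths and Skorokhod events\<close>

text \<open>What every path of the process satisfies: all of the cadlag property except possibly the
  left limit at the explosion time \<zeta>, after which the path remains in the cemetery. The value
  \<zeta> is infinite when there is no explosion.\<close>

definition regular_path :: "'a::euclidean_space set \<Rightarrow> (real \<Rightarrow> 'a option) \<Rightarrow> bool" where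
  "regular_path M X \<longleftrightarrow> X \<in> {0..} \<rightarrow>\<^sub>E topspace (with_cemetery M) \<and>
     (\<forall>t\<ge>0. ((\<lambda>s. stereo (X s)) \<longlongrightarrow> stereo (X t)) (at_right t)) \<and>
     (\<exists>\<zeta>::ereal. (\<forall>t\<ge>0. X t = None \<longleftrightarrow> \<zeta> \<le> ereal t) \<and>
        (\<forall>t>0. ereal t \<noteq> \<zeta> \<longrightarrow> (\<exists>z. ((\<lambda>s. stereo (X s)) \<longlongrightarrow> z) (at_left t))))"

text \<open>When the path explodes at \<open>\<zeta>\<close> and stays in the cemetery, \<open>X p \<noteq> None\<close> together with
  \<open>X (p + 1 / Suc m) = None\<close> means \<open>\<zeta> - 1 / Suc m \<le> p < \<zeta>\<close>: this is the Cauchy criterion for the left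
  limit at \<open>\<zeta>\<close>, expressed at rational times and without mentioning \<open>\<zeta>\<close>.\<close>

definition explosion_regular :: "(real \<Rightarrow> 'a::euclidean_space option) set" where
  "explosion_regular = {X. \<forall>n. \<exists>m. \<forall>p\<in>\<rat> \<inter> {0..}. \<forall>q\<in>\<rat> \<inter> {0..}.
     X p \<noteq> None \<and> X q \<noteq> None \<and> X (p + 1 / Suc m) = None \<and> X (q + 1 / Suc m) = None \<longrightarrow>
     dist (stereo (X p)) (stereo (X q)) \<le> 1 / Suc n}"

lemma explosion_regular_in_path_sigma: "explosion_regular \<in> sets path_sigma"
proof -
  have 1: "Measurable.pred path_sigma (\<lambda>X::real \<Rightarrow> 'a option. X t = None)" if "0 \<le> t" for t
    using coordinate_None_in_path_sigma[OF that, where 'a = 'a] unfolding pred_def by simp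
  have 2: "Measurable.pred path_sigma
      (\<lambda>X::real \<Rightarrow> 'a option. dist (stereo (X p)) (stereo (X q)) \<le> c)" if "0 \<le> p" "0 \<le> q" for p q c
    using stereo_coordinate_measurable[OF that(1), where 'a = 'a]
      stereo_coordinate_measurable[OF that(2), where 'a = 'a] by measurable
  have count: "countable (\<rat> \<inter> {0::real..})" by (intro countable_Int1 countable_rat)
  have 3: "{X \<in> space path_sigma. X p \<noteq> (None :: 'a option) \<and> X q \<noteq> None \<and> X (p + 1 / Suc m) = None \<and>
     X (q + 1 / Suc m) = None \<longrightarrow> dist (stereo (X p)) (stereo (X q)) \<le> 1 / Suc n} \<in> sets path_sigma"
    if "0 \<le> p" "0 \<le> q" for p q m n
    unfolding pred_def[symmetric] using that by (intro pred_intros_logic 1 2) auto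
  have "{X \<in> space path_sigma. \<forall>n. \<exists>m. \<forall>p\<in>\<rat> \<inter> {0..}. \<forall>q\<in>\<rat> \<inter> {0..}.
     X p \<noteq> (None :: 'a option) \<and> X q \<noteq> None \<and> X (p + 1 / Suc m) = None \<and> X (q + 1 / Suc m) = None \<longrightarrow>
     dist (stereo (X p)) (stereo (X q)) \<le> 1 / Suc n} \<in> sets path_sigma"
    by (intro sets.sets_Collect_countable_All sets.sets_Collect_countable_Ex
        sets.sets_Collect_countable_All' count 3) auto
  then show ?thesis unfolding explosion_regular_def by simp
qed

text \<open>Completeness along one sequence increasing to \<open>t\<close> provides the limit; the
  Cauchy condition then carries it over to all times near \<open>t\<close>.\<close>

lemma left_limit_if_Cauchy:
  fixes Z :: "real \<Rightarrow> 'b::complete_space"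
  assumes "\<And>e. e > 0 \<Longrightarrow> \<exists>a<t. \<forall>s\<in>{a<..<t}. \<forall>s'\<in>{a<..<t}. dist (Z s) (Z s') \<le> e"
  shows "\<exists>z. (Z \<longlongrightarrow> z) (at_left t)"
proof -
  define x where "x i = t - 1 / Suc i" for i :: nat
  have xt: "x i < t" for i unfolding x_def by simp
  have lim: "x \<longlonglongrightarrow> t - 0"
    unfolding x_def by (intro tendsto_intros LIMSEQ_Suc[OF lim_1_over_n, unfolded comp_def])
  have ev: "\<exists>N. \<forall>i\<ge>N. x i \<in> {a<..<t}" if "a < t" for a
    using order_tendstoD(1)[OF lim, of a] that xt by (auto simp: eventually_sequentially)
  have "Cauchy (\<lambda>i. Z (x i))"
  proof (rule metric_CauchyI)
    fix e :: real assume e: "0 < e"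
    then obtain a where a: "a < t" "\<forall>s\<in>{a<..<t}. \<forall>s'\<in>{a<..<t}. dist (Z s) (Z s') \<le> e / 2"
      using assms[of "e/2"] by auto
    obtain N where "\<forall>i\<ge>N. x i \<in> {a<..<t}" using ev[OF a(1)] by blast
    then have "dist (Z (x m)) (Z (x n)) \<le> e / 2" if "m \<ge> N" "n \<ge> N" for m n
      using a(2) that by blast
    then show "\<exists>M. \<forall>m\<ge>M. \<forall>n\<ge>M. dist (Z (x m)) (Z (x n)) < e"
      using e by (intro exI[of _ N]) force
  qed
  then obtain z where z: "(\<lambda>i. Z (x i)) \<longlonglongrightarrow> z" using Cauchy_convergent convergent_def by blast
  have "(Z \<longlongrightarrow> z) (at_left t)"
  proof (rule tendstoI)
    fix e :: real assume e: "0 < e"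
    then obtain a where a: "a < t" "\<forall>s\<in>{a<..<t}. \<forall>s'\<in>{a<..<t}. dist (Z s) (Z s') \<le> e / 2"
      using assms[of "e/2"] by auto
    obtain N where N: "\<forall>i\<ge>N. x i \<in> {a<..<t}" using ev[OF a(1)] by blast
    have "dist (Z s) z < e" if s: "s \<in> {a<..<t}" for s
    proof -
      have "(\<lambda>i. dist (Z s) (Z (x i))) \<longlonglongrightarrow> dist (Z s) z" by (intro tendsto_intros z)
      moreover have "\<forall>i\<ge>N. dist (Z s) (Z (x i)) \<le> e / 2" using a(2) N s by blast
      ultimately have "dist (Z s) z \<le> e / 2" by (intro LIMSEQ_le_const2) auto
      then show ?thesis using e by simp
    qed
    then show "\<forall>\<^sub>F s in at_left t. dist (Z s) z < e"
      unfolding eventually_at_left_field using a(1) by (intro exI[of _ a]) simp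
  qed
  then show ?thesis by blast
qed

lemma cadlag_paths_iff_stereo:
  fixes X :: "real \<Rightarrow> 'a::euclidean_space option"
  assumes M: "closed M" and ext: "X \<in> {0..} \<rightarrow>\<^sub>E topspace (with_cemetery M)"
    and rc: "\<And>t. 0 \<le> t \<Longrightarrow> ((\<lambda>s. stereo (X s)) \<longlongrightarrow> stereo (X t)) (at_right t)"
  shows "X \<in> cadlag_paths (with_cemetery M) \<longleftrightarrow>
     (\<forall>t>0. \<exists>z. ((\<lambda>s. stereo (X s)) \<longlongrightarrow> z) (at_left t))"
proof -
  have S: "X t \<in> topspace (with_cemetery M)" if "0 \<le> t" for t
    by (rule PiE_mem[OF ext]) (use that in simp)
  have right: "limitin (with_cemetery M) X (X t) (at_right t)" if "0 \<le> t" for t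
  proof -
    have ev: "\<forall>\<^sub>F s in at_right t. X s \<in> topspace (with_cemetery M)"
      using eventually_at_right_less[of t] by (rule eventually_mono) (rule S, use that in linarith)
    show ?thesis by (rule iffD2[OF limitin_with_cemetery_iff[OF M ev S[OF that]] rc[OF that]])
  qed
  have left: "(\<exists>l. limitin (with_cemetery M) X l (at_left t)) \<longleftrightarrow>
     (\<exists>z. ((\<lambda>s. stereo (X s)) \<longlongrightarrow> z) (at_left t))" if "t > 0" for t
    by (rule left_limit_with_cemetery_iff[OF M that S])
  show ?thesis
    unfolding cadlag_paths_def mem_Collect_eq using ext right by (simp add: left del: topspace_Alexandroff_compactification)
qed

lemma explosion_Cauchy_imp_left_limit:
  fixes X :: "real \<Rightarrow> 'a::euclidean_space option"
  assumes rc: "\<And>t. 0 \<le> t \<Longrightarrow> ((\<lambda>s. stereo (X s)) \<longlongrightarrow> stereo (X t)) (at_right t)"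
    and t: "0 < t" and \<zeta>: "\<And>s. 0 \<le> s \<Longrightarrow> X s = None \<longleftrightarrow> t \<le> s"
    and C: "X \<in> explosion_regular"
  shows "\<exists>z. ((\<lambda>s. stereo (X s)) \<longlongrightarrow> z) (at_left t)"
proof (rule left_limit_if_Cauchy)
  fix e :: real assume e: "e > 0"
  obtain n where n: "1 / Suc n < e / 2" using nat_approx_posE[of "e / 2"] e by auto
  obtain m where m: "\<And>p q. p \<in> \<rat> \<inter> {0..} \<Longrightarrow> q \<in> \<rat> \<inter> {0..} \<Longrightarrow>
     X p \<noteq> None \<and> X q \<noteq> None \<and> X (p + 1 / Suc m) = None \<and> X (q + 1 / Suc m) = None \<Longrightarrow>
     dist (stereo (X p)) (stereo (X q)) \<le> 1 / Suc n"
    using C unfolding explosion_regular_def by blast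
  \<comment> \<open>For \<open>p\<close> between \<open>a\<close> and \<open>t\<close> the path is
    alive at \<open>p\<close> and dead at \<open>p + 1 / Suc m\<close>, so the criterion applies to
    all rational times there.\<close>
  define a where "a = max 0 (t - 1 / Suc m)"
  have at: "a < t" "0 \<le> a" unfolding a_def using t by auto
  \<comment> \<open>Right continuity moves an arbitrary time to a rational one at cost
    \<open>e / 4\<close>; twice this and the criterion at \<open>e / 2\<close> make up
    \<open>e\<close>.\<close>
  have approx: "\<exists>p\<in>\<rat> \<inter> {a<..<t}. dist (stereo (X s)) (stereo (X p)) < e / 4" if s: "s \<in> {a<..<t}" for s
  proof -
    have "\<forall>\<^sub>F r in at_right s. dist (stereo (X r)) (stereo (X s)) < e / 4"
      using tendstoD[OF rc[of s], of "e/4"] s at e by auto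
    then obtain b where b: "b > s" "\<And>r. s < r \<Longrightarrow> r < b \<Longrightarrow> dist (stereo (X r)) (stereo (X s)) < e / 4"
      unfolding eventually_at_right_field by blast
    obtain p where "p \<in> \<rat>" "s < p" "p < min b t" using Rats_dense_in_real[of s "min b t"] b s by auto
    then show ?thesis using b(2)[of p] s by (intro bexI[of _ p]) (auto simp: dist_commute)
  qed
  have "dist (stereo (X s)) (stereo (X s')) \<le> e" if s: "s \<in> {a<..<t}" "s' \<in> {a<..<t}" for s s'
  proof -
    obtain p q where pq: "p \<in> \<rat> \<inter> {a<..<t}" "dist (stereo (X s)) (stereo (X p)) < e / 4"
      "q \<in> \<rat> \<inter> {a<..<t}" "dist (stereo (X s')) (stereo (X q)) < e / 4"
      using approx s by meson
    have "X p \<noteq> None" "X q \<noteq> None" "X (p + 1 / Suc m) = None" "X (q + 1 / Suc m) = None"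
      using pq at \<zeta>[of p] \<zeta>[of q] \<zeta>[of "p + 1 / Suc m"] \<zeta>[of "q + 1 / Suc m"] unfolding a_def
      by (auto simp: max_def split: if_splits)
    then have "dist (stereo (X p)) (stereo (X q)) \<le> 1 / Suc n"
      using pq(1,3) at by (intro m) auto
    moreover have "dist (stereo (X s)) (stereo (X s')) \<le>
        dist (stereo (X s)) (stereo (X p)) + dist (stereo (X p)) (stereo (X q)) + dist (stereo (X s')) (stereo (X q))"
      using dist_triangle[of "stereo (X s)" "stereo (X s')" "stereo (X p)"]
        dist_triangle[of "stereo (X p)" "stereo (X s')" "stereo (X q)"]
      by (simp add: dist_commute)
    ultimately show ?thesis using pq(2,4) n by linarith
  qed
  then show "\<exists>a<t. \<forall>s\<in>{a<..<t}. \<forall>s'\<in>{a<..<t}. dist (stereo (X s)) (stereo (X s')) \<le> e"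
    using at by blast
qed

lemma explosion_left_limit_imp_Cauchy:
  fixes X :: "real \<Rightarrow> 'a::euclidean_space option"
  assumes z: "((\<lambda>s. stereo (X s)) \<longlongrightarrow> z) (at_left t)"
    and \<zeta>: "\<And>s. 0 \<le> s \<Longrightarrow> X s = None \<longleftrightarrow> t \<le> s"
  shows "X \<in> explosion_regular"
  unfolding explosion_regular_def mem_Collect_eq
proof
  fix n :: nat
  have "\<forall>\<^sub>F s in at_left t. dist (stereo (X s)) z < 1 / Suc n / 2"
    by (rule tendstoD[OF z]) simp
  then obtain a where a: "a < t" "\<And>s. a < s \<Longrightarrow> s < t \<Longrightarrow> dist (stereo (X s)) z < 1 / Suc n / 2"
    unfolding eventually_at_left_field by blast
  \<comment> \<open>With this \<open>m\<close>, being alive at \<open>p\<close> and dead at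
    \<open>p + 1 / Suc m\<close> forces \<open>p\<close> into the interval from \<open>a\<close> to
    \<open>t\<close>, where the path is near its left limit.\<close>
  obtain m where m: "1 / Suc m < t - a" using nat_approx_posE[of "t - a"] a(1) by auto
  have near: "dist (stereo (X p)) z < 1 / Suc n / 2"
    if "0 \<le> p" "X p \<noteq> None" "X (p + 1 / Suc m) = None" for p
    using a(2)[of p] \<zeta>[of p] \<zeta>[of "p + 1 / Suc m"] that m by auto
  have "dist (stereo (X p)) (stereo (X q)) \<le> 1 / Suc n"
    if "0 \<le> p" "0 \<le> q" "X p \<noteq> None \<and> X q \<noteq> None \<and> X (p + 1 / Suc m) = None \<and> X (q + 1 / Suc m) = None" for p q
    using near[of p] near[of q] that dist_triangle2[of "stereo (X p)" "stereo (X q)" z] by linarith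
  then show "\<exists>m. \<forall>p\<in>\<rat> \<inter> {0..}. \<forall>q\<in>\<rat> \<inter> {0..}.
     X p \<noteq> None \<and> X q \<noteq> None \<and> X (p + 1 / Suc m) = None \<and> X (q + 1 / Suc m) = None \<longrightarrow>
     dist (stereo (X p)) (stereo (X q)) \<le> 1 / Suc n"
    by (intro exI[of _ m]) auto
qed

text \<open>For regular paths the cadlag property is reduced to an event of countably many
  coordinates. Only the left limit at a finite positive explosion time is at stake.\<close>

lemma regular_path_cadlag_iff:
  fixes X :: "real \<Rightarrow> 'a::euclidean_space option"
  assumes M: "closed M" and X: "regular_path M X"
  shows "X \<in> cadlag_paths (with_cemetery M) \<longleftrightarrow> X \<in> explosion_regular"
proof -
  have ext: "X \<in> {0..} \<rightarrow>\<^sub>E topspace (with_cemetery M)"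
    and rc: "\<And>t. 0 \<le> t \<Longrightarrow> ((\<lambda>s. stereo (X s)) \<longlongrightarrow> stereo (X t)) (at_right t)"
    using X unfolding regular_path_def by (simp_all del: topspace_Alexandroff_compactification)
  obtain \<zeta> where \<zeta>: "\<And>t. 0 \<le> t \<Longrightarrow> X t = None \<longleftrightarrow> \<zeta> \<le> ereal t"
    and ll: "\<And>t. 0 < t \<Longrightarrow> ereal t \<noteq> \<zeta> \<Longrightarrow> \<exists>z. ((\<lambda>s. stereo (X s)) \<longlongrightarrow> z) (at_left t)"
    using X unfolding regular_path_def by (elim conjE exE) simp
  show ?thesis
  proof (cases "\<exists>t>0. \<zeta> = ereal t")
    case True
    then obtain t where t: "0 < t" "\<zeta> = ereal t" by blast
    then have iff: "\<And>s. 0 \<le> s \<Longrightarrow> X s = None \<longleftrightarrow> t \<le> s" using \<zeta> by simp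
    have "(\<forall>s>0. \<exists>z. ((\<lambda>s. stereo (X s)) \<longlongrightarrow> z) (at_left s)) \<longleftrightarrow>
        (\<exists>z. ((\<lambda>s. stereo (X s)) \<longlongrightarrow> z) (at_left t))"
      using ll t by (metis ereal.inject)
    then show ?thesis
      using cadlag_paths_iff_stereo[OF M ext rc] explosion_Cauchy_imp_left_limit[OF rc t(1) iff]
        explosion_left_limit_imp_Cauchy[OF _ iff] by blast
  next
    case False
    then have "\<exists>z. ((\<lambda>s. stereo (X s)) \<longlongrightarrow> z) (at_left t)" if "0 < t" for t using ll that by metis
    moreover have "X \<in> explosion_regular"
    proof -
      \<comment> \<open>Without an explosion at a positive time the path is never alive and later
        dead, so the criterion holds vacuously.\<close>
      have "\<not> (X p \<noteq> None \<and> X (p + 1 / Suc m) = None)" if "0 \<le> p" for p m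
      proof
        assume "X p \<noteq> None \<and> X (p + 1 / Suc m) = None"
        then have "ereal p < \<zeta>" "\<zeta> \<le> ereal (p + 1 / Suc m)"
          using \<zeta>[of p] \<zeta>[of "p + 1 / Suc m"] that by auto
        then show False using False that by (cases \<zeta>) auto
      qed
      then show ?thesis unfolding explosion_regular_def by (intro CollectI allI exI[of _ 0] ballI) blast
    qed
    ultimately show ?thesis using cadlag_paths_iff_stereo[OF M ext rc] by blast
  qed
qed

section \<open>From Skorokhod open sets to all Skorokhod events\<close>

definition cadlag_version :: "'a::euclidean_space set \<Rightarrow> (real \<Rightarrow> 'a option) \<Rightarrow> (real \<Rightarrow> 'a option)" where
  "cadlag_version M X = (if X \<in> cadlag_paths (with_cemetery M) then X else (\<lambda>t\<in>{0..}. None))"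

lemma cadlag_version_cadlag: "cadlag_version M X \<in> cadlag_paths (with_cemetery M)"
proof -
  have "limitin (with_cemetery M) (\<lambda>t\<in>{0..}. None) None (at_right t)" if "0 \<le> t" for t :: real
  proof (rule limitin_eventually)
    show "\<forall>\<^sub>F s in at_right t. (\<lambda>t\<in>{0..}. None) s = (None :: 'a option)"
      using eventually_at_right_less[of t] by (rule eventually_mono) (use that in auto)
  qed simp
  moreover have "limitin (with_cemetery M) (\<lambda>t\<in>{0..}. None) None (at_left t)" if "0 < t" for t :: real
  proof (rule limitin_eventually)
    show "\<forall>\<^sub>F s in at_left t. (\<lambda>t\<in>{0..}. None) s = (None :: 'a option)"
      using eventually_at_left_real[OF that] by (rule eventually_mono) auto
  qed simp
  ultimately have "(\<lambda>t\<in>{0..}. None) \<in> cadlag_paths (with_cemetery M)"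
    unfolding cadlag_paths_def by (intro CollectI conjI allI impI restrict_PiE) auto
  then show ?thesis unfolding cadlag_version_def by simp
qed

text \<open>The event \<open>A\<close> depends on \<open>U\<close> alone and works for all regular
  paths at once. It therefore gives both the measurability of the process into the Skorokhod space
  and the transfer of equality of laws.\<close>

lemma skorokhod_event_in_path_sigma:
  fixes M :: "'a::euclidean_space set"
  assumes M: "closed M" and U: "U \<in> sets (borel_sigma (skorokhod_topology (with_cemetery M)))"
  shows "\<exists>A\<in>sets path_sigma. \<forall>X. regular_path M X \<longrightarrow> (cadlag_version M X \<in> U \<longleftrightarrow> X \<in> A)"
proof -
  let ?Sk = "skorokhod_topology (with_cemetery M)"
  have "U \<in> sigma_sets (topspace ?Sk) {U. openin ?Sk U}"
    using U unfolding borel_sigma_def by (subst (asm) sets_measure_of) (auto dest: openin_subset)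
  then show ?thesis
  proof (induction U)
    case (Basic U)
    then have "skorokhod_open (with_cemetery M) U" unfolding openin_skorokhod_topology by simp
    from skorokhod_open_in_path_sigma[OF M this] obtain A where
      A: "A \<in> sets path_sigma" "\<And>X. X \<in> cadlag_paths (with_cemetery M) \<Longrightarrow> X \<in> U \<longleftrightarrow> X \<in> A" by blast
    let ?N = "\<lambda>t\<in>{0..}. None :: 'a option"
    \<comment> \<open>Regular paths outside \<open>explosion_regular\<close> are all replaced by the
      same constant path, so together they belong to the event or not, according to that single
      path.\<close>
    let ?B = "(explosion_regular \<inter> A) \<union> (if ?N \<in> U then space path_sigma - explosion_regular else {})"
    have "?B \<in> sets path_sigma"
      using A(1) explosion_regular_in_path_sigma by (auto simp del: space_path_sigma)
    moreover have "cadlag_version M X \<in> U \<longleftrightarrow> X \<in> ?B" if "regular_path M X" for X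
      using A(2)[of X] regular_path_cadlag_iff[OF M that] unfolding cadlag_version_def by simp
    ultimately show ?case by blast
  next
    case Empty
    then show ?case by (intro bexI[of _ "{}"]) auto
  next
    case (Compl U)
    then obtain A where A: "A \<in> sets path_sigma"
      "\<And>X. regular_path M X \<Longrightarrow> cadlag_version M X \<in> U \<longleftrightarrow> X \<in> A" by blast
    show ?case
      using A(2) cadlag_version_cadlag[of M] unfolding topspace_skorokhod_topology
      by (intro bexI[OF _ sets.compl_sets[OF A(1)]]) simp
  next
    case (Union U)
    then obtain A where A: "\<And>i::nat. A i \<in> sets path_sigma"
      "\<And>i X. regular_path M X \<Longrightarrow> cadlag_version M X \<in> U i \<longleftrightarrow> X \<in> A i" by metis
    then show ?case by (intro bexI[of _ "\<Union>i. A i"]) auto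
  qed
qed

section \<open>Primitives of bounded functions\<close>

text \<open>Lipschitz functions with a chosen bounded Borel density. Boundedness and measurability
  make the gauge integral agree with the Lebesgue integral; the calculus needed is stability under
  linear combinations, products and exponentials.\<close>

definition primitive_on :: "real \<Rightarrow> real \<Rightarrow> (real \<Rightarrow> real) \<Rightarrow> (real \<Rightarrow> real) \<Rightarrow> bool" where
  "primitive_on a b f F \<longleftrightarrow> f \<in> borel_measurable (restrict_space borel {a..b}) \<and>
     (\<exists>B. \<forall>r\<in>{a..b}. \<bar>f r\<bar> \<le> B) \<and> (\<forall>r\<in>{a..b}. F r = F a + integral {a..r} f)"

lemma set_integrable_bounded_interval:
  fixes f :: "real \<Rightarrow> real"
  assumes "f \<in> borel_measurable (restrict_space borel {a..b})" "\<forall>r\<in>{a..b}. \<bar>f r\<bar> \<le> B"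
    and "a \<le> c" "d \<le> b"
  shows "set_integrable lborel {c..d} f"
proof -
  have "(\<lambda>x. indicator {a..b} x *\<^sub>R f x) \<in> borel_measurable lborel"
    using assms(1) by (subst (asm) borel_measurable_restrict_space_iff) auto
  then have "set_integrable lborel {a..b} f"
    unfolding set_integrable_def
    by (rule integrableI_bounded_set[where A = "{a..b}" and B = B, rotated])
      (use assms(2) in \<open>auto simp: emeasure_lborel_Icc_eq\<close>)
  then show ?thesis by (rule set_integrable_subset) (use assms(3,4) in auto)
qed

lemma integrable_bounded_interval:
  fixes f :: "real \<Rightarrow> real"
  assumes "f \<in> borel_measurable (restrict_space borel {a..b})" "\<forall>r\<in>{a..b}. \<bar>f r\<bar> \<le> B"
    and "a \<le> c" "d \<le> b"
  shows "f integrable_on {c..d}"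
  by (rule set_borel_integral_eq_integral(1)[OF set_integrable_bounded_interval[OF assms]])

lemma abs_integral_le:
  fixes f :: "real \<Rightarrow> real"
  assumes "f integrable_on {c..d}" "c \<le> d" "\<And>t. c \<le> t \<Longrightarrow> t \<le> d \<Longrightarrow> \<bar>f t\<bar> \<le> B"
  shows "\<bar>integral {c..d} f\<bar> \<le> B * (d - c)"
proof -
  have "0 \<le> B" using assms(3)[of c] assms(2) by simp
  then have "norm (integral {c..d} f) \<le> B * Henstock_Kurzweil_Integration.content (cbox c d)"
    using has_integral_bound[of B f "integral {c..d} f" c d] assms(1,3)
    by (simp add: integrable_integral cbox_interval)
  then show ?thesis using assms(2) by simp
qed

lemma primitive_onE:
  assumes "primitive_on a b f F"
  obtains B where "0 \<le> B" "f \<in> borel_measurable (restrict_space borel {a..b})"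
    "\<And>r. r \<in> {a..b} \<Longrightarrow> \<bar>f r\<bar> \<le> B"
    "\<And>c d. a \<le> c \<Longrightarrow> d \<le> b \<Longrightarrow> f integrable_on {c..d}"
    "\<And>c d. a \<le> c \<Longrightarrow> c \<le> d \<Longrightarrow> d \<le> b \<Longrightarrow> F d - F c = integral {c..d} f"
    "\<And>c d. a \<le> c \<Longrightarrow> c \<le> d \<Longrightarrow> d \<le> b \<Longrightarrow> \<bar>F d - F c\<bar> \<le> B * (d - c)"
    "continuous_on {a..b} F" "F \<in> borel_measurable (restrict_space borel {a..b})"
    "\<And>r. r \<in> {a..b} \<Longrightarrow> \<bar>F r\<bar> \<le> \<bar>F a\<bar> + B * (b - a)"
proof -
  obtain B0 where f: "f \<in> borel_measurable (restrict_space borel {a..b})"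
    "\<And>r. r \<in> {a..b} \<Longrightarrow> \<bar>f r\<bar> \<le> B0" "\<And>r. r \<in> {a..b} \<Longrightarrow> F r = F a + integral {a..r} f"
    using assms unfolding primitive_on_def by blast
  define B where "B = \<bar>B0\<bar>"
  have B: "0 \<le> B" "\<And>r. r \<in> {a..b} \<Longrightarrow> \<bar>f r\<bar> \<le> B" using f(2) unfolding B_def by force+
  have int: "f integrable_on {c..d}" if "a \<le> c" "d \<le> b" for c d
    by (rule integrable_bounded_interval[OF f(1) _ that, of B]) (use B in blast)
  have diff: "F d - F c = integral {c..d} f" if "a \<le> c" "c \<le> d" "d \<le> b" for c d
    using Henstock_Kurzweil_Integration.integral_combine[OF that(1,2) int[OF order_refl that(3)]]
      f(3)[of c] f(3)[of d] that by simp
  have lip: "\<bar>F d - F c\<bar> \<le> B * (d - c)" if "a \<le> c" "c \<le> d" "d \<le> b" for c d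
    unfolding diff[OF that] using B int that by (intro abs_integral_le) auto
  have cont: "continuous_on {a..b} F"
  proof (rule lipschitz_on_continuous_on[of B])
    show "B-lipschitz_on {a..b} F"
    proof (rule lipschitz_onI)
      fix x y assume "x \<in> {a..b}" "y \<in> {a..b}"
      then show "dist (F x) (F y) \<le> B * dist x y"
        using lip[of x y] lip[of y x] by (cases "x \<le> y") (auto simp: dist_real_def abs_minus_commute)
    qed (rule B)
  qed
  have "\<bar>F r\<bar> \<le> \<bar>F a\<bar> + B * (b - a)" if "r \<in> {a..b}" for r
  proof -
    have "\<bar>F r - F a\<bar> \<le> B * (r - a)" using lip[of a r] that by simp
    also have "\<dots> \<le> B * (b - a)" using that B by (intro mult_left_mono) auto
    finally show ?thesis by linarith
  qed
  then show thesis
    by (intro that[OF B(1) f(1) B(2) int diff lip cont borel_measurable_continuous_on_restrict[OF cont]])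
qed

text \<open>Bounded measurable densities need not be derivatives of their primitives at every point.
  Increments are compared with integrals up to an error quadratic in the step instead.\<close>

lemma constant_if_quadratic:
  fixes h :: "real \<Rightarrow> real"
  assumes "\<And>r r'. a \<le> r \<Longrightarrow> r \<le> r' \<Longrightarrow> r' \<le> b \<Longrightarrow> \<bar>h r' - h r\<bar> \<le> K * (r' - r)\<^sup>2"
    and "r \<in> {a..b}"
  shows "h r = h a"
proof -
  have K: "\<bar>h y - h x\<bar> \<le> \<bar>K\<bar> * (y - x)\<^sup>2" if "x \<in> {a..b}" "y \<in> {a..b}" for x y
  proof (cases "x \<le> y")
    case True
    have "\<bar>h y - h x\<bar> \<le> K * (y - x)\<^sup>2" using assms(1)[of x y] that True by simp
    also have "\<dots> \<le> \<bar>K\<bar> * (y - x)\<^sup>2" by (intro mult_right_mono) auto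
    finally show ?thesis .
  next
    case False
    have "\<bar>h x - h y\<bar> \<le> K * (x - y)\<^sup>2" using assms(1)[of y x] that False by simp
    also have "\<dots> \<le> \<bar>K\<bar> * (x - y)\<^sup>2" by (intro mult_right_mono) auto
    finally show ?thesis by (simp add: abs_minus_commute power2_commute)
  qed
  have "(h has_field_derivative 0) (at x within {a..b})" if x: "x \<in> {a..b}" for x
    unfolding has_field_derivative_iff
  proof (rule Lim_null_comparison)
    show "\<forall>\<^sub>F y in at x within {a..b}. norm ((h y - h x) / (y - x)) \<le> \<bar>K\<bar> * \<bar>y - x\<bar>"
      unfolding eventually_at_filter
    proof (intro always_eventually allI impI)
      fix y assume y: "y \<noteq> x" "y \<in> {a..b}"
      have "\<bar>h y - h x\<bar> / \<bar>y - x\<bar> \<le> (\<bar>K\<bar> * (y - x)\<^sup>2) / \<bar>y - x\<bar>"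
        by (intro divide_right_mono K x y) simp
      also have "(y - x)\<^sup>2 = \<bar>y - x\<bar> * \<bar>y - x\<bar>" by (simp add: power2_eq_square)
      also have "\<bar>K\<bar> * (\<bar>y - x\<bar> * \<bar>y - x\<bar>) / \<bar>y - x\<bar> = \<bar>K\<bar> * \<bar>y - x\<bar>"
        using y(1) by (simp add: field_simps del: abs_mult_self_eq)
      finally show "norm ((h y - h x) / (y - x)) \<le> \<bar>K\<bar> * \<bar>y - x\<bar>" by simp
    qed
    have "((\<lambda>y. \<bar>K\<bar> * \<bar>y - x\<bar>) \<longlongrightarrow> \<bar>K\<bar> * \<bar>x - x\<bar>) (at x within {a..b})"
      by (intro tendsto_intros)
    then show "((\<lambda>y. \<bar>K\<bar> * \<bar>y - x\<bar>) \<longlongrightarrow> 0) (at x within {a..b})" by simp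
  qed
  then have "\<exists>c. \<forall>x\<in>{a..b}. h x = c"
    by (intro has_field_derivative_zero_constant) auto
  then show ?thesis using assms(2) by auto
qed

text \<open>The difference between \<open>F\<close> and the candidate primitive has increments
  quadratic in the step, hence is constant.\<close>

lemma primitive_onI_quadratic:
  assumes f: "f \<in> borel_measurable (restrict_space borel {a..b})"
    and B: "\<forall>r\<in>{a..b}. \<bar>f r\<bar> \<le> B"
    and K: "\<And>r r'. a \<le> r \<Longrightarrow> r \<le> r' \<Longrightarrow> r' \<le> b \<Longrightarrow> \<bar>F r' - F r - integral {r..r'} f\<bar> \<le> K * (r' - r)\<^sup>2"
  shows "primitive_on a b f F"
proof -
  have "F r - integral {a..r} f = F a - integral {a..a} f" if "r \<in> {a..b}" for r
  proof (rule constant_if_quadratic[where h = "\<lambda>r. F r - integral {a..r} f" and b = b and K = K])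
    fix r r' assume r: "a \<le> r" "r \<le> r'" "r' \<le> b"
    have "integral {a..r} f + integral {r..r'} f = integral {a..r'} f"
      by (rule Henstock_Kurzweil_Integration.integral_combine[OF r(1,2)])
        (rule integrable_bounded_interval[OF f B order_refl r(3)])
    then show "\<bar>(F r' - integral {a..r'} f) - (F r - integral {a..r} f)\<bar> \<le> K * (r' - r)\<^sup>2"
      using K[OF r] by (simp add: algebra_simps)
  qed (rule that)
  then show ?thesis using f B unfolding primitive_on_def by (intro conjI ballI exI[of _ B]) force+
qed

text \<open>Freeze \<open>G\<close> at the right end and \<open>F\<close> at the left end of a step:
  the increment of the product is then exactly an integral. Putting the running values back changes
  the integrand by at most \<open>2 * B * C\<close> times the step, an error quadratic after
  integration.\<close>

lemma primitive_on_mult: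
  assumes "primitive_on a b f F" "primitive_on a b g G"
  shows "primitive_on a b (\<lambda>r. f r * G r + F r * g r) (\<lambda>r. F r * G r)"
proof -
  obtain B where f: "0 \<le> B" "f \<in> borel_measurable (restrict_space borel {a..b})"
    "\<And>r. r \<in> {a..b} \<Longrightarrow> \<bar>f r\<bar> \<le> B" "\<And>c d. a \<le> c \<Longrightarrow> d \<le> b \<Longrightarrow> f integrable_on {c..d}"
    "\<And>c d. a \<le> c \<Longrightarrow> c \<le> d \<Longrightarrow> d \<le> b \<Longrightarrow> F d - F c = integral {c..d} f"
    "\<And>c d. a \<le> c \<Longrightarrow> c \<le> d \<Longrightarrow> d \<le> b \<Longrightarrow> \<bar>F d - F c\<bar> \<le> B * (d - c)"
    "F \<in> borel_measurable (restrict_space borel {a..b})"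
    "\<And>r. r \<in> {a..b} \<Longrightarrow> \<bar>F r\<bar> \<le> \<bar>F a\<bar> + B * (b - a)"
    by (rule primitive_onE[OF assms(1)]) (rule that; assumption)
  obtain C where g: "0 \<le> C" "g \<in> borel_measurable (restrict_space borel {a..b})"
    "\<And>r. r \<in> {a..b} \<Longrightarrow> \<bar>g r\<bar> \<le> C" "\<And>c d. a \<le> c \<Longrightarrow> d \<le> b \<Longrightarrow> g integrable_on {c..d}"
    "\<And>c d. a \<le> c \<Longrightarrow> c \<le> d \<Longrightarrow> d \<le> b \<Longrightarrow> G d - G c = integral {c..d} g"
    "\<And>c d. a \<le> c \<Longrightarrow> c \<le> d \<Longrightarrow> d \<le> b \<Longrightarrow> \<bar>G d - G c\<bar> \<le> C * (d - c)"
    "G \<in> borel_measurable (restrict_space borel {a..b})"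
    "\<And>r. r \<in> {a..b} \<Longrightarrow> \<bar>G r\<bar> \<le> \<bar>G a\<bar> + C * (b - a)"
    by (rule primitive_onE[OF assms(2)]) (rule that; assumption)
  let ?k = "\<lambda>r. f r * G r + F r * g r"
  let ?B = "B * (\<bar>G a\<bar> + C * (b - a)) + (\<bar>F a\<bar> + B * (b - a)) * C"
  have meas: "?k \<in> borel_measurable (restrict_space borel {a..b})"
    using f(2,7) g(2,7) by measurable
  have bd: "\<forall>r\<in>{a..b}. \<bar>?k r\<bar> \<le> ?B"
  proof
    fix r assume that: "r \<in> {a..b}"
    have "\<bar>?k r\<bar> \<le> \<bar>f r\<bar> * \<bar>G r\<bar> + \<bar>F r\<bar> * \<bar>g r\<bar>"
      using abs_triangle_ineq[of "f r * G r" "F r * g r"] by (simp add: abs_mult)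
    also have "\<dots> \<le> ?B"
      using f(3,8)[OF that] g(3,8)[OF that] f(1) g(1) by (intro add_mono mult_mono) auto
    finally show "\<bar>?k r\<bar> \<le> ?B" .
  qed
  show ?thesis
  proof (rule primitive_onI_quadratic[OF meas bd])
    fix r r' assume r: "a \<le> r" "r \<le> r'" "r' \<le> b"
    have ki: "?k integrable_on {r..r'}" by (rule integrable_bounded_interval[OF meas bd r(1,3)])
    have ci: "(\<lambda>t. f t * G r' + F r * g t) integrable_on {r..r'}"
      by (intro integrable_add integrable_on_mult_left integrable_on_mult_right f(4) g(4) r)
    have "F r' * G r' - F r * G r = (F r' - F r) * G r' + F r * (G r' - G r)"
      by (simp add: algebra_simps)
    also have "\<dots> = integral {r..r'} (\<lambda>t. f t * G r' + F r * g t)"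
      unfolding f(5)[OF r] g(5)[OF r]
      by (subst Henstock_Kurzweil_Integration.integral_add)
        (auto intro!: integrable_on_mult_left integrable_on_mult_right f(4) g(4) r)
    finally have "F r' * G r' - F r * G r - integral {r..r'} ?k =
        integral {r..r'} (\<lambda>t. (f t * G r' + F r * g t) - ?k t)"
      using Henstock_Kurzweil_Integration.integral_diff[OF ci ki] by simp
    also have "\<bar>\<dots>\<bar> \<le> 2 * B * C * (r' - r) * (r' - r)"
    proof (rule abs_integral_le[OF integrable_diff[OF ci ki] r(2)])
      fix t assume t: "r \<le> t" "t \<le> r'"
      have "\<bar>f t * (G r' - G t)\<bar> \<le> B * (C * (r' - r))"
      proof -
        have "\<bar>G r' - G t\<bar> \<le> C * (r' - t)" using g(6)[of t r'] t r by simp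
        also have "\<dots> \<le> C * (r' - r)" using t g(1) by (intro mult_left_mono) auto
        finally show ?thesis
          unfolding abs_mult using f(1) f(3)[of t] t r by (intro mult_mono) auto
      qed
      moreover have "\<bar>(F r - F t) * g t\<bar> \<le> (B * (r' - r)) * C"
      proof -
        have "\<bar>F r - F t\<bar> \<le> B * (t - r)" using f(6)[of r t] t r by (simp add: abs_minus_commute)
        also have "\<dots> \<le> B * (r' - r)" using t f(1) by (intro mult_left_mono) auto
        finally show ?thesis
          unfolding abs_mult using g(3)[of t] t r f(1) by (intro mult_mono) auto
      qed
      moreover have "(f t * G r' + F r * g t) - ?k t = f t * (G r' - G t) + (F r - F t) * g t"
        by (simp add: algebra_simps)
      moreover have "2 * B * C * (r' - r) = B * (C * (r' - r)) + (B * (r' - r)) * C"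
        by (simp add: algebra_simps)
      ultimately show "\<bar>(f t * G r' + F r * g t) - ?k t\<bar> \<le> 2 * B * C * (r' - r)"
        using abs_triangle_ineq[of "f t * (G r' - G t)" "(F r - F t) * g t"] by linarith
    qed
    finally show "\<bar>F r' * G r' - F r * G r - integral {r..r'} ?k\<bar> \<le> (2 * B * C) * (r' - r)\<^sup>2"
      by (simp add: power2_eq_square mult.assoc)
  qed
qed

text \<open>Both estimates come from the tangent inequality
  \<open>exp u * (v - u) \<le> exp v - exp u\<close>, used at either end point.\<close>

lemma exp_Taylor_bound:
  fixes x y C :: real
  assumes "x \<le> C" "y \<le> C"
  shows "\<bar>exp y - exp x\<bar> \<le> exp C * \<bar>y - x\<bar>" "\<bar>exp y - exp x - exp x * (y - x)\<bar> \<le> exp C * (y - x)\<^sup>2"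
proof -
  have 1: "exp u * (v - u) \<le> exp v - exp u" for u v :: real
    using mult_left_mono[OF exp_ge_add_one_self[of "v - u"], of "exp u"]
    by (simp add: exp_diff algebra_simps)
  have e: "exp x \<le> exp C" "exp y \<le> exp C" using assms by auto
  show lip: "\<bar>exp y - exp x\<bar> \<le> exp C * \<bar>y - x\<bar>"
  proof (cases "x \<le> y")
    case True
    then have "\<bar>exp y - exp x\<bar> \<le> exp y * (y - x)" using 1[of y x] by (simp add: algebra_simps)
    also have "\<dots> \<le> exp C * (y - x)" using e True by (intro mult_right_mono) auto
    finally show ?thesis using True by simp
  next
    case False
    then have "\<bar>exp y - exp x\<bar> \<le> exp x * (x - y)" using 1[of x y] by (simp add: algebra_simps)
    also have "\<dots> \<le> exp C * (x - y)" using e False by (intro mult_right_mono) auto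
    finally show ?thesis using False by simp
  qed
  have "0 \<le> exp y - exp x - exp x * (y - x)" using 1[of x y] by simp
  moreover have "exp y - exp x - exp x * (y - x) \<le> (exp y - exp x) * (y - x)"
    using 1[of y x] by (simp add: algebra_simps)
  moreover have "\<dots> \<le> \<bar>exp y - exp x\<bar> * \<bar>y - x\<bar>" by (metis abs_ge_self abs_mult)
  moreover have "\<dots> \<le> (exp C * \<bar>y - x\<bar>) * \<bar>y - x\<bar>" using lip by (intro mult_right_mono) auto
  moreover have "\<dots> = exp C * (y - x)\<^sup>2" by (simp add: power2_eq_square)
  ultimately show "\<bar>exp y - exp x - exp x * (y - x)\<bar> \<le> exp C * (y - x)\<^sup>2" by linarith
qed

text \<open>Two errors of size \<open>exp C * B\<^sup>2\<close> times the squared step: the Taylor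
  remainder of \<open>exp\<close>, and the cost of freezing \<open>exp (F t)\<close> at the left end
  of the step.\<close>

lemma primitive_on_exp:
  assumes "primitive_on a b f F"
  shows "primitive_on a b (\<lambda>r. f r * exp (F r)) (\<lambda>r. exp (F r))"
proof -
  obtain B where f: "0 \<le> B" "f \<in> borel_measurable (restrict_space borel {a..b})"
    "\<And>r. r \<in> {a..b} \<Longrightarrow> \<bar>f r\<bar> \<le> B" "\<And>c d. a \<le> c \<Longrightarrow> d \<le> b \<Longrightarrow> f integrable_on {c..d}"
    "\<And>c d. a \<le> c \<Longrightarrow> c \<le> d \<Longrightarrow> d \<le> b \<Longrightarrow> F d - F c = integral {c..d} f"
    "\<And>c d. a \<le> c \<Longrightarrow> c \<le> d \<Longrightarrow> d \<le> b \<Longrightarrow> \<bar>F d - F c\<bar> \<le> B * (d - c)"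
    "F \<in> borel_measurable (restrict_space borel {a..b})"
    "\<And>r. r \<in> {a..b} \<Longrightarrow> \<bar>F r\<bar> \<le> \<bar>F a\<bar> + B * (b - a)"
    by (rule primitive_onE[OF assms(1)]) (rule that; assumption)
  define C where "C = \<bar>F a\<bar> + B * (b - a)"
  have FC: "F r \<le> C" if "r \<in> {a..b}" for r using f(8)[OF that] unfolding C_def by linarith
  let ?k = "\<lambda>r. f r * exp (F r)"
  have meas: "?k \<in> borel_measurable (restrict_space borel {a..b})"
    using f(2,7) by measurable
  have bd: "\<forall>r\<in>{a..b}. \<bar>?k r\<bar> \<le> B * exp C"
    unfolding abs_mult using f(1) f(3) FC by (intro ballI mult_mono) auto
  show ?thesis
  proof (rule primitive_onI_quadratic[OF meas bd])
    fix r r' assume r: "a \<le> r" "r \<le> r'" "r' \<le> b"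
    have ki: "?k integrable_on {r..r'}" by (rule integrable_bounded_interval[OF meas bd r(1,3)])
    have ci: "(\<lambda>t. f t * exp (F r)) integrable_on {r..r'}"
      by (intro integrable_on_mult_left f(4) r)
    have FF: "F r \<le> C" "F r' \<le> C" using FC r by auto
    have sq: "(F r' - F r)\<^sup>2 \<le> (B * (r' - r))\<^sup>2"
      using f(6)[OF r] by (simp add: abs_le_square_iff[symmetric])
    have "\<bar>exp (F r') - exp (F r) - exp (F r) * (F r' - F r)\<bar> \<le> exp C * (B * (r' - r))\<^sup>2"
      by (rule order_trans[OF exp_Taylor_bound(2)[OF FF] mult_left_mono[OF sq]]) simp
    moreover have "\<bar>integral {r..r'} (\<lambda>t. f t * exp (F r) - ?k t)\<bar> \<le> (B * (exp C * (B * (r' - r)))) * (r' - r)"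
    proof (rule abs_integral_le[OF integrable_diff[OF ci ki] r(2)])
      fix t assume t: "r \<le> t" "t \<le> r'"
      have "\<bar>exp (F r) - exp (F t)\<bar> \<le> exp C * \<bar>F r - F t\<bar>"
        using exp_Taylor_bound(1)[of "F t" C "F r"] FC t r by auto
      also have "\<dots> \<le> exp C * (B * (r' - r))"
      proof -
        have "\<bar>F r - F t\<bar> \<le> B * (t - r)" using f(6)[of r t] t r by (simp add: abs_minus_commute)
        also have "\<dots> \<le> B * (r' - r)" using t f(1) by (intro mult_left_mono) auto
        finally show ?thesis by (intro mult_left_mono) auto
      qed
      finally have "\<bar>f t\<bar> * \<bar>exp (F r) - exp (F t)\<bar> \<le> B * (exp C * (B * (r' - r)))"
        using f(1) f(3)[of t] t r by (intro mult_mono) auto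
      then show "\<bar>f t * exp (F r) - ?k t\<bar> \<le> B * (exp C * (B * (r' - r)))"
        by (simp add: abs_mult[symmetric] right_diff_distrib)
    qed
    moreover have "exp (F r) * (F r' - F r) - integral {r..r'} ?k = integral {r..r'} (\<lambda>t. f t * exp (F r) - ?k t)"
      using Henstock_Kurzweil_Integration.integral_diff[OF ci ki] f(5)[OF r] by (simp add: mult.commute)
    ultimately have "\<bar>exp (F r') - exp (F r) - integral {r..r'} ?k\<bar>
        \<le> exp C * (B * (r' - r))\<^sup>2 + (B * (exp C * (B * (r' - r)))) * (r' - r)"
      by linarith
    then show "\<bar>exp (F r') - exp (F r) - integral {r..r'} ?k\<bar> \<le> (2 * exp C * B\<^sup>2) * (r' - r)\<^sup>2"
      by (simp add: power2_eq_square algebra_simps)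
  qed
qed

lemma primitive_on_integral:
  assumes "f \<in> borel_measurable (restrict_space borel {a..b})" "\<And>r. r \<in> {a..b} \<Longrightarrow> \<bar>f r\<bar> \<le> B"
  shows "primitive_on a b f (\<lambda>r. integral {a..r} f)"
  unfolding primitive_on_def using assms by (intro conjI exI[of _ B] ballI) simp_all

lemma primitive_on_linear:
  assumes "primitive_on a b f F" "primitive_on a b g G"
  shows "primitive_on a b (\<lambda>r. c * f r + d * g r) (\<lambda>r. c * F r + d * G r)"
proof -
  obtain B where f: "0 \<le> B" "f \<in> borel_measurable (restrict_space borel {a..b})"
    "\<And>r. r \<in> {a..b} \<Longrightarrow> \<bar>f r\<bar> \<le> B" "\<And>c d. a \<le> c \<Longrightarrow> d \<le> b \<Longrightarrow> f integrable_on {c..d}"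
    "\<And>c d. a \<le> c \<Longrightarrow> c \<le> d \<Longrightarrow> d \<le> b \<Longrightarrow> F d - F c = integral {c..d} f"
    by (rule primitive_onE[OF assms(1)]) (rule that; assumption)
  obtain C where g: "0 \<le> C" "g \<in> borel_measurable (restrict_space borel {a..b})"
    "\<And>r. r \<in> {a..b} \<Longrightarrow> \<bar>g r\<bar> \<le> C" "\<And>c d. a \<le> c \<Longrightarrow> d \<le> b \<Longrightarrow> g integrable_on {c..d}"
    "\<And>c d. a \<le> c \<Longrightarrow> c \<le> d \<Longrightarrow> d \<le> b \<Longrightarrow> G d - G c = integral {c..d} g"
    by (rule primitive_onE[OF assms(2)]) (rule that; assumption)
  have "(\<lambda>r. c * f r + d * g r) \<in> borel_measurable (restrict_space borel {a..b})"
    using f(2) g(2) by measurable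
  moreover have "\<bar>c * f r + d * g r\<bar> \<le> \<bar>c\<bar> * B + \<bar>d\<bar> * C" if "r \<in> {a..b}" for r
  proof -
    have "\<bar>c * f r + d * g r\<bar> \<le> \<bar>c\<bar> * \<bar>f r\<bar> + \<bar>d\<bar> * \<bar>g r\<bar>"
      using abs_triangle_ineq[of "c * f r" "d * g r"] by (simp add: abs_mult)
    also have "\<dots> \<le> \<bar>c\<bar> * B + \<bar>d\<bar> * C" using f(3)[OF that] g(3)[OF that] by (intro add_mono mult_left_mono) auto
    finally show ?thesis .
  qed
  moreover have "c * F r + d * G r = (c * F a + d * G a) + integral {a..r} (\<lambda>r. c * f r + d * g r)"
    if "r \<in> {a..b}" for r
  proof -
    have i: "f integrable_on {a..r}" "g integrable_on {a..r}" using f(4) g(4) that by auto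
    have "integral {a..r} (\<lambda>r. c * f r + d * g r) = c * integral {a..r} f + d * integral {a..r} g"
      using i by (subst Henstock_Kurzweil_Integration.integral_add) (auto intro: integrable_on_mult_right)
    then show ?thesis using f(5)[of a r] g(5)[of a r] that by (simp add: algebra_simps)
  qed
  ultimately show ?thesis unfolding primitive_on_def by blast
qed

text \<open>Multiply the primitive \<open>D g exp (- \<integral> a\<^sub>1)\<close> by \<open>exp (\<integral> (a\<^sub>1 - a\<^sub>2))\<close> and apply the product rule.\<close>

lemma renewal_equation_change_rate:
  fixes a\<^sub>1 a\<^sub>2 q\<^sub>1 q\<^sub>2 g D :: "real \<Rightarrow> real"
  assumes sT: "s \<le> T"
    and m: "a\<^sub>1 \<in> borel_measurable (restrict_space borel {s..T})" "a\<^sub>2 \<in> borel_measurable (restrict_space borel {s..T})"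
      "q\<^sub>1 \<in> borel_measurable (restrict_space borel {s..T})" "D \<in> borel_measurable (restrict_space borel {s..T})"
    and b: "\<And>r. r \<in> {s..T} \<Longrightarrow> \<bar>a\<^sub>1 r\<bar> \<le> B" "\<And>r. r \<in> {s..T} \<Longrightarrow> \<bar>a\<^sub>2 r\<bar> \<le> B"
      "\<And>r. r \<in> {s..T} \<Longrightarrow> \<bar>q\<^sub>1 r\<bar> \<le> B" "\<And>r. r \<in> {s..T} \<Longrightarrow> \<bar>D r\<bar> \<le> 1"
    and gen: "\<And>r. r \<in> {s..T} \<Longrightarrow> q\<^sub>1 r - a\<^sub>1 r * g r = q\<^sub>2 r - a\<^sub>2 r * g r"
    and D: "D s = 1"
    and eq: "\<And>r. r \<in> {s..T} \<Longrightarrow> D r * g r * exp (- integral {s..r} a\<^sub>1) =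
       C * exp (- integral {s..T} a\<^sub>1) + integral {r..T} (\<lambda>t. D t * q\<^sub>1 t * exp (- integral {s..t} a\<^sub>1))"
  shows "g s = C * exp (- integral {s..T} a\<^sub>2) + integral {s..T} (\<lambda>t. D t * q\<^sub>2 t * exp (- integral {s..t} a\<^sub>2))"
proof -
  define L1 where "L1 = (\<lambda>r. integral {s..r} a\<^sub>1)"
  define L2 where "L2 = (\<lambda>r. integral {s..r} a\<^sub>2)"
  have L1: "primitive_on s T a\<^sub>1 L1" and L2: "primitive_on s T a\<^sub>2 L2"
    unfolding L1_def L2_def by (rule primitive_on_integral[OF m(1) b(1)] primitive_on_integral[OF m(2) b(2)]; assumption)+
  have B: "0 \<le> B" using b(1)[of s] sT by simp
  \<comment> \<open>In the application \<open>g\<close> jumps at observation times, and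
    \<open>D\<close>, which records the observations already made, compensates for the jumps: by
    \<open>eq\<close> the product \<open>F\<close> is a primitive of \<open>- k\<close>, hence
    Lipschitz.\<close>
  define F where "F = (\<lambda>r. D r * g r * exp (- L1 r))"
  define k where "k = (\<lambda>t. D t * q\<^sub>1 t * exp (- L1 t))"
  obtain E1 where E1: "L1 \<in> borel_measurable (restrict_space borel {s..T})"
    "\<And>r. r \<in> {s..T} \<Longrightarrow> \<bar>L1 r\<bar> \<le> E1"
    by (rule primitive_onE[OF L1]) (rule that; assumption)
  have km: "k \<in> borel_measurable (restrict_space borel {s..T})"
    unfolding k_def using m(3,4) E1(1) by measurable
  have kb: "\<forall>r\<in>{s..T}. \<bar>k r\<bar> \<le> 1 * B * exp E1"
  proof
    fix r assume r: "r \<in> {s..T}"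
    show "\<bar>k r\<bar> \<le> 1 * B * exp E1"
      unfolding k_def abs_mult using b(3,4)[OF r] E1(2)[OF r] B by (intro mult_mono) auto
  qed
  have ki: "k integrable_on {c..d}" if "s \<le> c" "d \<le> T" for c d
    by (rule integrable_bounded_interval[OF km kb that])
  have eqF: "F r = C * exp (- L1 T) + integral {r..T} k" if "r \<in> {s..T}" for r
    using eq[OF that] unfolding F_def k_def L1_def .
  have FP: "primitive_on s T (\<lambda>r. - k r) F"
    unfolding primitive_on_def
  proof (intro conjI ballI)
    show "(\<lambda>r. - k r) \<in> borel_measurable (restrict_space borel {s..T})" using km by measurable
    show "\<exists>B. \<forall>r\<in>{s..T}. \<bar>- k r\<bar> \<le> B" using kb by (intro exI[of _ "1 * B * exp E1"]) simp
    fix r assume r: "r \<in> {s..T}"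
    have "integral {s..r} k + integral {r..T} k = integral {s..T} k"
      by (rule Henstock_Kurzweil_Integration.integral_combine) (use r ki in auto)
    then show "F r = F s + integral {s..r} (\<lambda>r. - k r)"
      using eqF[OF r] eqF[of s] sT by simp
  qed
  have E: "primitive_on s T (\<lambda>r. (a\<^sub>1 r - a\<^sub>2 r) * exp (L1 r - L2 r)) (\<lambda>r. exp (L1 r - L2 r))"
    using primitive_on_exp[OF primitive_on_linear[OF L1 L2, of 1 "-1"]] by simp
  note P = primitive_on_mult[OF FP E]
  have FE: "F r * exp (L1 r - L2 r) = D r * g r * exp (- L2 r)" for r
    unfolding F_def by (simp add: exp_diff exp_minus field_simps)
  \<comment> \<open>The generator identity enters here and nowhere else: it turns the loss terms
    created by the change of exponential into the difference of the two gain terms.\<close>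
  have dens: "- k r * exp (L1 r - L2 r) + F r * ((a\<^sub>1 r - a\<^sub>2 r) * exp (L1 r - L2 r)) = - (D r * q\<^sub>2 r * exp (- L2 r))"
    if "r \<in> {s..T}" for r
  proof -
    have q2: "q\<^sub>2 r = q\<^sub>1 r - a\<^sub>1 r * g r + a\<^sub>2 r * g r" using gen[OF that] by simp
    have "- k r * exp (L1 r - L2 r) = - (D r * q\<^sub>1 r * exp (- L2 r))"
      unfolding k_def by (simp add: exp_diff exp_minus field_simps)
    moreover have "F r * ((a\<^sub>1 r - a\<^sub>2 r) * exp (L1 r - L2 r)) = D r * g r * (a\<^sub>1 r - a\<^sub>2 r) * exp (- L2 r)"
      unfolding F_def by (simp add: exp_diff exp_minus field_simps)
    ultimately have "- k r * exp (L1 r - L2 r) + F r * ((a\<^sub>1 r - a\<^sub>2 r) * exp (L1 r - L2 r)) =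
        - (D r * q\<^sub>1 r * exp (- L2 r)) + D r * g r * (a\<^sub>1 r - a\<^sub>2 r) * exp (- L2 r)"
      by (simp only:)
    also have "\<dots> = - (D r * q\<^sub>2 r * exp (- L2 r))"
      unfolding q2 by (simp add: algebra_simps)
    finally show ?thesis .
  qed
  have "D T * g T * exp (- L2 T) - D s * g s * exp (- L2 s) =
      integral {s..T} (\<lambda>r. - k r * exp (L1 r - L2 r) + F r * ((a\<^sub>1 r - a\<^sub>2 r) * exp (L1 r - L2 r)))"
  proof -
    have "F T * exp (L1 T - L2 T) = F s * exp (L1 s - L2 s) +
      integral {s..T} (\<lambda>r. - k r * exp (L1 r - L2 r) + F r * ((a\<^sub>1 r - a\<^sub>2 r) * exp (L1 r - L2 r)))"
      by (rule bspec[OF P[unfolded primitive_on_def, THEN conjunct2, THEN conjunct2]]) (use sT in simp)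
    then show ?thesis unfolding FE by simp
  qed
  also have "\<dots> = integral {s..T} (\<lambda>t. - (D t * q\<^sub>2 t * exp (- L2 t)))"
    by (rule Henstock_Kurzweil_Integration.integral_cong) (rule dens)
  finally have "D T * g T * exp (- L2 T) - g s = - integral {s..T} (\<lambda>t. D t * q\<^sub>2 t * exp (- L2 t))"
    using D unfolding L2_def by simp
  \<comment> \<open>At \<open>r = T\<close> the integral in \<open>eq\<close> vanishes and the
    exponentials cancel.\<close>
  moreover have "D T * g T = C" using eq[of T] sT by simp
  ultimately show ?thesis unfolding L2_def by simp
qed

section \<open>Competing exponential clocks\<close>

abbreviation exp1 :: "real measure" where
  "exp1 \<equiv> density lborel (exponential_density 1)"

lemma prob_space_exp1: "prob_space exp1"
  using prob_space_exponential_density[of 1] by simp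

lemma sets_exp1: "sets exp1 = sets borel" "space exp1 = UNIV"
  by auto

lemma emeasure_exp1_greaterThan:
  assumes "0 \<le> c"
  shows "emeasure exp1 {c<..} = ennreal (exp (- c))"
proof -
  interpret prob_space exp1 by (rule prob_space_exp1)
  have "distributed exp1 lborel (\<lambda>x. x) (exponential_density 1)"
    unfolding distributed_def by (auto intro!: measure_eqI simp: emeasure_distr)
  from exponential_distributedD_gt[OF this assms]
  have "prob {c<..} = exp (- c)" by (simp add: greaterThan_def)
  then show ?thesis unfolding emeasure_eq_measure by simp
qed

lemma AE_exp1_pos: "AE e in exp1. 0 < e"
proof -
  interpret prob_space exp1 by (rule prob_space_exp1)
  have "prob {0<..} = 1" using emeasure_exp1_greaterThan[of 0] by (simp add: emeasure_eq_measure)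
  then have "AE e in exp1. e \<in> {0<..}" by (intro AE_prob_1)
  then show ?thesis by simp
qed

lemma AE_exp1_neq: "AE e in exp1. e \<noteq> c"
proof -
  have "AE e in lborel. e \<noteq> c" by (rule AE_lborel_singleton)
  then show ?thesis by (subst AE_density) auto
qed

section \<open>One clock: its ringing time and its law\<close>

definition jump_rate :: "real \<Rightarrow> (real \<Rightarrow> real) \<Rightarrow> bool" where
  "jump_rate s a \<longleftrightarrow> a \<in> borel_measurable (restrict_space borel {s..}) \<and> (\<forall>r\<ge>s. 0 \<le> a r) \<and>
     (\<forall>b. \<exists>B. \<forall>r\<in>{s..b}. \<bar>a r\<bar> \<le> B)"

text \<open>This is \<open>clock\<close> for a rate that depends on time only; it separates the
  probabilistic computations from the flow.\<close>

definition ringing_time :: "real \<Rightarrow> (real \<Rightarrow> real) \<Rightarrow> real \<Rightarrow> ereal" where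
  "ringing_time s a e = (INF t \<in> {t. s \<le> t \<and> e < (LBINT r:{s..t}. a r)}. ereal t)"

lemma jump_rate_measurable:
  assumes "jump_rate s a"
  shows "a \<in> borel_measurable (restrict_space borel {s..b})"
  by (rule measurable_restrict_mono[of _ _ "{s..}"]) (use assms in \<open>auto simp: jump_rate_def\<close>)

lemma jump_rate_bounded:
  assumes "jump_rate s a"
  obtains B where "\<And>r. r \<in> {s..b} \<Longrightarrow> \<bar>a r\<bar> \<le> B"
  using assms unfolding jump_rate_def by blast

lemma jump_rate_primitive:
  assumes "jump_rate s a"
  shows "primitive_on s b a (\<lambda>r. integral {s..r} a)"
proof -
  obtain B where "\<And>r. r \<in> {s..b} \<Longrightarrow> \<bar>a r\<bar> \<le> B" using jump_rate_bounded[OF assms] by blast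
  then show ?thesis using jump_rate_measurable[OF assms] by (intro primitive_on_integral)
qed

lemma jump_rate_integrable:
  assumes "jump_rate s a" "s \<le> c"
  shows "set_integrable lborel {c..d} a" "a integrable_on {c..d}"
proof -
  obtain B where B: "\<And>r. r \<in> {s..d} \<Longrightarrow> \<bar>a r\<bar> \<le> B" using jump_rate_bounded[OF assms(1)] by blast
  show *: "set_integrable lborel {c..d} a"
    by (rule set_integrable_bounded_interval[OF jump_rate_measurable[OF assms(1)], of d B])
      (use B assms(2) in auto)
  show "a integrable_on {c..d}" by (rule set_borel_integral_eq_integral(1)[OF *])
qed

lemma jump_rate_LBINT:
  assumes "jump_rate s a"
  shows "(LBINT r:{s..t}. a r) = integral {s..t} a"
  by (rule set_borel_integral_eq_integral(2)[OF jump_rate_integrable(1)[OF assms order_refl]])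

lemma jump_rate_integral_mono:
  assumes "jump_rate s a" "s \<le> c" "c \<le> d"
  shows "integral {s..c} a \<le> integral {s..d} a"
  using assms by (intro integral_subset_le jump_rate_integrable(2)[OF assms(1)]) (auto simp: jump_rate_def)

lemma jump_rate_integral_nonneg:
  assumes "jump_rate s a" "s \<le> c"
  shows "0 \<le> integral {s..c} a"
  using jump_rate_integral_mono[OF assms(1) order_refl assms(2)] by simp

lemma jump_rate_integral_continuous:
  assumes "jump_rate s a"
  shows "continuous_on {s..b} (\<lambda>r. integral {s..r} a)"
  by (rule primitive_onE[OF jump_rate_primitive[OF assms, of b]])

lemma ringing_time_ge: "ereal s \<le> ringing_time s a e"
  unfolding ringing_time_def by (intro INF_greatest) auto

text \<open>By continuity of the cumulative rate, a threshold exceeded at \<open>t\<close> is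
  already exceeded slightly earlier. The equivalence holds for every threshold, which suits
  measurability proofs.\<close>

lemma ringing_time_less_iff:
  assumes a: "jump_rate s a"
  shows "ringing_time s a e < ereal t \<longleftrightarrow> s < t \<and> e < integral {s..t} a"
proof
  assume "ringing_time s a e < ereal t"
  then obtain t' where t': "s \<le> t'" "e < integral {s..t'} a" "t' < t"
    unfolding ringing_time_def INF_less_iff jump_rate_LBINT[OF a] by auto
  then show "s < t \<and> e < integral {s..t} a"
    using jump_rate_integral_mono[OF a t'(1), of t] by simp
next
  assume *: "s < t \<and> e < integral {s..t} a"
  have "((\<lambda>r. integral {s..r} a) \<longlongrightarrow> integral {s..t} a) (at t within {s..t})"
    using jump_rate_integral_continuous[OF a, of t] * by (simp add: continuous_on_def)
  then have "\<forall>\<^sub>F r in at t within {s..t}. e < integral {s..r} a" using * by (intro order_tendstoD(1)) auto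
  moreover have "at t within {s..t} = at_left t" using * by (intro at_within_Icc_at_left) auto
  ultimately have "\<forall>\<^sub>F r in at_left t. e < integral {s..r} a" by simp
  then obtain b where b: "b < t" "\<And>r. b < r \<Longrightarrow> r < t \<Longrightarrow> e < integral {s..r} a"
    unfolding eventually_at_left_field by blast
  obtain r where r: "max b s < r" "r < t" using dense[of "max b s" t] b * by auto
  then have "ringing_time s a e \<le> ereal r"
    unfolding ringing_time_def jump_rate_LBINT[OF a] using b(2)[of r] by (intro INF_lower) auto
  also have "\<dots> < ereal t" using r by simp
  finally show "ringing_time s a e < ereal t" .
qed

text \<open>If \<open>e\<close> equals the cumulative rate at \<open>t\<close> and this rate stays
  flat after \<open>t\<close>, the clock rings only at the end of the flat stretch and the
  equivalence fails. That one value of \<open>e\<close> is null for the exponential law.\<close>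

lemma less_ringing_time_iff:
  assumes a: "jump_rate s a" and st: "s \<le> t" and ne: "e \<noteq> integral {s..t} a"
  shows "ereal t < ringing_time s a e \<longleftrightarrow> integral {s..t} a < e"
proof
  assume *: "ereal t < ringing_time s a e"
  show "integral {s..t} a < e"
  proof (rule ccontr)
    assume "\<not> ?thesis"
    then have "ringing_time s a e \<le> ereal t"
      unfolding ringing_time_def jump_rate_LBINT[OF a] using ne st by (intro INF_lower) auto
    then show False using * by simp
  qed
next
  assume *: "integral {s..t} a < e"
  have "((\<lambda>r. integral {s..r} a) \<longlongrightarrow> integral {s..t} a) (at t within {s..t+1})"
    using jump_rate_integral_continuous[OF a, of "t + 1"] st by (simp add: continuous_on_def)
  then have "((\<lambda>r. integral {s..r} a) \<longlongrightarrow> integral {s..t} a) (at t within {t..t+1})"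
    by (rule tendsto_within_subset) (use st in auto)
  then have "\<forall>\<^sub>F r in at t within {t..t+1}. integral {s..r} a < e" using * by (intro order_tendstoD(2)) auto
  moreover have "at t within {t..t+1} = at_right t" by (intro at_within_Icc_at_right) auto
  ultimately have "\<forall>\<^sub>F r in at_right t. integral {s..r} a < e" by simp
  then obtain b where b: "t < b" "\<And>r. t < r \<Longrightarrow> r < b \<Longrightarrow> integral {s..r} a < e"
    unfolding eventually_at_right_field by blast
  obtain r where r: "t < r" "r < b" using dense[OF b(1)] by blast
  then have "\<not> ringing_time s a e < ereal r"
    unfolding ringing_time_less_iff[OF a] using b(2)[of r] by simp
  then show "ereal t < ringing_time s a e" using r by (metis ereal_less(2) less_ereal.simps(1) not_less order.strict_trans2)
qed

lemma borel_measurable_ereal_if_less: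
  fixes f :: "'w \<Rightarrow> ereal"
  assumes "\<And>t::real. {w \<in> space N. f w < ereal t} \<in> sets N"
  shows "f \<in> borel_measurable N"
  unfolding borel_measurable_ereal_iff_Iio
proof
  fix c :: ereal
  show "f -` {..<c} \<inter> space N \<in> sets N"
  proof (cases c)
    case (real r)
    have "f -` {..<c} \<inter> space N = {w \<in> space N. f w < ereal r}" using real by auto
    then show ?thesis using assms by simp
  next
    case PInf
    have "f -` {..<c} \<inter> space N = (\<Union>n::nat. {w \<in> space N. f w < ereal (real n)})"
      using PInf less_PInf_Ex_of_nat by (auto simp: less_top)
    then show ?thesis using assms by auto
  next
    case MInf
    then have "f -` {..<c} \<inter> space N = {}" by auto
    then show ?thesis by simp
  qed
qed

lemma ringing_time_measurable [measurable]:
  assumes "jump_rate s a"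
  shows "ringing_time s a \<in> borel_measurable borel"
  by (rule borel_measurable_ereal_if_less) (simp add: ringing_time_less_iff[OF assms])

lemma nn_integral_rate_exp:
  assumes a: "jump_rate s a" and y: "s \<le> y" "y \<le> T"
  shows "(\<integral>\<^sup>+ r. ennreal (a r * exp (- integral {s..r} a)) * indicator {y..T} r \<partial>lborel) =
     ennreal (exp (- integral {s..y} a) - exp (- integral {s..T} a))"
proof -
  let ?L = "\<lambda>r. integral {s..r} a"
  have P: "primitive_on s T (\<lambda>r. - a r * exp (- ?L r)) (\<lambda>r. exp (- ?L r))"
    using primitive_on_exp[OF primitive_on_linear[OF jump_rate_primitive[OF a] jump_rate_primitive[OF a], of T "-1" 0]]
    by simp
  then obtain B where B: "(\<lambda>r. - a r * exp (- ?L r)) \<in> borel_measurable (restrict_space borel {s..T})"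
    "\<And>r. r \<in> {s..T} \<Longrightarrow> \<bar>- a r * exp (- ?L r)\<bar> \<le> B"
    "\<And>c d. s \<le> c \<Longrightarrow> c \<le> d \<Longrightarrow> d \<le> T \<Longrightarrow>
       exp (- ?L d) - exp (- ?L c) = integral {c..d} (\<lambda>r. - a r * exp (- ?L r))"
    by (rule primitive_onE) (rule that; assumption)
  have si: "set_integrable lborel {y..T} (\<lambda>r. - a r * exp (- ?L r))"
    by (rule set_integrable_bounded_interval[OF B(1), of B]) (use B(2) y in auto)
  have si': "set_integrable lborel {y..T} (\<lambda>r. a r * exp (- ?L r))"
    using set_integrable_mult_right[of "-1", OF si] by simp
  have "(\<integral>\<^sup>+ r. ennreal (a r * exp (- ?L r)) * indicator {y..T} r \<partial>lborel) =
     (\<integral>\<^sup>+ r. ennreal (indicator {y..T} r *\<^sub>R (a r * exp (- ?L r))) \<partial>lborel)"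
    by (intro nn_integral_cong) (auto simp: indicator_def)
  also have "\<dots> = ennreal (LBINT r:{y..T}. a r * exp (- ?L r))"
    unfolding set_lebesgue_integral_def
    using si' a y(1) unfolding set_integrable_def jump_rate_def
    by (intro nn_integral_eq_integral) (auto simp: indicator_def)
  also have "(LBINT r:{y..T}. a r * exp (- ?L r)) = integral {y..T} (\<lambda>r. a r * exp (- ?L r))"
    by (rule set_borel_integral_eq_integral(2)[OF si'])
  also have "\<dots> = exp (- ?L y) - exp (- ?L T)"
    using B(3)[OF y order_refl] by simp
  finally show ?thesis .
qed

lemma jump_rate_exp_measurable:
  assumes a: "jump_rate s a"
  shows "(\<lambda>r. ennreal (a r * exp (- integral {s..r} a)) * indicator {s..T} r) \<in> borel_measurable borel"
proof -
  have "continuous_on {s..T} (\<lambda>r. exp (- integral {s..r} a))"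
    by (intro continuous_intros jump_rate_integral_continuous[OF a])
  then have [measurable]: "(\<lambda>r. exp (- integral {s..r} a)) \<in> borel_measurable (restrict_space borel {s..T})"
    by (rule borel_measurable_continuous_on_restrict)
  note jump_rate_measurable[OF a, measurable]
  have "(\<lambda>r. ennreal (a r * exp (- integral {s..r} a))) \<in> borel_measurable (restrict_space borel {s..T})"
    by measurable
  then show ?thesis by (subst (asm) borel_measurable_restrict_space_iff_ennreal) auto
qed

text \<open>Cutting at \<open>T\<close> discards infinite ringing times. The two sides are then
  integrals of \<open>h\<close> against finite measures, which are identified on the half-lines
  \<open>{x<..}\<close>.\<close>

lemma ringing_time_law:
  assumes a: "jump_rate s a" and sT: "s \<le> T" and h [measurable]: "h \<in> borel_measurable borel"
  shows "(\<integral>\<^sup>+ e. (if ringing_time s a e \<le> ereal T then h (real_of_ereal (ringing_time s a e)) else 0) \<partial>exp1) =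
     (\<integral>\<^sup>+ r. h r * (ennreal (a r * exp (- integral {s..r} a)) * indicator {s..T} r) \<partial>lborel)"
proof -
  let ?L = "\<lambda>r. integral {s..r} a" and ?\<rho> = "ringing_time s a"
  note ringing_time_measurable[OF a, measurable] jump_rate_exp_measurable[OF a, measurable]
  let ?E = "{e. ?\<rho> e \<le> ereal T}"
  define N1 where "N1 = distr (density exp1 (indicator ?E)) borel (\<lambda>e. real_of_ereal (?\<rho> e))"
  define N2 where "N2 = density lborel (\<lambda>r. ennreal (a r * exp (- ?L r)) * indicator {s..T} r)"
  have "N1 = N2"
  proof (rule measure_eqI_lessThan)
    fix x :: real
    \<comment> \<open>Both measures are carried by \<open>{s..T}\<close>, so \<open>x\<close> is
      clamped to this interval.\<close>
    define y where "y = max s (min x T)"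
    have y: "s \<le> y" "y \<le> T" using sT unfolding y_def by auto
    have Ly: "0 \<le> ?L y" "?L y \<le> ?L T"
      using jump_rate_integral_nonneg[OF a y(1)] jump_rate_integral_mono[OF a y] by auto
    have "emeasure N1 {x<..} = emeasure (density exp1 (indicator ?E)) {e. x < real_of_ereal (?\<rho> e)}"
      unfolding N1_def by (subst emeasure_distr) (auto simp: vimage_def)
    also have "\<dots> = (\<integral>\<^sup>+ e. indicator ?E e * indicator {e. x < real_of_ereal (?\<rho> e)} e \<partial>exp1)"
      by (subst emeasure_density) auto
    also have "\<dots> = (\<integral>\<^sup>+ e. indicator {?L y<..} e - indicator {?L T<..} e \<partial>exp1)"
    proof (rule nn_integral_cong_AE)
      show "AE e in exp1. indicator ?E e * indicator {e. x < real_of_ereal (?\<rho> e)} e =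
          (indicator {?L y<..} e - indicator {?L T<..} e :: ennreal)"
        using AE_exp1_pos AE_exp1_neq[of "?L y"] AE_exp1_neq[of "?L T"]
      proof eventually_elim
        case (elim e)
        have T: "?\<rho> e \<le> ereal T \<longleftrightarrow> e < ?L T"
          using less_ringing_time_iff[OF a sT elim(3)] elim(3) by (auto simp: not_less[symmetric])
        have "x < real_of_ereal (?\<rho> e) \<longleftrightarrow> ?L y < e" if le: "?\<rho> e \<le> ereal T"
        proof -
          obtain t where t: "?\<rho> e = ereal t" "s \<le> t" "t \<le> T"
            using le ringing_time_ge[of s a e] by (cases "?\<rho> e") auto
          consider "x < s" | "s \<le> x" "x < T" | "T \<le> x" by linarith
          then show ?thesis
          proof cases
            case 1
            then have "y = s" using sT unfolding y_def by auto
            then show ?thesis using 1 t elim(1) by simp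
          next
            case 2
            then have yx: "y = x" unfolding y_def by auto
            show ?thesis
              using less_ringing_time_iff[OF a y(1) elim(2)] t(1) unfolding yx by simp
          next
            case 3
            then have "y = T" using sT unfolding y_def by auto
            then show ?thesis using 3 t T le by simp
          qed
        qed
        then show ?case using T Ly elim(3) by (auto simp: indicator_def)
      qed
    qed
    also have "\<dots> = emeasure exp1 {?L y<..} - emeasure exp1 {?L T<..}"
    proof -
      have "emeasure exp1 {?L T<..} \<noteq> \<infinity>"
        using emeasure_exp1_greaterThan[of "?L T"] Ly by simp
      moreover have "AE e in exp1. indicator {?L T<..} e \<le> (indicator {?L y<..} e :: ennreal)"
        using Ly by (intro AE_I2) (auto simp: indicator_def)
      ultimately show ?thesis by (subst nn_integral_diff) (auto simp: sets_exp1)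
    qed
    also have "\<dots> = ennreal (exp (- ?L y) - exp (- ?L T))"
      using Ly by (simp add: emeasure_exp1_greaterThan ennreal_minus)
    finally have 1: "emeasure N1 {x<..} = ennreal (exp (- ?L y) - exp (- ?L T))" .
    then show "emeasure N1 {x<..} < \<infinity>" by simp
    have "emeasure N2 {x<..} = (\<integral>\<^sup>+ r. (ennreal (a r * exp (- ?L r)) * indicator {s..T} r) * indicator {x<..} r \<partial>lborel)"
      unfolding N2_def by (subst emeasure_density) auto
    also have "\<dots> = (\<integral>\<^sup>+ r. ennreal (a r * exp (- ?L r)) * indicator {y..T} r \<partial>lborel)"
    proof (rule nn_integral_cong_AE)
      show "AE r in lborel. (ennreal (a r * exp (- ?L r)) * indicator {s..T} r) * indicator {x<..} r =
         ennreal (a r * exp (- ?L r)) * indicator {y..T} r"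
        using AE_lborel_singleton[of x] AE_lborel_singleton[of T]
        by eventually_elim (auto simp: y_def indicator_def max_def min_def split: if_splits)
    qed
    also have "\<dots> = ennreal (exp (- ?L y) - exp (- ?L T))"
      by (rule nn_integral_rate_exp[OF a y])
    finally show "emeasure N1 {x<..} = emeasure N2 {x<..}" using 1 by simp
  qed (simp_all add: N1_def N2_def)
  then have "(\<integral>\<^sup>+ r. h r \<partial>N1) = (\<integral>\<^sup>+ r. h r \<partial>N2)" by simp
  also have "(\<integral>\<^sup>+ r. h r \<partial>N1) = (\<integral>\<^sup>+ e. indicator ?E e * h (real_of_ereal (?\<rho> e)) \<partial>exp1)"
    unfolding N1_def by (subst nn_integral_distr) (auto simp: nn_integral_density)
  also have "\<dots> = (\<integral>\<^sup>+ e. (if ?\<rho> e \<le> ereal T then h (real_of_ereal (?\<rho> e)) else 0) \<partial>exp1)"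
    by (intro nn_integral_cong) auto
  also have "(\<integral>\<^sup>+ r. h r \<partial>N2) = (\<integral>\<^sup>+ r. h r * (ennreal (a r * exp (- ?L r)) * indicator {s..T} r) \<partial>lborel)"
    unfolding N2_def by (subst nn_integral_density) (measurable, simp_all add: mult.commute)
  finally show ?thesis .
qed

section \<open>Several clocks: the time and the index of the first ring\<close>

definition first_ring :: "nat \<Rightarrow> real \<Rightarrow> (nat \<Rightarrow> real \<Rightarrow> real) \<Rightarrow> (nat \<Rightarrow> real) \<Rightarrow> ereal" where
  "first_ring l s a e = (INF j\<in>{1..l}. ringing_time s (a j) (e j))"

definition first_ringer :: "nat \<Rightarrow> real \<Rightarrow> (nat \<Rightarrow> real \<Rightarrow> real) \<Rightarrow> (nat \<Rightarrow> real) \<Rightarrow> nat" where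
  "first_ringer l s a e = (LEAST j. j \<in> {1..l} \<and> ringing_time s (a j) (e j) = first_ring l s a e)"

lemma first_ring_le: "j \<in> {1..l} \<Longrightarrow> first_ring l s a e \<le> ringing_time s (a j) (e j)"
  unfolding first_ring_def by (rule INF_lower)

lemma less_first_ring_iff: "ereal t < first_ring l s a e \<longleftrightarrow> (\<forall>j\<in>{1..l}. ereal t < ringing_time s (a j) (e j))"
proof (cases "{1..l} = {}")
  case True show ?thesis unfolding first_ring_def True by (simp add: top_ereal_def)
next
  case False then show ?thesis unfolding first_ring_def
    by (simp add: Min_gr_iff cInf_eq_Min)
qed

lemma first_ringer:
  assumes "first_ring l s a e \<noteq> \<infinity>"
  shows "first_ringer l s a e \<in> {1..l}"
    and "ringing_time s (a (first_ringer l s a e)) (e (first_ringer l s a e)) = first_ring l s a e"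
proof -
  have "{1..l} \<noteq> {}"
  proof
    assume "{1..l} = {}"
    then have "first_ring l s a e = Inf {}" unfolding first_ring_def by (metis image_empty)
    then show False using assms by (simp add: top_ereal_def)
  qed
  then have "first_ring l s a e \<in> (\<lambda>j. ringing_time s (a j) (e j)) ` {1..l}"
    unfolding first_ring_def by (subst cInf_eq_Min) (auto intro!: Min_in)
  then obtain j where "j \<in> {1..l} \<and> ringing_time s (a j) (e j) = first_ring l s a e" by auto
  then have "first_ringer l s a e \<in> {1..l} \<and>
     ringing_time s (a (first_ringer l s a e)) (e (first_ringer l s a e)) = first_ring l s a e"
    unfolding first_ringer_def by (rule LeastI)
  then show "first_ringer l s a e \<in> {1..l}"
    "ringing_time s (a (first_ringer l s a e)) (e (first_ringer l s a e)) = first_ring l s a e" by auto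
qed

abbreviation exp1_product :: "nat \<Rightarrow> (nat \<Rightarrow> real) measure" where
  "exp1_product l \<equiv> \<Pi>\<^sub>M j\<in>{1..l}. exp1"

text \<open>Start, rates and thresholds all vary with \<open>w\<close>, so that the same facts serve
  for a fixed starting state and for joint measurability in the state and the noise.\<close>

lemma first_ring_measurable_gen:
  assumes ring [measurable]: "\<And>i. i \<in> {1..l} \<Longrightarrow> (\<lambda>w. ringing_time (s w) (a w i) (e w i)) \<in> borel_measurable N"
  shows "(\<lambda>w. first_ring l (s w) (a w) (e w)) \<in> borel_measurable N"
  unfolding first_ring_def by measurable

text \<open>The cut at \<open>T\<close> matters: an infinite first ring need not come from any
  clock, as \<open>l = 0\<close> shows, and the index is meaningful only for a finite one.\<close>

lemma first_ringer_sets_gen: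
  assumes ring: "\<And>i. i \<in> {1..l} \<Longrightarrow> (\<lambda>w. ringing_time (s w) (a w i) (e w i)) \<in> borel_measurable N"
  shows "{w \<in> space N. first_ring l (s w) (a w) (e w) \<le> ereal T \<and> first_ringer l (s w) (a w) (e w) = j} \<in> sets N"
proof (cases "j \<in> {1..l}")
  case True
  have frm [measurable]: "(\<lambda>w. first_ring l (s w) (a w) (e w)) \<in> borel_measurable N"
    by (rule first_ring_measurable_gen) (rule ring)
  \<comment> \<open>The least index is expressed by finitely many comparisons of ringing times:
    clock \<open>j\<close> attains the infimum and no earlier clock does.\<close>
  have iff: "first_ringer l s a e = j \<longleftrightarrow> ringing_time s (a j) (e j) = first_ring l s a e \<and>
     (\<forall>i\<in>{1..<j}. ringing_time s (a i) (e i) \<noteq> first_ring l s a e)" if "first_ring l s a e \<le> ereal T" for s a e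
  proof -
    have ne: "first_ring l s a e \<noteq> \<infinity>" using that by auto
    show ?thesis
    proof
      assume *: "first_ringer l s a e = j"
      have "ringing_time s (a i) (e i) \<noteq> first_ring l s a e" if i: "i \<in> {1..<j}" for i
      proof -
        have "i < (LEAST j. j \<in> {1..l} \<and> ringing_time s (a j) (e j) = first_ring l s a e)"
          using i * unfolding first_ringer_def by simp
        from not_less_Least[OF this] show ?thesis using i True by simp
      qed
      then show "ringing_time s (a j) (e j) = first_ring l s a e \<and>
          (\<forall>i\<in>{1..<j}. ringing_time s (a i) (e i) \<noteq> first_ring l s a e)"
        using first_ringer(2)[OF ne] unfolding * by blast
    next
      assume *: "ringing_time s (a j) (e j) = first_ring l s a e \<and>
          (\<forall>i\<in>{1..<j}. ringing_time s (a i) (e i) \<noteq> first_ring l s a e)"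
      show "first_ringer l s a e = j"
        unfolding first_ringer_def
      proof (rule Least_equality)
        fix i assume "i \<in> {1..l} \<and> ringing_time s (a i) (e i) = first_ring l s a e"
        then show "j \<le> i" using * by (meson atLeastAtMost_iff atLeastLessThan_iff not_less)
      qed (use * True in blast)
    qed
  qed
  let ?F = "\<lambda>w. first_ring l (s w) (a w) (e w)" and ?R = "\<lambda>i w. ringing_time (s w) (a w i) (e w i)"
  have "{w \<in> space N. ?F w \<le> ereal T \<and> first_ringer l (s w) (a w) (e w) = j} =
     {w \<in> space N. ?F w \<le> ereal T \<and> ?R j w = ?F w \<and> (\<forall>i\<in>{1..<j}. ?R i w \<noteq> ?F w)}"
    using iff by blast
  also have "\<dots> \<in> sets N"
  proof -
    have eqm: "Measurable.pred N (\<lambda>w. ?R i w = ?F w)" if "i \<in> {1..l}" for i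
      unfolding pred_def by (rule borel_measurable_eq[OF ring[OF that] frm])
    have "Measurable.pred N (\<lambda>w. \<forall>i\<in>{1..<j}. ?R i w \<noteq> ?F w)"
      using True by (intro pred_intros_finite pred_intros_logic eqm) auto
    moreover have "Measurable.pred N (\<lambda>w. ?F w \<le> ereal T)" by measurable
    ultimately show ?thesis
      unfolding pred_def[symmetric] by (intro pred_intros_logic eqm[OF True])
  qed
  finally show ?thesis .
next
  case False
  have "first_ringer l (s w) (a w) (e w) \<noteq> j" if "first_ring l (s w) (a w) (e w) \<le> ereal T" for w
  proof -
    have "first_ring l (s w) (a w) (e w) \<noteq> \<infinity>" using that by auto
    from first_ringer(1)[OF this] False show ?thesis by metis
  qed
  then have e: "{w \<in> space N. first_ring l (s w) (a w) (e w) \<le> ereal T \<and> first_ringer l (s w) (a w) (e w) = j} = {}"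
    by blast
  show ?thesis unfolding e by (rule sets.empty_sets)
qed

lemma ringing_time_component_measurable:
  assumes "\<And>j. j \<in> {1..l} \<Longrightarrow> jump_rate s (a j)" "j \<in> {1..l}"
  shows "(\<lambda>e. ringing_time s (a j) (e j)) \<in> borel_measurable (exp1_product l)"
proof -
  note ringing_time_measurable[OF assms(1)[OF assms(2)], measurable]
  show ?thesis using assms(2) by measurable
qed

lemma first_ring_measurable:
  assumes "\<And>j. j \<in> {1..l} \<Longrightarrow> jump_rate s (a j)"
  shows "first_ring l s a \<in> borel_measurable (exp1_product l)"
  by (rule first_ring_measurable_gen[of l "\<lambda>_. s" "\<lambda>_. a" "\<lambda>e. e"])
    (rule ringing_time_component_measurable[OF assms])

lemma first_ringer_sets:
  assumes a: "\<And>j. j \<in> {1..l} \<Longrightarrow> jump_rate s (a j)"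
  shows "{e \<in> space (exp1_product l). first_ring l s a e \<le> ereal T \<and> first_ringer l s a e = j} \<in> sets (exp1_product l)"
  by (rule first_ringer_sets_gen[of l "\<lambda>_. s" "\<lambda>_. a" "\<lambda>e. e"])
    (rule ringing_time_component_measurable[OF assms])

text \<open>Independence of the thresholds: survival probabilities multiply, so cumulative rates add
  up in the exponent.\<close>

lemma emeasure_exp1_product_box:
  fixes J :: "nat set"
  assumes "finite J" "\<And>i. i \<in> J \<Longrightarrow> 0 \<le> c i"
  shows "(\<integral>\<^sup>+ x. (\<Prod>i\<in>J. indicator {c i<..} (x i)) \<partial>(\<Pi>\<^sub>M i\<in>J. exp1)) = ennreal (exp (- (\<Sum>i\<in>J. c i)))"
proof -
  interpret product_sigma_finite "\<lambda>_::nat. exp1"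
    by (simp add: product_sigma_finite_def prob_space_imp_sigma_finite prob_space_exp1)
  have "(\<integral>\<^sup>+ x. (\<Prod>i\<in>J. indicator {c i<..} (x i)) \<partial>(\<Pi>\<^sub>M i\<in>J. exp1)) = (\<Prod>i\<in>J. \<integral>\<^sup>+ y. indicator {c i<..} y \<partial>exp1)"
    by (rule product_nn_integral_prod[OF assms(1)]) auto
  also have "\<dots> = (\<Prod>i\<in>J. ennreal (exp (- c i)))"
    using assms(2) by (intro prod.cong) (auto simp: emeasure_exp1_greaterThan)
  also have "\<dots> = ennreal (exp (- (\<Sum>i\<in>J. c i)))"
    using assms(1) by (simp add: prod_ennreal exp_sum sum_negf[symmetric])
  finally show ?thesis .
qed

lemma nn_integral_no_ring:
  assumes a: "\<And>j. j \<in> {1..l} \<Longrightarrow> jump_rate s (a j)" and sT: "s \<le> T"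
  shows "(\<integral>\<^sup>+ e. (if first_ring l s a e \<le> ereal T then 0 else 1) \<partial>exp1_product l) =
     ennreal (exp (- (\<Sum>j=1..l. integral {s..T} (a j))))"
proof -
  have "(\<integral>\<^sup>+ e. (if first_ring l s a e \<le> ereal T then 0 else 1) \<partial>exp1_product l) =
     (\<integral>\<^sup>+ x. (\<Prod>i\<in>{1..l}. indicator {integral {s..T} (a i)<..} (x i)) \<partial>exp1_product l)"
  proof (rule nn_integral_cong_AE)
    have "AE e in exp1_product l. \<forall>i\<in>{1..l}. e i \<noteq> integral {s..T} (a i)"
      by (intro AE_finite_allI) (auto intro: AE_PiM_component prob_space_exp1 AE_exp1_neq)
    then show "AE e in exp1_product l. (if first_ring l s a e \<le> ereal T then 0 else 1) =
       ((\<Prod>i\<in>{1..l}. indicator {integral {s..T} (a i)<..} (e i)) :: ennreal)"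
    proof eventually_elim
      case (elim e)
      have "ereal T < first_ring l s a e \<longleftrightarrow> (\<forall>i\<in>{1..l}. integral {s..T} (a i) < e i)"
        unfolding less_first_ring_iff using less_ringing_time_iff[OF a sT] elim by blast
      then show ?case by (auto simp: not_less[symmetric] indicator_def prod_eq_1_iff)
    qed
  qed
  also have "\<dots> = ennreal (exp (- (\<Sum>j=1..l. integral {s..T} (a j))))"
    using jump_rate_integral_nonneg[OF a sT] by (intro emeasure_exp1_product_box) auto
  finally show ?thesis .
qed

text \<open>Integrate over the other thresholds first. Once clock \<open>j\<close> rings at
  \<open>t\<close>, it is the first one exactly when all the others survive \<open>t\<close>, up to
  ties of probability zero; this multiplies \<open>h\<close> by their survival probability, and the
  law of a single clock supplies the density.\<close>

lemma nn_integral_first_ring_component: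
  assumes a: "\<And>j. j \<in> {1..l} \<Longrightarrow> jump_rate s (a j)" and sT: "s \<le> T" and j: "j \<in> {1..l}"
    and h [measurable]: "h \<in> borel_measurable borel"
  shows "(\<integral>\<^sup>+ e. (if first_ring l s a e \<le> ereal T \<and> first_ringer l s a e = j
       then h (real_of_ereal (first_ring l s a e)) else 0) \<partial>exp1_product l) =
     (\<integral>\<^sup>+ r. h r * ennreal (a j r * exp (- (\<Sum>i=1..l. integral {s..r} (a i)))) * indicator {s..T} r \<partial>lborel)"
proof -
  interpret product_sigma_finite "\<lambda>_::nat. exp1"
    by (simp add: product_sigma_finite_def prob_space_imp_sigma_finite prob_space_exp1)
  let ?J = "{1..l} - {j}"
  have J: "{1..l} = insert j ?J" using j by auto
  let ?f = "\<lambda>e. if first_ring l s a e \<le> ereal T \<and> first_ringer l s a e = j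
       then h (real_of_ereal (first_ring l s a e)) else 0"
  have frm [measurable]: "first_ring l s a \<in> borel_measurable (exp1_product l)"
    by (rule first_ring_measurable) (rule a)
  have [measurable]: "Measurable.pred (exp1_product l) (\<lambda>e. first_ring l s a e \<le> ereal T \<and> first_ringer l s a e = j)"
    unfolding pred_def by (rule first_ringer_sets) (rule a)
  have f: "?f \<in> borel_measurable (exp1_product l)" by measurable
  let ?\<rho> = "ringing_time s (a j)"
  \<comment> \<open>\<open>h\<close> weighted by the probability that no other clock has rung by
    time \<open>r\<close>; extended by 0 outside \<open>{s..T}\<close> to be Borel on the whole
    line.\<close>
  define g where "g r = h r * (if r \<in> {s..T} then ennreal (exp (- (\<Sum>i\<in>?J. integral {s..r} (a i)))) else 0)" for r
  have "continuous_on {s..T} (\<lambda>r. exp (- (\<Sum>i\<in>?J. integral {s..r} (a i))))"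
    by (intro continuous_intros jump_rate_integral_continuous a) auto
  then have "(\<lambda>r. ennreal (exp (- (\<Sum>i\<in>?J. integral {s..r} (a i))))) \<in> borel_measurable (restrict_space borel {s..T})"
    using borel_measurable_continuous_on_restrict by (intro measurable_compose[OF _ measurable_ennreal]) blast
  then have "(\<lambda>r. ennreal (exp (- (\<Sum>i\<in>?J. integral {s..r} (a i)))) * indicator {s..T} r) \<in> borel_measurable borel"
    by (subst (asm) borel_measurable_restrict_space_iff_ennreal) auto
  then have [measurable]: "(\<lambda>r. if r \<in> {s..T} then ennreal (exp (- (\<Sum>i\<in>?J. integral {s..r} (a i)))) else 0) \<in> borel_measurable borel"
    by (rule measurable_cong[THEN iffD1, rotated]) auto
  have g [measurable]: "g \<in> borel_measurable borel"
    unfolding g_def by measurable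
  have inner: "(\<integral>\<^sup>+ x. ?f (x(j := y)) \<partial>(\<Pi>\<^sub>M i\<in>?J. exp1)) = (if ?\<rho> y \<le> ereal T then g (real_of_ereal (?\<rho> y)) else 0)" for y
  proof (cases "?\<rho> y \<le> ereal T")
    case False
    have "\<not> (first_ring l s a (x(j := y)) \<le> ereal T \<and> first_ringer l s a (x(j := y)) = j)" for x
    proof
      assume *: "first_ring l s a (x(j := y)) \<le> ereal T \<and> first_ringer l s a (x(j := y)) = j"
      then have "first_ring l s a (x(j := y)) \<noteq> \<infinity>" by auto
      from first_ringer(2)[OF this] * have "?\<rho> y \<le> ereal T" by (simp add: conjunct2[OF *])
      then show False using False by blast
    qed
    then have "?f (x(j := y)) = 0" for x by (simp only: if_False simp_thms)
    then show ?thesis using False by (simp del: not_le)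
  next
    case True
    then obtain t where t: "?\<rho> y = ereal t" "s \<le> t" "t \<le> T"
      using ringing_time_ge[of s "a j" y] by (cases "?\<rho> y") auto
    have "(\<integral>\<^sup>+ x. ?f (x(j := y)) \<partial>(\<Pi>\<^sub>M i\<in>?J. exp1)) =
       (\<integral>\<^sup>+ x. h t * (\<Prod>i\<in>?J. indicator {integral {s..t} (a i)<..} (x i)) \<partial>(\<Pi>\<^sub>M i\<in>?J. exp1))"
    proof (rule nn_integral_cong_AE)
      have "AE x in (\<Pi>\<^sub>M i\<in>?J. exp1). \<forall>i\<in>?J. x i \<noteq> integral {s..t} (a i) \<and> 0 < x i"
        by (intro AE_finite_allI AE_conjI AE_PiM_component prob_space_exp1 AE_exp1_neq AE_exp1_pos) simp
      then show "AE x in (\<Pi>\<^sub>M i\<in>?J. exp1). ?f (x(j := y)) =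
          h t * (\<Prod>i\<in>?J. indicator {integral {s..t} (a i)<..} (x i))"
      proof eventually_elim
        case (elim x)
        let ?e = "x(j := y)"
        have ej: "ringing_time s (a j) (?e j) = ereal t" using t by simp
        have le: "first_ring l s a ?e \<le> ereal t" using first_ring_le[OF j, of s a ?e] ej by simp
        show ?case
        proof (cases "\<forall>i\<in>?J. integral {s..t} (a i) < x i")
          case True
          have gt: "ereal t < ringing_time s (a i) (?e i)" if "i \<in> ?J" for i
            using less_ringing_time_iff[OF a t(2), of i "x i"] elim True that by auto
          have "first_ring l s a ?e = ereal t"
          proof (rule antisym[OF le])
            show "ereal t \<le> first_ring l s a ?e" unfolding first_ring_def
            proof (rule INF_greatest)
              fix i assume "i \<in> {1..l}"
              then show "ereal t \<le> ringing_time s (a i) (?e i)"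
                using gt[of i] ej by (cases "i = j") (auto simp: less_imp_le)
            qed
          qed
          moreover have "first_ringer l s a ?e = j"
          proof (rule ccontr)
            assume ne: "first_ringer l s a ?e \<noteq> j"
            have "first_ring l s a ?e \<noteq> \<infinity>" using calculation by simp
            note fr = first_ringer[OF this]
            have "ereal t < first_ring l s a ?e" using gt[of "first_ringer l s a ?e"] fr ne by simp
            then show False using calculation by simp
          qed
          ultimately show ?thesis using True t(3) by simp
        next
          case False
          then obtain i where i: "i \<in> ?J" "x i < integral {s..t} (a i)" using elim by force
          \<comment> \<open>At \<open>t = s\<close> the cumulative rate is 0, and a ring would need
            a negative threshold, whereas thresholds are almost surely positive.\<close>
          have "s < t"
          proof (rule ccontr)
            assume "\<not> s < t"
            then have "integral {s..t} (a i) = 0" using t(2) by simp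
            then show False using i elim by force
          qed
          then have "ringing_time s (a i) (?e i) < ereal t"
            using ringing_time_less_iff[OF a, of i "x i" t] i by auto
          then have "first_ring l s a ?e < ereal t"
            by (rule le_less_trans[rotated]) (rule first_ring_le, use i in simp)
          moreover from this have "first_ring l s a ?e \<noteq> \<infinity>" by auto
          ultimately have "first_ringer l s a ?e \<noteq> j"
            using first_ringer(2)[of l s a ?e] ej by (intro notI) (simp only: less_irrefl simp_thms)
          moreover have "(\<Prod>i\<in>?J. indicator {integral {s..t} (a i)<..} (x i)) = (0::ennreal)"
            using i by (intro prod_zero bexI[of _ i]) auto
          ultimately show ?thesis by simp
        qed
      qed
    qed
    also have "\<dots> = h t * (\<integral>\<^sup>+ x. (\<Prod>i\<in>?J. indicator {integral {s..t} (a i)<..} (x i)) \<partial>(\<Pi>\<^sub>M i\<in>?J. exp1))"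
      by (rule nn_integral_cmult) measurable
    also have "\<dots> = h t * ennreal (exp (- (\<Sum>i\<in>?J. integral {s..t} (a i))))"
      using jump_rate_integral_nonneg[OF a t(2)] by (subst emeasure_exp1_product_box) auto
    finally show ?thesis using True t unfolding g_def by simp
  qed
  have "integral\<^sup>N (exp1_product l) ?f = integral\<^sup>N (\<Pi>\<^sub>M i\<in>insert j ?J. exp1) ?f" using J by simp
  also have "\<dots> = (\<integral>\<^sup>+ y. (\<integral>\<^sup>+ x. ?f (x(j := y)) \<partial>(\<Pi>\<^sub>M i\<in>?J. exp1)) \<partial>exp1)"
    by (rule product_nn_integral_insert_rev) (use f J in auto)
  also have "\<dots> = (\<integral>\<^sup>+ y. (if ?\<rho> y \<le> ereal T then g (real_of_ereal (?\<rho> y)) else 0) \<partial>exp1)"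
    by (simp only: inner)
  also have "\<dots> = (\<integral>\<^sup>+ r. g r * (ennreal (a j r * exp (- integral {s..r} (a j))) * indicator {s..T} r) \<partial>lborel)"
    by (rule ringing_time_law[OF a[OF j] sT g])
  also have "\<dots> = (\<integral>\<^sup>+ r. h r * ennreal (a j r * exp (- (\<Sum>i=1..l. integral {s..r} (a i)))) * indicator {s..T} r \<partial>lborel)"
  proof (rule nn_integral_cong)
    fix r
    show "g r * (ennreal (a j r * exp (- integral {s..r} (a j))) * indicator {s..T} r) =
       h r * ennreal (a j r * exp (- (\<Sum>i=1..l. integral {s..r} (a i)))) * indicator {s..T} r"
    proof (cases "r \<in> {s..T}")
      case True
      have "0 \<le> a j r" using a[OF j] True unfolding jump_rate_def by simp
      moreover have "(\<Sum>i=1..l. integral {s..r} (a i)) = integral {s..r} (a j) + (\<Sum>i\<in>?J. integral {s..r} (a i))"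
        using j by (subst sum.remove[of _ j]) auto
      ultimately have "ennreal (a j r * exp (- (\<Sum>i=1..l. integral {s..r} (a i)))) =
          ennreal (exp (- (\<Sum>i\<in>?J. integral {s..r} (a i)))) * ennreal (a j r * exp (- integral {s..r} (a j)))"
        by (subst ennreal_mult[symmetric]) (simp_all add: exp_diff exp_minus field_simps)
      then show ?thesis using True unfolding g_def by (simp add: mult.assoc)
    qed simp
  qed
  finally show ?thesis .
qed

lemma nn_integral_first_ring:
  assumes a: "\<And>j. j \<in> {1..l} \<Longrightarrow> jump_rate s (a j)" and sT: "s \<le> T"
    and h: "\<And>j. j \<in> {1..l} \<Longrightarrow> h j \<in> borel_measurable borel"
  shows "(\<integral>\<^sup>+ e. (if first_ring l s a e \<le> ereal T
       then h (first_ringer l s a e) (real_of_ereal (first_ring l s a e)) else c) \<partial>exp1_product l) =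
     c * ennreal (exp (- (\<Sum>j=1..l. integral {s..T} (a j)))) +
     (\<Sum>j=1..l. \<integral>\<^sup>+ r. h j r * ennreal (a j r * exp (- (\<Sum>i=1..l. integral {s..r} (a i)))) * indicator {s..T} r \<partial>lborel)"
proof -
  let ?F = "first_ring l s a" and ?I = "first_ringer l s a"
  have frm [measurable]: "first_ring l s a \<in> borel_measurable (exp1_product l)"
    by (rule first_ring_measurable) (rule a)
  have m [measurable]: "Measurable.pred (exp1_product l) (\<lambda>e. ?F e \<le> ereal T \<and> ?I e = j)" for j
    unfolding pred_def by (rule first_ringer_sets) (rule a)
  have hm: "(\<lambda>e. if ?F e \<le> ereal T \<and> ?I e = j then h j (real_of_ereal (?F e)) else 0) \<in> borel_measurable (exp1_product l)"
    if "j \<in> {1..l}" for j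
  proof -
    note h[OF that, measurable]
    show ?thesis by measurable
  qed
  have "(\<integral>\<^sup>+ e. (if ?F e \<le> ereal T then h (?I e) (real_of_ereal (?F e)) else c) \<partial>exp1_product l) =
     (\<integral>\<^sup>+ e. c * (if ?F e \<le> ereal T then 0 else 1) +
        (\<Sum>j=1..l. if ?F e \<le> ereal T \<and> ?I e = j then h j (real_of_ereal (?F e)) else 0) \<partial>exp1_product l)"
  proof (rule nn_integral_cong)
    fix e
    show "(if ?F e \<le> ereal T then h (?I e) (real_of_ereal (?F e)) else c) =
      c * (if ?F e \<le> ereal T then 0 else 1) +
        (\<Sum>j=1..l. if ?F e \<le> ereal T \<and> ?I e = j then h j (real_of_ereal (?F e)) else 0)"
    proof (cases "?F e \<le> ereal T")
      case True
      then have "?F e \<noteq> \<infinity>" by auto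
      then have "?I e \<in> {1..l}" by (rule first_ringer(1))
      then have "(\<Sum>j=1..l. if ?I e = j then h j (real_of_ereal (?F e)) else 0) = h (?I e) (real_of_ereal (?F e))"
        by (subst sum.delta') auto
      then show ?thesis using True by simp
    qed simp
  qed
  also have "\<dots> = c * (\<integral>\<^sup>+ e. (if ?F e \<le> ereal T then 0 else 1) \<partial>exp1_product l) +
      (\<Sum>j=1..l. \<integral>\<^sup>+ e. (if ?F e \<le> ereal T \<and> ?I e = j then h j (real_of_ereal (?F e)) else 0) \<partial>exp1_product l)"
  proof -
    have 1: "(\<lambda>e. if ?F e \<le> ereal T then 0 else (1::ennreal)) \<in> borel_measurable (exp1_product l)"
      by measurable
    have 2: "(\<lambda>e. \<Sum>j=1..l. if ?F e \<le> ereal T \<and> ?I e = j then h j (real_of_ereal (?F e)) else 0)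
        \<in> borel_measurable (exp1_product l)"
      by (rule borel_measurable_sum) (rule hm)
    have 3: "(\<lambda>e. c * (if ?F e \<le> ereal T then 0 else (1::ennreal))) \<in> borel_measurable (exp1_product l)"
      by measurable
    show ?thesis
      unfolding nn_integral_add[OF 3 2]
        nn_integral_cmult[OF 1] by (subst nn_integral_sum) (use hm in simp_all)
  qed
  also have "\<dots> = c * ennreal (exp (- (\<Sum>j=1..l. integral {s..T} (a j)))) +
     (\<Sum>j=1..l. \<integral>\<^sup>+ r. h j r * ennreal (a j r * exp (- (\<Sum>i=1..l. integral {s..r} (a i)))) * indicator {s..T} r \<partial>lborel)"
  proof (intro arg_cong2[where f = "(+)"] arg_cong2[where f = "(*)"] refl sum.cong)
    show "(\<integral>\<^sup>+ e. (if ?F e \<le> ereal T then 0 else 1) \<partial>exp1_product l) =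
        ennreal (exp (- (\<Sum>j=1..l. integral {s..T} (a j))))"
      by (rule nn_integral_no_ring[OF _ sT]) (rule a)
    fix j assume j: "j \<in> {1..l}"
    show "(\<integral>\<^sup>+ e. (if ?F e \<le> ereal T \<and> ?I e = j then h j (real_of_ereal (?F e)) else 0) \<partial>exp1_product l) =
      (\<integral>\<^sup>+ r. h j r * ennreal (a j r * exp (- (\<Sum>i=1..l. integral {s..r} (a i)))) * indicator {s..T} r \<partial>lborel)"
      by (rule nn_integral_first_ring_component[OF _ sT j h[OF j]]) (rule a)
  qed
  finally show ?thesis .
qed

section \<open>Independence of the rounds\<close>

lemma clock_eq_ringing_time: "clock \<phi> lam e j s x = ringing_time s (\<lambda>r. lam j r (\<phi> s r x)) e"
  unfolding clock_def ringing_time_def ..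

lemma next_time_eq_first_ring: "next_time \<phi> l lam e s x = first_ring l s (\<lambda>j r. lam j r (\<phi> s r x)) e"
  unfolding next_time_def first_ring_def clock_eq_ringing_time ..

lemma next_index_eq_first_ringer: "next_index \<phi> l lam e s x = first_ringer l s (\<lambda>j r. lam j r (\<phi> s r x)) e"
  unfolding next_index_def first_ringer_def clock_eq_ringing_time next_time_eq_first_ring ..

abbreviation state_space :: "'a::euclidean_space set \<Rightarrow> (real \<times> 'a) measure" where
  "state_space M \<equiv> half_line \<Otimes>\<^sub>M borel_on M"

abbreviation round_noise :: "nat \<Rightarrow> ((nat \<Rightarrow> real) \<times> real) measure" where
  "round_noise l \<equiv> exp1_product l \<Otimes>\<^sub>M uniform01"

lemma noise_eq: "noise l = (\<Pi>\<^sub>M k\<in>{1..}. round_noise l)"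
  unfolding noise_def ..

lemma prob_space_uniform01: "prob_space uniform01"
  by (rule prob_spaceI) (simp add: emeasure_restrict_space)

lemma prob_space_exp1_product: "prob_space (exp1_product l)"
  by (intro prob_space_PiM prob_space_exp1)

lemma prob_space_round_noise: "prob_space (round_noise l)"
  by (rule prob_space_pair) (rule prob_space_exp1_product prob_space_uniform01)+

lemma prob_space_noise: "prob_space (noise l)"
  unfolding noise_eq by (intro prob_space_PiM prob_space_round_noise)

definition noise_shift :: "(nat \<Rightarrow> 'b) \<Rightarrow> (nat \<Rightarrow> 'b)" where
  "noise_shift \<eta> = (\<lambda>k\<in>{1..}. \<eta> (Suc k))"

text \<open>Rounds are numbered from 1, so the new round takes index 1 and the others move up. The
  restriction matches the extensional functions that form the product space.\<close>

definition noise_cons :: "'b \<Rightarrow> (nat \<Rightarrow> 'b) \<Rightarrow> (nat \<Rightarrow> 'b)" where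
  "noise_cons \<nu> \<eta> = (\<lambda>k\<in>{1..}. if k = 1 then \<nu> else \<eta> (k - 1))"

lemma noise_cons_1 [simp]: "noise_cons \<nu> \<eta> 1 = \<nu>" "noise_cons \<nu> \<eta> (Suc 0) = \<nu>"
  unfolding noise_cons_def by auto

lemma noise_shift_cons: "\<eta> \<in> space (noise l) \<Longrightarrow> noise_shift (noise_cons \<nu> \<eta>) = \<eta>"
  unfolding noise_shift_def noise_cons_def noise_eq space_PiM
  by (rule ext) (auto simp: restrict_def PiE_def extensional_def)

lemma noise_shift_measurable [measurable]: "noise_shift \<in> noise l \<rightarrow>\<^sub>M noise l"
  unfolding noise_shift_def noise_eq by (rule measurable_restrict) measurable

lemma noise_cons_measurable [measurable]:
  "(\<lambda>(\<nu>, \<eta>). noise_cons \<nu> \<eta>) \<in> round_noise l \<Otimes>\<^sub>M noise l \<rightarrow>\<^sub>M noise l"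
  unfolding noise_cons_def noise_eq case_prod_beta
proof (rule measurable_restrict)
  fix k :: nat assume k: "k \<in> {1..}"
  show "(\<lambda>p. if k = 1 then fst p else snd p (k - 1)) \<in> round_noise l \<Otimes>\<^sub>M (\<Pi>\<^sub>M k\<in>{1..}. round_noise l) \<rightarrow>\<^sub>M round_noise l"
  proof (cases "k = 1")
    case False
    then have "k - 1 \<in> {1..}" using k by auto
    then have "(\<lambda>p. snd p (k - 1)) \<in> round_noise l \<Otimes>\<^sub>M (\<Pi>\<^sub>M k\<in>{1..}. round_noise l) \<rightarrow>\<^sub>M round_noise l"
      by (intro measurable_compose[OF measurable_snd] measurable_component_singleton)
    then show ?thesis using False by simp
  qed simp
qed

text \<open>An independent round put in front of an i.i.d. sequence gives an i.i.d. sequence with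
  the same law. It suffices to compare boxes that constrain finitely many rounds.\<close>

lemma distr_noise_cons:
  "distr (round_noise l \<Otimes>\<^sub>M noise l) (noise l) (\<lambda>(\<nu>, \<eta>). noise_cons \<nu> \<eta>) = noise l"
proof -
  let ?N = "round_noise l"
  interpret N: prob_space ?N by (rule prob_space_round_noise)
  interpret S: prob_space "noise l" by (rule prob_space_noise)
  interpret PN: pair_prob_space ?N "noise l" ..
  interpret P: product_prob_space "\<lambda>_::nat. ?N" "{1..}"
    by unfold_locales
  have "distr (?N \<Otimes>\<^sub>M noise l) (noise l) (\<lambda>(\<nu>, \<eta>). noise_cons \<nu> \<eta>) = (\<Pi>\<^sub>M k\<in>{1..}. ?N)"
  proof (rule P.PiM_eq)
    show "sets (distr (?N \<Otimes>\<^sub>M noise l) (noise l) (\<lambda>(\<nu>, \<eta>). noise_cons \<nu> \<eta>)) = sets (\<Pi>\<^sub>M k\<in>{1..}. ?N)"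
      by (simp add: noise_eq)
    fix J :: "nat set" and F assume J: "finite J" "J \<subseteq> {1..}" and F: "\<And>j. j \<in> J \<Longrightarrow> F j \<in> sets ?N"
    \<comment> \<open>Unconstrained rounds receive the whole space, so that the first factor has
      mass 1 when round 1 is not constrained.\<close>
    define F' where "F' j = (if j \<in> J then F j else space ?N)" for j
    have F': "F' j \<in> sets ?N" for j using F unfolding F'_def by auto
    let ?J' = "(\<lambda>k. k - 1) ` (J - {1})"
    have J': "finite ?J'" "?J' \<subseteq> {1..}" using J by auto
    have inj: "inj_on (\<lambda>k. k - 1) (J - {1})" using J(2) by (intro inj_onI) force
    have emb: "prod_emb {1..} (\<lambda>_. ?N) J (Pi\<^sub>E J F) \<in> sets (noise l)"
      unfolding noise_eq using J F by (intro sets_PiM_I) auto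
    have emb': "prod_emb {1..} (\<lambda>_. ?N) ?J' (Pi\<^sub>E ?J' (\<lambda>j. F' (Suc j))) \<in> sets (noise l)"
      unfolding noise_eq using J' F' by (intro sets_PiM_I) auto
    have pre: "(\<lambda>(\<nu>, \<eta>). noise_cons \<nu> \<eta>) -` (prod_emb {1..} (\<lambda>_. ?N) J (Pi\<^sub>E J F)) \<inter> space (?N \<Otimes>\<^sub>M noise l)
        = F' 1 \<times> prod_emb {1..} (\<lambda>_. ?N) ?J' (Pi\<^sub>E ?J' (\<lambda>j. F' (Suc j)))"
    proof (intro set_eqI)
      fix p :: "((nat \<Rightarrow> real) \<times> real) \<times> (nat \<Rightarrow> (nat \<Rightarrow> real) \<times> real)"
      obtain \<nu> \<eta> where p: "p = (\<nu>, \<eta>)" by (cases p)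
      have sp: "\<eta> \<in> space (noise l) \<longleftrightarrow> \<eta> \<in> ({1..} \<rightarrow>\<^sub>E space ?N)" by (simp add: noise_eq space_PiM)
      have "noise_cons \<nu> \<eta> \<in> prod_emb {1..} (\<lambda>_. ?N) J (Pi\<^sub>E J F) \<longleftrightarrow> (\<forall>k\<in>J. noise_cons \<nu> \<eta> k \<in> F k)"
        if "\<nu> \<in> space ?N" "\<eta> \<in> ({1..} \<rightarrow>\<^sub>E space ?N)"
      proof -
        have "noise_cons \<nu> \<eta> \<in> ({1..} \<rightarrow>\<^sub>E space ?N)"
          using that unfolding noise_cons_def by (auto simp: PiE_iff)
        then show ?thesis using J(2) by (auto simp: prod_emb_iff PiE_iff restrict_def extensional_def)
      qed
      moreover have "(\<forall>k\<in>J. noise_cons \<nu> \<eta> k \<in> F k) \<longleftrightarrow> \<nu> \<in> F' 1 \<and> (\<forall>j\<in>?J'. \<eta> j \<in> F' (Suc j))"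
        if "\<nu> \<in> space ?N"
      proof -
        have 1: "(\<forall>j\<in>?J'. \<eta> j \<in> F' (Suc j)) \<longleftrightarrow> (\<forall>k\<in>J - {1}. \<eta> (k - 1) \<in> F k)"
        proof -
          have "F' (Suc (k - 1)) = F k" if "k \<in> J - {1}" for k
            using that J(2) unfolding F'_def by (auto simp: subset_iff)
          then show ?thesis by auto
        qed
        have 2: "noise_cons \<nu> \<eta> k = \<eta> (k - 1)" if "k \<in> J - {1}" for k
          using that J(2) unfolding noise_cons_def by auto
        have 3: "\<nu> \<in> F' 1 \<longleftrightarrow> (1 \<in> J \<longrightarrow> \<nu> \<in> F 1)" using that unfolding F'_def by auto
        show ?thesis unfolding 1 3 using 2 by (metis DiffE DiffI insertI1 noise_cons_1(1) singletonD)
      qed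
      moreover have "\<eta> \<in> prod_emb {1..} (\<lambda>_. ?N) ?J' (Pi\<^sub>E ?J' (\<lambda>j. F' (Suc j))) \<longleftrightarrow>
          \<eta> \<in> ({1..} \<rightarrow>\<^sub>E space ?N) \<and> (\<forall>j\<in>?J'. \<eta> j \<in> F' (Suc j))"
        unfolding prod_emb_iff by (auto simp: PiE_iff)
      moreover have "\<nu> \<in> F' 1 \<Longrightarrow> \<nu> \<in> space ?N" using sets.sets_into_space[OF F'] by blast
      ultimately show "p \<in> (\<lambda>(\<nu>, \<eta>). noise_cons \<nu> \<eta>) -` (prod_emb {1..} (\<lambda>_. ?N) J (Pi\<^sub>E J F)) \<inter> space (?N \<Otimes>\<^sub>M noise l) \<longleftrightarrow>
         p \<in> F' 1 \<times> prod_emb {1..} (\<lambda>_. ?N) ?J' (Pi\<^sub>E ?J' (\<lambda>j. F' (Suc j)))"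
        unfolding p space_pair_measure vimage_def Int_iff mem_Collect_eq mem_Times_iff fst_conv snd_conv prod.case sp
        by blast
    qed
    have "emeasure (distr (?N \<Otimes>\<^sub>M noise l) (noise l) (\<lambda>(\<nu>, \<eta>). noise_cons \<nu> \<eta>)) (prod_emb {1..} (\<lambda>_. ?N) J (Pi\<^sub>E J F))
      = emeasure ?N (F' 1) * emeasure (noise l) (prod_emb {1..} (\<lambda>_. ?N) ?J' (Pi\<^sub>E ?J' (\<lambda>j. F' (Suc j))))"
      unfolding emeasure_distr[OF noise_cons_measurable emb] pre
      by (rule S.emeasure_pair_measure_Times[OF F' emb'])
    also have "emeasure (noise l) (prod_emb {1..} (\<lambda>_. ?N) ?J' (Pi\<^sub>E ?J' (\<lambda>j. F' (Suc j)))) = (\<Prod>j\<in>?J'. emeasure ?N (F' (Suc j)))"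
      unfolding noise_eq by (rule P.emeasure_PiM_emb[OF J'(2,1) F'])
    also have "\<dots> = (\<Prod>k\<in>J - {1}. emeasure ?N (F k))"
      unfolding prod.reindex[OF inj] comp_def using J(2)
      by (intro prod.cong) (auto simp: F'_def subset_iff)
    also have "emeasure ?N (F' 1) * (\<Prod>k\<in>J - {1}. emeasure ?N (F k)) = (\<Prod>k\<in>J. emeasure ?N (F k))"
    proof (cases "1 \<in> J")
      case True
      then show ?thesis unfolding F'_def using J(1) by (subst (2) prod.remove[of _ 1]) auto
    next
      case False
      then show ?thesis unfolding F'_def by (simp add: N.emeasure_space_1 del: One_nat_def)
    qed
    finally show "emeasure (distr (?N \<Otimes>\<^sub>M noise l) (noise l) (\<lambda>(\<nu>, \<eta>). noise_cons \<nu> \<eta>)) (prod_emb {1..} (\<lambda>_. ?N) J (Pi\<^sub>E J F))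
      = (\<Prod>k\<in>J. emeasure ?N (F k))" .
  qed
  then show ?thesis by (simp add: noise_eq)
qed

text \<open>Conditioning on the first round: the source of the Markov property at the first
  jump.\<close>

lemma nn_integral_noise:
  assumes "f \<in> borel_measurable (noise l)"
  shows "(\<integral>\<^sup>+ \<eta>. f \<eta> \<partial>noise l) = (\<integral>\<^sup>+ \<nu>. (\<integral>\<^sup>+ \<eta>. f (noise_cons \<nu> \<eta>) \<partial>noise l) \<partial>round_noise l)"
proof -
  interpret S: prob_space "noise l" by (rule prob_space_noise)
  note assms[measurable]
  have "(\<integral>\<^sup>+ \<eta>. f \<eta> \<partial>noise l) = (\<integral>\<^sup>+ p. f (case p of (\<nu>, \<eta>) \<Rightarrow> noise_cons \<nu> \<eta>) \<partial>(round_noise l \<Otimes>\<^sub>M noise l))"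
    by (subst distr_noise_cons[symmetric], subst nn_integral_distr[OF noise_cons_measurable]) (simp_all add: assms)
  also have "\<dots> = (\<integral>\<^sup>+ \<nu>. (\<integral>\<^sup>+ \<eta>. f (noise_cons \<nu> \<eta>) \<partial>noise l) \<partial>round_noise l)"
    by (subst S.nn_integral_fst[symmetric, OF measurable_compose[OF noise_cons_measurable assms]]) simp
  finally show ?thesis .
qed

section \<open>Flow lines and the first jump\<close>

lemma space_borel_on [simp]: "space (borel_on M) = M"
  by (simp add: space_restrict_space)

lemma measurable_half_line: "f \<in> borel_measurable N \<Longrightarrow> (\<And>w. w \<in> space N \<Longrightarrow> 0 \<le> f w) \<Longrightarrow> f \<in> N \<rightarrow>\<^sub>M half_line"
  by (rule measurable_restrict_space2) auto

lemma measurable_const_borel_on: "x \<in> M \<Longrightarrow> (\<lambda>_. x) \<in> N \<rightarrow>\<^sub>M borel_on M"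
  by (rule measurable_const) simp

locale pdmp_system =
  fixes M :: "'a::euclidean_space set"
    and \<phi> :: "real \<Rightarrow> real \<Rightarrow> 'a \<Rightarrow> 'a"
    and l :: nat
    and lam :: "nat \<Rightarrow> real \<Rightarrow> 'a \<Rightarrow> real"
    and G :: "nat \<Rightarrow> real \<Rightarrow> 'a \<Rightarrow> real \<Rightarrow> 'a"
  assumes closed_M: "closed M"
    and flow: "differential_flow M \<phi>"
    and lam_measurable: "j \<in> {1..l} \<Longrightarrow> (\<lambda>(t, x). lam j t x) \<in> borel_measurable (state_space M)"
    and lam_nonneg: "j \<in> {1..l} \<Longrightarrow> 0 \<le> t \<Longrightarrow> x \<in> M \<Longrightarrow> 0 \<le> lam j t x"
    and lam_bounded: "j \<in> {1..l} \<Longrightarrow> compact K \<Longrightarrow> K \<subseteq> {0..} \<times> M \<Longrightarrow> bounded ((\<lambda>(t, x). lam j t x) ` K)"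
    and G_measurable: "j \<in> {1..l} \<Longrightarrow>
       (\<lambda>(t, x, u). G j t x u) \<in> half_line \<Otimes>\<^sub>M borel_on M \<Otimes>\<^sub>M borel_on {0..1} \<rightarrow>\<^sub>M borel_on M"
begin

lemma flow_measurable:
  assumes "f \<in> borel_measurable N" "g \<in> borel_measurable N" "X \<in> N \<rightarrow>\<^sub>M borel_on M"
    and "\<And>w. w \<in> space N \<Longrightarrow> 0 \<le> f w \<and> f w \<le> g w"
  shows "(\<lambda>w. \<phi> (f w) (g w) (X w)) \<in> N \<rightarrow>\<^sub>M borel_on M"
proof -
  have "(\<lambda>w. (f w, g w - f w, X w)) \<in> N \<rightarrow>\<^sub>M half_line \<Otimes>\<^sub>M half_line \<Otimes>\<^sub>M borel_on M"
    by (intro measurable_Pair measurable_half_line borel_measurable_diff assms(1-3)) (use assms(4) in auto)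
  from measurable_compose[OF this flow[unfolded differential_flow_def, THEN conjunct1]]
  show ?thesis by simp
qed

lemma lam_compose_measurable:
  assumes "j \<in> {1..l}" "f \<in> borel_measurable N" "X \<in> N \<rightarrow>\<^sub>M borel_on M" "\<And>w. w \<in> space N \<Longrightarrow> 0 \<le> f w"
  shows "(\<lambda>w. lam j (f w) (X w)) \<in> borel_measurable N"
proof -
  have "(\<lambda>w. (f w, X w)) \<in> N \<rightarrow>\<^sub>M state_space M"
    by (intro measurable_Pair measurable_half_line assms)
  from measurable_compose[OF this lam_measurable[OF assms(1)]] show ?thesis by simp
qed

lemma G_compose_measurable:
  assumes "j \<in> {1..l}" "f \<in> borel_measurable N" "X \<in> N \<rightarrow>\<^sub>M borel_on M" "\<And>w. w \<in> space N \<Longrightarrow> 0 \<le> f w"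
    and "U \<in> N \<rightarrow>\<^sub>M borel_on {0..1}"
  shows "(\<lambda>w. G j (f w) (X w) (U w)) \<in> N \<rightarrow>\<^sub>M borel_on M"
proof -
  have "(\<lambda>w. (f w, X w, U w)) \<in> N \<rightarrow>\<^sub>M half_line \<Otimes>\<^sub>M borel_on M \<Otimes>\<^sub>M borel_on {0..1}"
    by (intro measurable_Pair measurable_half_line assms)
  from measurable_compose[OF this G_measurable[OF assms(1)]] show ?thesis by simp
qed

lemma flow_in_M: 
  assumes "0 \<le> s" "s \<le> t" "x \<in> M" shows "\<phi> s t x \<in> M"
proof -
  have "(\<lambda>x. \<phi> s t x) \<in> borel_on M \<rightarrow>\<^sub>M borel_on M"
    by (rule flow_measurable) (use assms in auto)
  from measurable_space[OF this, of x] assms(3) show ?thesis by simp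
qed

lemma G_in_M:
  assumes "j \<in> {1..l}" "0 \<le> t" "x \<in> M" "u \<in> {0..1}" shows "G j t x u \<in> M"
proof -
  have "(\<lambda>u. G j t x u) \<in> borel_on {0..1} \<rightarrow>\<^sub>M borel_on M"
    by (rule G_compose_measurable) (use assms in \<open>auto intro: measurable_const_borel_on\<close>)
  from measurable_space[OF this, of u] assms(4) show ?thesis by simp
qed

lemma flow_id: "0 \<le> s \<Longrightarrow> x \<in> M \<Longrightarrow> \<phi> s s x = x"
  using flow[unfolded differential_flow_def, THEN conjunct2, THEN conjunct1] by simp

lemma flow_flow:
  assumes "0 \<le> s" "s \<le> r" "r \<le> t" "x \<in> M"
  shows "\<phi> r t (\<phi> s r x) = \<phi> s t x"
proof -
  have "\<forall>t\<ge>0. \<forall>h\<^sub>1\<ge>0. \<forall>h\<^sub>2\<ge>0. \<forall>x\<in>M.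
        \<phi> (t + h\<^sub>1) (t + h\<^sub>1 + h\<^sub>2) (\<phi> t (t + h\<^sub>1) x) = \<phi> t (t + h\<^sub>1 + h\<^sub>2) x"
    by (rule flow[unfolded differential_flow_def, THEN conjunct2, THEN conjunct2, THEN conjunct1])
  from this[rule_format, of s "r - s" "t - r" x] assms show ?thesis by simp
qed

lemma flow_continuous:
  assumes "0 \<le> s" "x \<in> M"
  shows "continuous_on {s..} (\<lambda>r. \<phi> s r x)"
proof -
  have "\<exists>v. continuous_on {0..} v \<and>
      (\<forall>h\<ge>0. ((\<lambda>h. \<phi> s (s + h) x) has_vector_derivative v h) (at h within {0..}))"
    using flow[unfolded differential_flow_def, THEN conjunct2, THEN conjunct2, THEN conjunct2, THEN conjunct1]
      assms by simp
  then obtain v where "\<forall>h\<ge>0. ((\<lambda>h. \<phi> s (s + h) x) has_vector_derivative v h) (at h within {0..})"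
    by (elim exE conjE) (rule that)
  then have v: "((\<lambda>h. \<phi> s (s + h) x) has_vector_derivative v h) (at h within {0..})" if "0 \<le> h" for h
    using that by simp
  have "continuous_on {0..} (\<lambda>h. \<phi> s (s + h) x)"
    unfolding continuous_on_eq_continuous_within
    using v has_vector_derivative_continuous by (metis atLeast_iff)
  then have "continuous_on {s..} ((\<lambda>h. \<phi> s (s + h) x) \<circ> (\<lambda>r. r - s))"
    by (intro continuous_on_compose continuous_intros) (auto elim: continuous_on_subset)
  then show ?thesis by (simp add: comp_def)
qed

abbreviation traj_rate :: "real \<Rightarrow> 'a \<Rightarrow> nat \<Rightarrow> real \<Rightarrow> real" where
  "traj_rate s x \<equiv> \<lambda>j r. lam j r (\<phi> s r x)"

text \<open>A flow line over a bounded time interval is compact by continuity, so rates bounded on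
  compact sets are bounded along it.\<close>

lemma jump_rate_traj:
  assumes s: "0 \<le> s" "x \<in> M" and j: "j \<in> {1..l}"
  shows "jump_rate s (traj_rate s x j)"
  unfolding jump_rate_def
proof (intro conjI allI impI)
  have "(\<lambda>r. \<phi> s r x) \<in> restrict_space borel {s..} \<rightarrow>\<^sub>M borel_on M"
    by (rule flow_measurable) (use s in \<open>auto intro!: measurable_restrict_space1 measurable_const_borel_on\<close>)
  then show "traj_rate s x j \<in> borel_measurable (restrict_space borel {s..})"
    by (intro lam_compose_measurable[OF j]) (use s in \<open>auto intro!: measurable_restrict_space1\<close>)
  show "0 \<le> traj_rate s x j r" if "s \<le> r" for r
    using lam_nonneg[OF j] flow_in_M[OF s(1) that s(2)] s that by simp
  fix b
  have "continuous_on {s..b} (\<lambda>r. (r, \<phi> s r x))"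
    by (intro continuous_intros continuous_on_subset[OF flow_continuous[OF s]]) auto
  then have "compact ((\<lambda>r. (r, \<phi> s r x)) ` {s..b})" by (intro compact_continuous_image) auto
  moreover have "(\<lambda>r. (r, \<phi> s r x)) ` {s..b} \<subseteq> {0..} \<times> M" using s flow_in_M by auto
  ultimately have "bounded ((\<lambda>(t, x). lam j t x) ` (\<lambda>r. (r, \<phi> s r x)) ` {s..b})"
    by (rule lam_bounded[OF j])
  then show "\<exists>B. \<forall>r\<in>{s..b}. \<bar>traj_rate s x j r\<bar> \<le> B" by (auto simp: bounded_iff image_image)
qed

lemma cumulative_rate_measurable:
  assumes j: "j \<in> {1..l}"
  shows "(\<lambda>(s, x). LBINT r:{s..t}. traj_rate s x j r) \<in> borel_measurable (state_space M)"
proof -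
  have sp: "0 \<le> fst (fst w) \<and> snd (fst w) \<in> M" if "w \<in> space (state_space M \<Otimes>\<^sub>M lborel)" for w
    using that by (auto simp: space_pair_measure)
  have m1: "(\<lambda>w. fst (fst w)) \<in> borel_measurable (state_space M \<Otimes>\<^sub>M lborel)"
    by (rule measurable_compose[OF measurable_fst], rule measurable_compose[OF measurable_fst],
        rule measurable_restrict_space1) simp
  have m2: "(\<lambda>w. snd (fst w)) \<in> state_space M \<Otimes>\<^sub>M lborel \<rightarrow>\<^sub>M borel_on M"
    by (rule measurable_compose[OF measurable_fst]) (rule measurable_snd)
  \<comment> \<open>Replacing \<open>r\<close> by its maximum with the starting time keeps the flow
    in the range where it is controlled; the indicator of the interval undoes the change.\<close>
  have m3: "(\<lambda>w. max (fst (fst w)) (snd w)) \<in> borel_measurable (state_space M \<Otimes>\<^sub>M lborel)"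
    using m1 by measurable
  have m4: "(\<lambda>w. \<phi> (fst (fst w)) (max (fst (fst w)) (snd w)) (snd (fst w))) \<in> state_space M \<Otimes>\<^sub>M lborel \<rightarrow>\<^sub>M borel_on M"
    by (rule flow_measurable[OF m1 m3 m2]) (use sp in auto)
  have m5: "(\<lambda>w. lam j (max (fst (fst w)) (snd w)) (\<phi> (fst (fst w)) (max (fst (fst w)) (snd w)) (snd (fst w))))
      \<in> borel_measurable (state_space M \<Otimes>\<^sub>M lborel)"
    by (rule lam_compose_measurable[OF j m3 m4]) (use sp in \<open>auto simp: le_max_iff_disj\<close>)
  have "(\<lambda>w. if fst (fst w) \<le> snd w \<and> snd w \<le> t then
      lam j (max (fst (fst w)) (snd w)) (\<phi> (fst (fst w)) (max (fst (fst w)) (snd w)) (snd (fst w))) else 0)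
      \<in> borel_measurable (state_space M \<Otimes>\<^sub>M lborel)"
    using m5 m1 by measurable
  then have "(\<lambda>(z, r). indicator {fst z..t} r *\<^sub>R traj_rate (fst z) (snd z) j r) \<in> borel_measurable (state_space M \<Otimes>\<^sub>M lborel)"
    by (rule measurable_cong[THEN iffD1, rotated]) (auto simp: indicator_def max_def split: if_splits)
  from lborel.borel_measurable_lebesgue_integral[OF this] show ?thesis
    unfolding set_lebesgue_integral_def by (simp add: case_prod_beta')
qed

lemma ringing_time_traj_measurable:
  assumes j: "j \<in> {1..l}" and s: "s \<in> borel_measurable N" "\<And>w. w \<in> space N \<Longrightarrow> 0 \<le> s w"
    and X: "X \<in> N \<rightarrow>\<^sub>M borel_on M" and e: "e \<in> borel_measurable N"
  shows "(\<lambda>w. ringing_time (s w) (traj_rate (s w) (X w) j) (e w)) \<in> borel_measurable N"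
proof (rule borel_measurable_ereal_if_less)
  fix t :: real
  have "(\<lambda>w. (s w, X w)) \<in> N \<rightarrow>\<^sub>M state_space M"
    by (intro measurable_Pair measurable_half_line s X)
  from measurable_compose[OF this cumulative_rate_measurable[OF j, of t]]
  have [measurable]: "(\<lambda>w. LBINT r:{s w..t}. traj_rate (s w) (X w) j r) \<in> borel_measurable N" by simp
  note s(1)[measurable] e[measurable]
  have XM: "X w \<in> M" if "w \<in> space N" for w using measurable_space[OF X that] by simp
  have "{w \<in> space N. ringing_time (s w) (traj_rate (s w) (X w) j) (e w) < ereal t} =
    {w \<in> space N. s w < t \<and> e w < (LBINT r:{s w..t}. traj_rate (s w) (X w) j r)}"
    using ringing_time_less_iff[OF jump_rate_traj[OF s(2) XM j]] jump_rate_LBINT[OF jump_rate_traj[OF s(2) XM j]]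
    by auto
  also have "\<dots> \<in> sets N" by measurable
  finally show "{w \<in> space N. ringing_time (s w) (traj_rate (s w) (X w) j) (e w) < ereal t} \<in> sets N" .
qed

section \<open>Decomposition of an observation event at the first jump\<close>

lemma first_ring_ge: "ereal s \<le> first_ring l s a e"
  unfolding first_ring_def by (intro INF_greatest ringing_time_ge)

text \<open>The interval is half-open: an observation made exactly at the jump time \<open>S\<close>
  sees the post-jump position and is left to the next stretch.\<close>

definition observed :: "real set \<Rightarrow> (real \<Rightarrow> 'a set) \<Rightarrow> real \<Rightarrow> 'a \<Rightarrow> ereal \<Rightarrow> bool" where
  "observed I A s x S \<longleftrightarrow> (\<forall>t\<in>I. s \<le> t \<and> ereal t < S \<longrightarrow> \<phi> s t x \<in> A t)"

text \<open>\<open>P\<close> stands for the requirement on the process restarted after the jump. A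
  jump exactly at \<open>T\<close> still counts, since an observation at \<open>T\<close> would see
  its result; after \<open>T\<close> nothing remains to be observed.\<close>

definition first_step :: "real set \<Rightarrow> (real \<Rightarrow> 'a set) \<Rightarrow> real \<Rightarrow>
    (real \<Rightarrow> 'a \<Rightarrow> (nat \<Rightarrow> (nat \<Rightarrow> real) \<times> real) \<Rightarrow> bool) \<Rightarrow>
    real \<Rightarrow> 'a \<Rightarrow> (nat \<Rightarrow> (nat \<Rightarrow> real) \<times> real) \<Rightarrow> bool" where
  "first_step I A T P s x \<eta> \<longleftrightarrow>
     (let e = fst (\<eta> 1); u = snd (\<eta> 1); S = first_ring l s (traj_rate s x) e; t = real_of_ereal S in
      observed I A s x S \<and>
      (S \<le> ereal T \<longrightarrow> P t (G (first_ringer l s (traj_rate s x) e) t (\<phi> s t x) u) (noise_shift \<eta>)))"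

lemma first_step_measurable:
  assumes I: "finite I" "I \<subseteq> {0..}" and A: "\<And>t. t \<in> I \<Longrightarrow> A t \<in> sets borel"
    and P: "Measurable.pred (state_space M \<Otimes>\<^sub>M noise l) (\<lambda>((s, x), \<eta>). P s x \<eta>)"
  shows "Measurable.pred (state_space M \<Otimes>\<^sub>M noise l) (\<lambda>((s, x), \<eta>). first_step I A T P s x \<eta>)"
proof -
  let ?N = "state_space M \<Otimes>\<^sub>M noise l"
  define s where "s w = fst (fst w)" for w :: "(real \<times> 'a) \<times> (nat \<Rightarrow> (nat \<Rightarrow> real) \<times> real)"
  define X where "X w = snd (fst w)" for w :: "(real \<times> 'a) \<times> (nat \<Rightarrow> (nat \<Rightarrow> real) \<times> real)"
  define e where "e w = fst (snd w 1)" for w :: "(real \<times> 'a) \<times> (nat \<Rightarrow> (nat \<Rightarrow> real) \<times> real)"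
  define u where "u w = snd (snd w 1)" for w :: "(real \<times> 'a) \<times> (nat \<Rightarrow> (nat \<Rightarrow> real) \<times> real)"
  have s [measurable]: "s \<in> borel_measurable ?N"
    unfolding s_def by (rule measurable_compose[OF measurable_fst], rule measurable_compose[OF measurable_fst],
        rule measurable_restrict_space1) simp
  have s0: "0 \<le> s w" if "w \<in> space ?N" for w using that unfolding s_def by (auto simp: space_pair_measure)
  have X [measurable]: "X \<in> ?N \<rightarrow>\<^sub>M borel_on M"
    unfolding X_def by (rule measurable_compose[OF measurable_fst]) (rule measurable_snd)
  have \<eta>1: "(\<lambda>w. snd w 1) \<in> ?N \<rightarrow>\<^sub>M round_noise l"
    unfolding noise_eq by (rule measurable_compose[OF measurable_snd], rule measurable_component_singleton) simp
  have e: "e \<in> ?N \<rightarrow>\<^sub>M exp1_product l"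
    unfolding e_def by (rule measurable_compose[OF \<eta>1 measurable_fst])
  have ei: "(\<lambda>w. e w i) \<in> borel_measurable ?N" if "i \<in> {1..l}" for i
    using measurable_compose[OF e measurable_component_singleton[OF that]] by simp
  have "u \<in> ?N \<rightarrow>\<^sub>M uniform01"
    unfolding u_def by (rule measurable_compose[OF \<eta>1 measurable_snd])
  then have u: "u \<in> ?N \<rightarrow>\<^sub>M borel_on {0..1}"
    by (rule measurable_cong_sets[THEN equalityD1, THEN subsetD, rotated -1]) (simp_all add: sets_restrict_space)
  have ring: "(\<lambda>w. ringing_time (s w) (traj_rate (s w) (X w) i) (e w i)) \<in> borel_measurable ?N" if "i \<in> {1..l}" for i
    by (rule ringing_time_traj_measurable[OF that s s0 X ei[OF that]])
  define S where "S w = first_ring l (s w) (traj_rate (s w) (X w)) (e w)" for w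
  define R where "R w = first_ringer l (s w) (traj_rate (s w) (X w)) (e w)" for w
  have S [measurable]: "S \<in> borel_measurable ?N"
    unfolding S_def by (rule first_ring_measurable_gen) (rule ring)
  have R: "Measurable.pred ?N (\<lambda>w. S w \<le> ereal T \<and> R w = j)" for j
    unfolding pred_def S_def R_def by (rule first_ringer_sets_gen) (rule ring)
  \<comment> \<open>A real-valued substitute for the jump time, never before the starting time, so
    that the flow can be evaluated at it for every sample; it equals \<open>S\<close> whenever
    \<open>S \<le> T\<close>.\<close>
  define \<tau> where "\<tau> w = real_of_ereal (min (S w) (ereal (max (s w) T)))" for w
  have \<tau> [measurable]: "\<tau> \<in> borel_measurable ?N" unfolding \<tau>_def by measurable
  have \<tau>s: "s w \<le> \<tau> w" for w
  proof -
    have "ereal (s w) \<le> S w" unfolding S_def by (rule first_ring_ge)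
    then show ?thesis
      unfolding \<tau>_def by (cases "S w") (auto simp: min_def max_def split: if_splits)
  qed
  have \<tau>S: "real_of_ereal (S w) = \<tau> w" if "S w \<le> ereal T" for w
  proof -
    have "S w \<le> ereal (max (s w) T)" using that by (rule order_trans) simp
    then show ?thesis unfolding \<tau>_def by (simp add: min_absorb1)
  qed
  have Y: "(\<lambda>w. \<phi> (s w) (\<tau> w) (X w)) \<in> ?N \<rightarrow>\<^sub>M borel_on M"
    by (rule flow_measurable[OF s \<tau> X]) (use s0 \<tau>s in auto)
  have "Measurable.pred ?N (\<lambda>w. \<phi> (s w) (max (s w) t) (X w) \<in> A t)" if "t \<in> I" for t
  proof -
    have "(\<lambda>w. \<phi> (s w) (max (s w) t) (X w)) \<in> ?N \<rightarrow>\<^sub>M borel_on M"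
      by (rule flow_measurable[OF s _ X]) (use s s0 in auto)
    then have "(\<lambda>w. \<phi> (s w) (max (s w) t) (X w)) \<in> borel_measurable ?N"
      by (rule measurable_restrict_space2_iff[THEN iffD1, THEN conjunct1])
    then show ?thesis using A[OF that] by measurable
  qed
  then have D: "Measurable.pred ?N (\<lambda>w. \<forall>t\<in>I. s w \<le> t \<and> ereal t < S w \<longrightarrow> \<phi> (s w) (max (s w) t) (X w) \<in> A t)"
    by (intro pred_intros_finite I pred_intros_logic) (auto intro: s S)
  have J: "Measurable.pred ?N (\<lambda>w. S w \<le> ereal T \<and> R w = j \<longrightarrow>
      P (\<tau> w) (G j (\<tau> w) (\<phi> (s w) (\<tau> w) (X w)) (u w)) (noise_shift (snd w)))" if j: "j \<in> {1..l}" for j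
  proof -
    have "(\<lambda>w. G j (\<tau> w) (\<phi> (s w) (\<tau> w) (X w)) (u w)) \<in> ?N \<rightarrow>\<^sub>M borel_on M"
      by (rule G_compose_measurable[OF j \<tau> Y _ u]) (use s0 \<tau>s in \<open>force intro: order_trans\<close>)
    moreover have "\<tau> \<in> ?N \<rightarrow>\<^sub>M half_line"
      using \<tau> by (rule measurable_restrict_space2[rotated]) (use s0 \<tau>s in \<open>force intro: order_trans\<close>)
    ultimately have "(\<lambda>w. ((\<tau> w, G j (\<tau> w) (\<phi> (s w) (\<tau> w) (X w)) (u w)), noise_shift (snd w))) \<in> ?N \<rightarrow>\<^sub>M ?N"
      by (intro measurable_Pair measurable_compose[OF measurable_snd noise_shift_measurable])
    from measurable_compose[OF this P] have
      "Measurable.pred ?N (\<lambda>w. P (\<tau> w) (G j (\<tau> w) (\<phi> (s w) (\<tau> w) (X w)) (u w)) (noise_shift (snd w)))"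
      by simp
    then show ?thesis by (intro pred_intros_logic(4) R)
  qed
  \<comment> \<open>The random index of the ringing clock is replaced by a finite conjunction over
    its possible values, each with a fixed jump map.\<close>
  have "Measurable.pred ?N (\<lambda>w. (\<forall>t\<in>I. s w \<le> t \<and> ereal t < S w \<longrightarrow> \<phi> (s w) (max (s w) t) (X w) \<in> A t) \<and>
     (\<forall>j\<in>{1..l}. S w \<le> ereal T \<and> R w = j \<longrightarrow>
        P (\<tau> w) (G j (\<tau> w) (\<phi> (s w) (\<tau> w) (X w)) (u w)) (noise_shift (snd w))))"
    by (intro pred_intros_logic pred_intros_finite D J) auto
  moreover have "first_step I A T P (s w) (X w) (snd w) \<longleftrightarrow>
     (\<forall>t\<in>I. s w \<le> t \<and> ereal t < S w \<longrightarrow> \<phi> (s w) (max (s w) t) (X w) \<in> A t) \<and>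
     (\<forall>j\<in>{1..l}. S w \<le> ereal T \<and> R w = j \<longrightarrow>
        P (\<tau> w) (G j (\<tau> w) (\<phi> (s w) (\<tau> w) (X w)) (u w)) (noise_shift (snd w)))" for w
  proof -
    have "R w \<in> {1..l}" if "S w \<le> ereal T"
    proof -
      have "S w \<noteq> \<infinity>" using that by auto
      then show ?thesis unfolding S_def R_def by (rule first_ringer(1))
    qed
    moreover have "observed I A (s w) (X w) (S w) \<longleftrightarrow>
        (\<forall>t\<in>I. s w \<le> t \<and> ereal t < S w \<longrightarrow> \<phi> (s w) (max (s w) t) (X w) \<in> A t)"
      unfolding observed_def by (auto simp: max_absorb2)
    ultimately show ?thesis
      unfolding first_step_def Let_def S_def[symmetric] R_def[symmetric] e_def[symmetric] u_def[symmetric]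
      using \<tau>S by auto
  qed
  ultimately have "Measurable.pred ?N (\<lambda>w. first_step I A T P (s w) (X w) (snd w))" by simp
  then show ?thesis unfolding s_def X_def by (simp add: case_prod_beta')
qed

end

section \<open>The renewal equation\<close>

lemma sets_uniform01: "sets uniform01 = sets (borel_on {0..1})"
  by (simp add: sets_restrict_space)

lemma space_uniform01 [simp]: "space uniform01 = {0..1}"
  by (simp add: space_restrict_space)

lemma measurable_uniform01: "U \<in> N \<rightarrow>\<^sub>M uniform01 \<Longrightarrow> U \<in> N \<rightarrow>\<^sub>M borel_on {0..1}"
  using measurable_cong_sets[OF refl sets_uniform01, of N] by blast

text \<open>Values in \<open>ennreal\<close> suit the least fixed point argument; the passage to
  reals takes place only along a flow line, where differences are needed.\<close>

definition noise_prob :: "nat \<Rightarrow> (real \<Rightarrow> 'a \<Rightarrow> (nat \<Rightarrow> (nat \<Rightarrow> real) \<times> real) \<Rightarrow> bool) \<Rightarrow> real \<Rightarrow> 'a \<Rightarrow> ennreal" where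
  "noise_prob l P s x = (\<integral>\<^sup>+ \<eta>. (if P s x \<eta> then 1 else 0) \<partial>noise l)"

lemma noise_prob_le_1: "noise_prob l P s x \<le> 1"
proof -
  interpret prob_space "noise l" by (rule prob_space_noise)
  have "noise_prob l P s x \<le> (\<integral>\<^sup>+ \<eta>. 1 \<partial>noise l)"
    unfolding noise_prob_def by (intro nn_integral_mono) auto
  then show ?thesis by (simp add: emeasure_space_1)
qed

lemma noise_prob_measurable:
  assumes "Measurable.pred (state_space M \<Otimes>\<^sub>M noise l) (\<lambda>((s, x), \<eta>). P s x \<eta>)"
  shows "(\<lambda>(s, x). noise_prob l P s x) \<in> borel_measurable (state_space M)"
proof -
  interpret prob_space "noise l" by (rule prob_space_noise)
  have "Measurable.pred (state_space M \<Otimes>\<^sub>M noise l) (\<lambda>w. P (fst (fst w)) (snd (fst w)) (snd w))"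
    using assms by (simp add: case_prod_beta')
  then have "(\<lambda>w. if P (fst (fst w)) (snd (fst w)) (snd w) then 1 else 0 :: ennreal) \<in> borel_measurable (state_space M \<Otimes>\<^sub>M noise l)"
    by measurable
  then have "(\<lambda>(z, \<eta>). if P (fst z) (snd z) \<eta> then 1 else 0 :: ennreal) \<in> borel_measurable (state_space M \<Otimes>\<^sub>M noise l)"
    by (simp add: case_prod_beta')
  from borel_measurable_nn_integral[OF this] show ?thesis
    unfolding noise_prob_def by (simp add: case_prod_beta')
qed

context pdmp_system begin

text \<open>The first-jump operator. Its first term accounts for no jump up to \<open>T\<close>,
  when the flow line must meet all observations; the sum accounts for a first jump at time
  \<open>r\<close> caused by clock \<open>j\<close>, with the survival factor of all clocks.\<close>

definition renewal :: "real set \<Rightarrow> (real \<Rightarrow> 'a set) \<Rightarrow> real \<Rightarrow> (real \<Rightarrow> 'a \<Rightarrow> ennreal) \<Rightarrow> real \<Rightarrow> 'a \<Rightarrow> ennreal" where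
  "renewal I A T u s x =
     (if observed I A s x \<infinity> then 1 else 0) * ennreal (exp (- (\<Sum>j=1..l. integral {s..T} (traj_rate s x j)))) +
     (\<Sum>j=1..l. \<integral>\<^sup>+ r. ((if observed I A s x (ereal r) then 1 else 0) * (\<integral>\<^sup>+ v. u r (G j r (\<phi> s r x) v) \<partial>uniform01)) *
        ennreal (traj_rate s x j r * exp (- (\<Sum>i=1..l. integral {s..r} (traj_rate s x i)))) * indicator {s..T} r \<partial>lborel)"

lemma kernel_integral_measurable:
  assumes s: "0 \<le> s" "x \<in> M" and j: "j \<in> {1..l}"
    and u: "(\<lambda>(s, x). u s x) \<in> borel_measurable (state_space M)"
  shows "(\<lambda>r. \<integral>\<^sup>+ v. u (max s r) (G j (max s r) (\<phi> s (max s r) x) v) \<partial>uniform01) \<in> borel_measurable borel"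
proof -
  interpret prob_space uniform01 by (rule prob_space_uniform01)
  have r: "(\<lambda>w. max s (fst w)) \<in> borel_measurable (borel \<Otimes>\<^sub>M uniform01)" by measurable
  have y: "(\<lambda>w. \<phi> s (max s (fst w)) x) \<in> borel \<Otimes>\<^sub>M uniform01 \<rightarrow>\<^sub>M borel_on M"
    by (rule flow_measurable[OF _ r measurable_const_borel_on[OF s(2)]]) (use s in auto)
  have "(\<lambda>w. G j (max s (fst w)) (\<phi> s (max s (fst w)) x) (snd w)) \<in> borel \<Otimes>\<^sub>M uniform01 \<rightarrow>\<^sub>M borel_on M"
    by (rule G_compose_measurable[OF j r y]) (use s in \<open>auto intro: measurable_uniform01\<close>)
  then have "(\<lambda>w. (max s (fst w), G j (max s (fst w)) (\<phi> s (max s (fst w)) x) (snd w))) \<in> borel \<Otimes>\<^sub>M uniform01 \<rightarrow>\<^sub>M state_space M"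
    by (intro measurable_Pair measurable_half_line r) (use s in auto)
  from measurable_compose[OF this u]
  have "(\<lambda>(r, v). u (max s r) (G j (max s r) (\<phi> s (max s r) x) v)) \<in> borel_measurable (borel \<Otimes>\<^sub>M uniform01)"
    by (simp add: case_prod_beta')
  then show ?thesis by (rule borel_measurable_nn_integral)
qed

lemma observed_measurable:
  assumes "finite I"
  shows "Measurable.pred borel (\<lambda>r. observed I A s x (ereal (max s r)))"
  unfolding observed_def by (intro pred_intros_finite assms pred_intros_logic) measurable

text \<open>Given the first round, the remaining noise has its original law, so the inner integral
  is \<open>noise_prob\<close> at the post-jump state. Integrating the uniform variable gives the
  kernel, integrating the thresholds the law of the first ring.\<close>

lemma noise_prob_first_step:
  assumes I: "finite I" "I \<subseteq> {0..T}" and A: "\<And>t. t \<in> I \<Longrightarrow> A t \<in> sets borel"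
    and P: "Measurable.pred (state_space M \<Otimes>\<^sub>M noise l) (\<lambda>((s, x), \<eta>). P s x \<eta>)"
    and s: "0 \<le> s" "s \<le> T" and x: "x \<in> M"
  shows "noise_prob l (first_step I A T P) s x = renewal I A T (noise_prob l P) s x"
proof -
  interpret N: prob_space "noise l" by (rule prob_space_noise)
  interpret U: prob_space uniform01 by (rule prob_space_uniform01)
  let ?a = "traj_rate s x"
  let ?S = "first_ring l s ?a" and ?R = "first_ringer l s ?a"
  let ?u = "noise_prob l P"
  have u: "(\<lambda>(s, x). ?u s x) \<in> borel_measurable (state_space M)" by (rule noise_prob_measurable[OF P])
  have sx: "(s, x) \<in> space (state_space M)" using s x by (simp add: space_pair_measure)
  let ?f = "\<lambda>\<eta>. if first_step I A T P s x \<eta> then 1 else 0 :: ennreal"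
  have "Measurable.pred (state_space M \<Otimes>\<^sub>M noise l) (\<lambda>((s, x), \<eta>). first_step I A T P s x \<eta>)"
    by (rule first_step_measurable[OF I(1) _ A P]) (use I(2) in auto)
  from measurable_Pair2[OF this sx] have "Measurable.pred (noise l) (first_step I A T P s x)" by simp
  then have f: "?f \<in> borel_measurable (noise l)" by measurable
  define h where "h j r = (if observed I A s x (ereal (max s r)) then 1 else 0) *
      (\<integral>\<^sup>+ v. ?u (max s r) (G j (max s r) (\<phi> s (max s r) x) v) \<partial>uniform01)" for j r
  have h: "h j \<in> borel_measurable borel" if "j \<in> {1..l}" for j
  proof -
    note kernel_integral_measurable[OF s(1) x that u, measurable]
    note observed_measurable[OF I(1), of A s x, measurable]
    show ?thesis unfolding h_def by measurable
  qed
  let ?c = "if observed I A s x \<infinity> then 1 else 0 :: ennreal"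
  have rate: "jump_rate s (?a j)" if "j \<in> {1..l}" for j by (rule jump_rate_traj[OF s(1) x that])
  have F: "(\<lambda>\<nu>. \<integral>\<^sup>+ \<eta>. ?f (noise_cons \<nu> \<eta>) \<partial>noise l) \<in> borel_measurable (round_noise l)"
    using N.borel_measurable_nn_integral[of "\<lambda>\<nu> \<eta>. ?f (noise_cons \<nu> \<eta>)" "round_noise l"]
      measurable_compose[OF noise_cons_measurable f] by (simp add: case_prod_beta')
  have inner: "(\<integral>\<^sup>+ \<eta>. ?f (noise_cons (e, v) \<eta>) \<partial>noise l) =
      (if ?S e \<le> ereal T then (if observed I A s x (?S e) then 1 else 0) *
         ?u (real_of_ereal (?S e)) (G (?R e) (real_of_ereal (?S e)) (\<phi> s (real_of_ereal (?S e)) x) v) else ?c)" for e v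
  proof -
    have "(\<integral>\<^sup>+ \<eta>. ?f (noise_cons (e, v) \<eta>) \<partial>noise l) =
       (\<integral>\<^sup>+ \<eta>. (if observed I A s x (?S e) then 1 else 0) * (if ?S e \<le> ereal T \<longrightarrow>
         P (real_of_ereal (?S e)) (G (?R e) (real_of_ereal (?S e)) (\<phi> s (real_of_ereal (?S e)) x) v) \<eta> then 1 else 0) \<partial>noise l)"
      by (intro nn_integral_cong) (auto simp: first_step_def Let_def noise_shift_cons)
    also have "\<dots> = (if ?S e \<le> ereal T then (if observed I A s x (?S e) then 1 else 0) *
         ?u (real_of_ereal (?S e)) (G (?R e) (real_of_ereal (?S e)) (\<phi> s (real_of_ereal (?S e)) x) v) else
         (if observed I A s x (?S e) then 1 else 0))"
      unfolding noise_prob_def by (auto simp: N.emeasure_space_1)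
    finally have *: "(\<integral>\<^sup>+ \<eta>. ?f (noise_cons (e, v) \<eta>) \<partial>noise l) = \<dots>" .
    \<comment> \<open>All observation times are at most \<open>T\<close>, so if there is no jump up
      to \<open>T\<close> the exact value of the jump time does not matter and the contribution is
      the constant \<open>?c\<close>.\<close>
    have "observed I A s x (?S e) = observed I A s x \<infinity>" if "\<not> ?S e \<le> ereal T"
    proof -
      have "ereal t < ?S e" if "t \<in> I" for t
      proof -
        have "ereal t \<le> ereal T" using I(2) that by auto
        then show ?thesis using \<open>\<not> ?S e \<le> ereal T\<close> by (meson le_less_trans not_le)
      qed
      then show ?thesis unfolding observed_def by auto
    qed
    then show ?thesis unfolding * by (simp cong: if_cong)
  qed
  have mid: "(\<integral>\<^sup>+ v. (\<integral>\<^sup>+ \<eta>. ?f (noise_cons (e, v) \<eta>) \<partial>noise l) \<partial>uniform01) =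
      (if ?S e \<le> ereal T then h (?R e) (real_of_ereal (?S e)) else ?c)" for e
  proof (cases "?S e \<le> ereal T")
    case True
    then obtain t where t: "?S e = ereal t" "s \<le> t" "t \<le> T"
      using first_ring_ge[of s ?a e] by (cases "?S e") auto
    have R: "?R e \<in> {1..l}" by (rule first_ringer(1)) (use t in simp)
    have "(\<lambda>v. G (?R e) t (\<phi> s t x) v) \<in> uniform01 \<rightarrow>\<^sub>M borel_on M"
      by (rule G_compose_measurable[OF R])
        (use t s x flow_in_M[OF s(1) t(2) x] in \<open>auto intro: measurable_const_borel_on measurable_uniform01\<close>)
    then have "(\<lambda>v. (t, G (?R e) t (\<phi> s t x) v)) \<in> uniform01 \<rightarrow>\<^sub>M state_space M"
      by (intro measurable_Pair measurable_half_line) (use s t in auto)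
    from measurable_compose[OF this u] have "(\<lambda>v. ?u t (G (?R e) t (\<phi> s t x) v)) \<in> borel_measurable uniform01" by simp
    then show ?thesis
      unfolding inner using t by (simp add: nn_integral_cmult h_def max_absorb2)
  next
    case False
    then show ?thesis unfolding inner using U.emeasure_space_1 by simp
  qed
  have "noise_prob l (first_step I A T P) s x = (\<integral>\<^sup>+ \<nu>. (\<integral>\<^sup>+ \<eta>. ?f (noise_cons \<nu> \<eta>) \<partial>noise l) \<partial>round_noise l)"
    unfolding noise_prob_def by (rule nn_integral_noise[OF f])
  also have "\<dots> = (\<integral>\<^sup>+ e. (\<integral>\<^sup>+ v. (\<integral>\<^sup>+ \<eta>. ?f (noise_cons (e, v) \<eta>) \<partial>noise l) \<partial>uniform01) \<partial>exp1_product l)"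
    by (rule U.nn_integral_fst[OF F, symmetric])
  also have "\<dots> = (\<integral>\<^sup>+ e. (if ?S e \<le> ereal T then h (?R e) (real_of_ereal (?S e)) else ?c) \<partial>exp1_product l)"
    by (simp only: mid)
  also have "\<dots> = ?c * ennreal (exp (- (\<Sum>j=1..l. integral {s..T} (?a j)))) +
     (\<Sum>j=1..l. \<integral>\<^sup>+ r. h j r * ennreal (?a j r * exp (- (\<Sum>i=1..l. integral {s..r} (?a i)))) * indicator {s..T} r \<partial>lborel)"
    by (rule nn_integral_first_ring[OF _ s(2) h]) (rule rate)
  also have "\<dots> = renewal I A T ?u s x"
    unfolding renewal_def
    by (intro arg_cong2[where f = "(+)"] refl sum.cong nn_integral_cong)
      (auto simp: h_def indicator_def max_absorb2)
  finally show ?thesis .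
qed

text \<open>The index bounds the number of jumps: there are fewer than \<open>n\<close> of them up to time \<open>T\<close>.\<close>

primrec observed_within :: "real set \<Rightarrow> (real \<Rightarrow> 'a set) \<Rightarrow> real \<Rightarrow> nat \<Rightarrow>
    real \<Rightarrow> 'a \<Rightarrow> (nat \<Rightarrow> (nat \<Rightarrow> real) \<times> real) \<Rightarrow> bool" where
  "observed_within I A T 0 = (\<lambda>s x \<eta>. False)"
| "observed_within I A T (Suc n) = first_step I A T (observed_within I A T n)"

definition observed_path :: "real set \<Rightarrow> (real \<Rightarrow> 'a set) \<Rightarrow> real \<Rightarrow>
    real \<Rightarrow> 'a \<Rightarrow> (nat \<Rightarrow> (nat \<Rightarrow> real) \<times> real) \<Rightarrow> bool" where
  "observed_path I A T s x \<eta> \<longleftrightarrow> (\<exists>n. observed_within I A T n s x \<eta>)"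

lemma first_step_mono:
  assumes "first_step I A T P s x \<eta>" "\<And>s x \<eta>. P s x \<eta> \<Longrightarrow> P' s x \<eta>"
  shows "first_step I A T P' s x \<eta>"
  using assms unfolding first_step_def Let_def by blast

lemma observed_within_Suc: "observed_within I A T n s x \<eta> \<Longrightarrow> observed_within I A T (Suc n) s x \<eta>"
proof (induction n arbitrary: s x \<eta>)
  case (Suc n)
  show ?case
    unfolding observed_within.simps(2)[of I A T "Suc n"]
    by (rule first_step_mono[OF Suc.prems[unfolded observed_within.simps(2)] Suc.IH])
qed simp

text \<open>The fixed point property holds sample by sample. The existential quantifier over
  \<open>n\<close> passes through \<open>first_step\<close>, where the future requirement occurs
  once, as the conclusion of an implication.\<close>

lemma observed_path_first_step: "observed_path I A T = first_step I A T (observed_path I A T)"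
proof (intro ext)
  fix s x \<eta>
  have "observed_path I A T s x \<eta> \<longleftrightarrow> (\<exists>n. observed_within I A T (Suc n) s x \<eta>)"
    unfolding observed_path_def using observed_within_Suc by blast
  also have "\<dots> \<longleftrightarrow> first_step I A T (observed_path I A T) s x \<eta>"
    unfolding observed_within.simps(2) first_step_def Let_def observed_path_def by blast
  finally show "observed_path I A T s x \<eta> = first_step I A T (observed_path I A T) s x \<eta>" .
qed

lemma observed_within_measurable:
  assumes I: "finite I" "I \<subseteq> {0..}" and A: "\<And>t. t \<in> I \<Longrightarrow> A t \<in> sets borel"
  shows "Measurable.pred (state_space M \<Otimes>\<^sub>M noise l) (\<lambda>((s, x), \<eta>). observed_within I A T n s x \<eta>)"
proof (induction n)
  case (Suc n)
  show ?case unfolding observed_within.simps(2)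
    by (rule first_step_measurable[OF I _ Suc.IH]) (rule A)
qed (simp add: case_prod_beta')

lemma observed_path_measurable:
  assumes I: "finite I" "I \<subseteq> {0..}" and A: "\<And>t. t \<in> I \<Longrightarrow> A t \<in> sets borel"
  shows "Measurable.pred (state_space M \<Otimes>\<^sub>M noise l) (\<lambda>((s, x), \<eta>). observed_path I A T s x \<eta>)"
proof -
  have "Measurable.pred (state_space M \<Otimes>\<^sub>M noise l)
      (\<lambda>w. \<exists>n. observed_within I A T n (fst (fst w)) (snd (fst w)) (snd w))"
    using observed_within_measurable[OF I A] by (intro pred_intros_countable) (simp add: case_prod_beta')
  then show ?thesis unfolding observed_path_def by (simp add: case_prod_beta')
qed

text \<open>Comparison on \<open>{s..T}\<close> and \<open>M\<close> is enough, since flow and jumps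
  do not leave \<open>M\<close>; the induction for minimality knows its inequality only
  there.\<close>

lemma renewal_mono:
  assumes "\<And>r y. r \<in> {s..T} \<Longrightarrow> y \<in> M \<Longrightarrow> u r y \<le> v r y" and s: "0 \<le> s" "x \<in> M"
  shows "renewal I A T u s x \<le> renewal I A T v s x"
  unfolding renewal_def
proof (intro add_mono order_refl sum_mono nn_integral_mono)
  fix j r assume j: "j \<in> {1..l}"
  show "((if observed I A s x (ereal r) then 1 else 0) * (\<integral>\<^sup>+ v. u r (G j r (\<phi> s r x) v) \<partial>uniform01)) *
        ennreal (traj_rate s x j r * exp (- (\<Sum>i=1..l. integral {s..r} (traj_rate s x i)))) * indicator {s..T} r
     \<le> ((if observed I A s x (ereal r) then 1 else 0) * (\<integral>\<^sup>+ w. v r (G j r (\<phi> s r x) w) \<partial>uniform01)) *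
        ennreal (traj_rate s x j r * exp (- (\<Sum>i=1..l. integral {s..r} (traj_rate s x i)))) * indicator {s..T} r"
  proof (cases "r \<in> {s..T}")
    case True
    have "(\<integral>\<^sup>+ v. u r (G j r (\<phi> s r x) v) \<partial>uniform01) \<le> (\<integral>\<^sup>+ w. v r (G j r (\<phi> s r x) w) \<partial>uniform01)"
      using True s by (intro nn_integral_mono assms(1) G_in_M[OF j] flow_in_M) auto
    then show ?thesis by (intro mult_right_mono mult_left_mono) auto
  qed simp
qed

lemma observed_path_fixpoint:
  assumes I: "finite I" "I \<subseteq> {0..T}" and A: "\<And>t. t \<in> I \<Longrightarrow> A t \<in> sets borel"
    and s: "0 \<le> s" "s \<le> T" and x: "x \<in> M"
  shows "renewal I A T (noise_prob l (observed_path I A T)) s x = noise_prob l (observed_path I A T) s x"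
proof -
  have "I \<subseteq> {0..}" using I(2) by auto
  have "noise_prob l (first_step I A T (observed_path I A T)) s x = renewal I A T (noise_prob l (observed_path I A T)) s x"
    by (rule noise_prob_first_step[OF I _ observed_path_measurable[OF I(1) \<open>I \<subseteq> {0..}\<close>] s x]) (rule A; assumption)+
  then show ?thesis unfolding observed_path_first_step[symmetric] ..
qed

text \<open>The iterates of \<open>renewal\<close> from 0 stay below any fixed point by
  monotonicity. They are the probabilities of being observed with fewer than \<open>n\<close> jumps,
  which increase to the full probability.\<close>

lemma observed_path_minimal:
  assumes I: "finite I" "I \<subseteq> {0..T}" and A: "\<And>t. t \<in> I \<Longrightarrow> A t \<in> sets borel"
    and v: "\<And>s x. 0 \<le> s \<Longrightarrow> s \<le> T \<Longrightarrow> x \<in> M \<Longrightarrow> renewal I A T v s x = v s x"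
    and s: "0 \<le> s" "s \<le> T" and x: "x \<in> M"
  shows "noise_prob l (observed_path I A T) s x \<le> v s x"
proof -
  have I': "I \<subseteq> {0..}" using I(2) by auto
  have le: "noise_prob l (observed_within I A T n) s x \<le> v s x" if "0 \<le> s" "s \<le> T" "x \<in> M" for n s x
    using that
  proof (induction n arbitrary: s x)
    case 0
    then show ?case by (simp add: noise_prob_def)
  next
    case (Suc n)
    have "noise_prob l (observed_within I A T (Suc n)) s x = renewal I A T (noise_prob l (observed_within I A T n)) s x"
      unfolding observed_within.simps(2)
      by (rule noise_prob_first_step[OF I A observed_within_measurable[OF I(1) I' A] Suc.prems])
    also have "\<dots> \<le> renewal I A T v s x"
      using Suc by (intro renewal_mono) auto
    also have "\<dots> = v s x" by (rule v[OF Suc.prems])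
    finally show ?case .
  qed
  have meas: "(\<lambda>\<eta>. if observed_within I A T n s x \<eta> then 1 else 0 :: ennreal) \<in> borel_measurable (noise l)" for n
  proof -
    have "(s, x) \<in> space (state_space M)" using s x by (simp add: space_pair_measure)
    from measurable_Pair2[OF observed_within_measurable[OF I(1) I' A] this]
    have "Measurable.pred (noise l) (observed_within I A T n s x)" by simp
    then show ?thesis by measurable
  qed
  have "noise_prob l (observed_path I A T) s x =
      (\<integral>\<^sup>+ \<eta>. (SUP n. if observed_within I A T n s x \<eta> then 1 else 0) \<partial>noise l)"
    unfolding noise_prob_def
  proof (intro nn_integral_cong)
    fix \<eta>
    show "(if observed_path I A T s x \<eta> then 1 else 0 :: ennreal) = (SUP n. if observed_within I A T n s x \<eta> then 1 else 0)"
    proof (cases "observed_path I A T s x \<eta>")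
      case True
      then obtain n where "observed_within I A T n s x \<eta>" unfolding observed_path_def by blast
      then have "(SUP n. if observed_within I A T n s x \<eta> then 1 else 0) = (1 :: ennreal)"
        by (intro antisym SUP_least SUP_upper2[of n]) auto
      then show ?thesis using True by simp
    next
      case False
      then have "\<not> observed_within I A T n s x \<eta>" for n unfolding observed_path_def by blast
      then show ?thesis using False by simp
    qed
  qed
  also have "\<dots> = (SUP n. noise_prob l (observed_within I A T n) s x)"
    unfolding noise_prob_def
    using observed_within_Suc by (intro nn_integral_monotone_convergence_SUP meas incseq_SucI le_funI) auto
  also have "\<dots> \<le> v s x" by (rule SUP_least) (rule le[OF s x])
  finally show ?thesis .
qed

section \<open>The renewal equation with real integrands along a flow line\<close>

abbreviation total_rate :: "real \<Rightarrow> 'a \<Rightarrow> real \<Rightarrow> real" where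
  "total_rate s x r \<equiv> \<Sum>j=1..l. traj_rate s x j r"

text \<open>The gain term of the generator applied to \<open>u\<close>. Subtracting the total rate
  times \<open>u\<close> leaves the sum of rate times kernel minus identity, the only combination
  that the two families share.\<close>

definition jump_intensity :: "(real \<Rightarrow> 'a \<Rightarrow> ennreal) \<Rightarrow> real \<Rightarrow> 'a \<Rightarrow> real" where
  "jump_intensity u t x = (\<Sum>j=1..l. lam j t x * enn2real (\<integral>\<^sup>+ v. u t (G j t x v) \<partial>uniform01))"

lemma total_rate_jump_rate: "0 \<le> s \<Longrightarrow> x \<in> M \<Longrightarrow> jump_rate s (total_rate s x)"
proof -
  assume s: "0 \<le> s" "x \<in> M"
  note r = jump_rate_traj[OF s, unfolded jump_rate_def]
  have "\<exists>B. \<forall>r\<in>{s..b}. \<bar>total_rate s x r\<bar> \<le> B" for b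
  proof -
    have "\<forall>j\<in>{1..l}. \<exists>B. \<forall>r\<in>{s..b}. \<bar>traj_rate s x j r\<bar> \<le> B" using r by blast
    then obtain B where B: "\<And>j r. j \<in> {1..l} \<Longrightarrow> r \<in> {s..b} \<Longrightarrow> \<bar>traj_rate s x j r\<bar> \<le> B j" by metis
    have "\<bar>total_rate s x r\<bar> \<le> (\<Sum>j=1..l. B j)" if "r \<in> {s..b}" for r
      using B that by (intro order_trans[OF sum_abs] sum_mono)
    then show ?thesis by blast
  qed
  moreover have "total_rate s x \<in> borel_measurable (restrict_space borel {s..})"
    using r by (intro borel_measurable_sum) blast
  moreover have "0 \<le> total_rate s x r" if "s \<le> r" for r
    using r that by (intro sum_nonneg) blast
  ultimately show ?thesis unfolding jump_rate_def by blast
qed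

lemma integral_total_rate:
  assumes "0 \<le> s" "x \<in> M" "s \<le> c"
  shows "integral {c..d} (total_rate s x) = (\<Sum>j=1..l. integral {c..d} (traj_rate s x j))"
  by (rule integral_sum) (use jump_rate_integrable(2)[OF jump_rate_traj[OF assms(1,2)] assms(3)] in auto)

lemma kernel_integral_le_1:
  assumes "\<And>r y. u r y \<le> 1"
  shows "(\<integral>\<^sup>+ v. u r (G j r x v) \<partial>uniform01) \<le> (1::ennreal)"
proof -
  interpret prob_space uniform01 by (rule prob_space_uniform01)
  have "(\<integral>\<^sup>+ v. u r (G j r x v) \<partial>uniform01) \<le> (\<integral>\<^sup>+ v. 1 \<partial>uniform01)"
    by (intro nn_integral_mono assms)
  then show ?thesis using emeasure_space_1 by simp
qed

lemma jump_intensity_traj: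
  assumes s: "0 \<le> s" "x \<in> M" and u: "(\<lambda>(s, x). u s x) \<in> borel_measurable (state_space M)" "\<And>r y. u r y \<le> (1::ennreal)"
  shows "(\<lambda>r. jump_intensity u r (\<phi> s r x)) \<in> borel_measurable (restrict_space borel {s..T})"
    and "\<And>r. s \<le> r \<Longrightarrow> 0 \<le> jump_intensity u r (\<phi> s r x)"
    and "\<And>r. s \<le> r \<Longrightarrow> jump_intensity u r (\<phi> s r x) \<le> total_rate s x r"
proof -
  have lam: "0 \<le> lam j r (\<phi> s r x)" if "j \<in> {1..l}" "s \<le> r" for j r
    using lam_nonneg[OF that(1)] flow_in_M[OF s(1) that(2) s(2)] s that by simp
  have K: "enn2real (\<integral>\<^sup>+ v. u r (G j r y v) \<partial>uniform01) \<le> 1" for j r y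
    using kernel_integral_le_1[of u r j y, OF u(2)] by (intro enn2real_leI) auto
  have "(\<lambda>r. enn2real (\<integral>\<^sup>+ v. u r (G j r (\<phi> s r x) v) \<partial>uniform01)) \<in> borel_measurable (restrict_space borel {s..T})"
    if "j \<in> {1..l}" for j
  proof -
    have "(\<lambda>r. enn2real (\<integral>\<^sup>+ v. u (max s r) (G j (max s r) (\<phi> s (max s r) x) v) \<partial>uniform01))
        \<in> borel_measurable (restrict_space borel {s..T})"
      using kernel_integral_measurable[OF s that u(1)] by (intro measurable_restrict_space1) measurable
    then show ?thesis
      by (rule measurable_cong[THEN iffD1, rotated]) (auto simp: max_absorb2 space_restrict_space)
  qed
  then show "(\<lambda>r. jump_intensity u r (\<phi> s r x)) \<in> borel_measurable (restrict_space borel {s..T})"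
    unfolding jump_intensity_def
    using jump_rate_measurable[OF jump_rate_traj[OF s], of _ T]
    by (intro borel_measurable_sum borel_measurable_times) auto
  show "0 \<le> jump_intensity u r (\<phi> s r x)" if "s \<le> r" for r
    unfolding jump_intensity_def by (intro sum_nonneg mult_nonneg_nonneg lam that) auto
  show "jump_intensity u r (\<phi> s r x) \<le> total_rate s x r" if "s \<le> r" for r
    unfolding jump_intensity_def by (intro sum_mono mult_left_le K lam that)
qed

definition observed_ind :: "real set \<Rightarrow> (real \<Rightarrow> 'a set) \<Rightarrow> real \<Rightarrow> 'a \<Rightarrow> ereal \<Rightarrow> real" where
  "observed_ind I A s x S = (if observed I A s x S then 1 else 0)"

text \<open>Times before \<open>r\<close> are read on the original flow line, times from
  \<open>r\<close> on along the line restarted at \<open>r\<close>; the half-open convention makes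
  this a partition, and the flow property identifies the two lines.\<close>

lemma observed_split:
  assumes "0 \<le> s" "s \<le> r" "ereal r \<le> S" "x \<in> M"
  shows "observed I A s x S \<longleftrightarrow> observed I A s x (ereal r) \<and> observed I A r (\<phi> s r x) S"
proof -
  have *: "(s \<le> t \<and> ereal t < S \<longrightarrow> \<phi> s t x \<in> A t) \<longleftrightarrow>
     (s \<le> t \<and> ereal t < ereal r \<longrightarrow> \<phi> s t x \<in> A t) \<and> (r \<le> t \<and> ereal t < S \<longrightarrow> \<phi> r t (\<phi> s r x) \<in> A t)" for t
  proof (cases "r \<le> t")
    case True
    then show ?thesis using flow_flow[OF assms(1,2) True assms(4)] assms(2) by auto
  next
    case False
    then have "ereal t < S" using assms(3) by (intro less_le_trans[OF _ assms(3)]) simp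
    then show ?thesis using False by auto
  qed
  show ?thesis unfolding observed_def using * by blast
qed

lemma observed_ind_split:
  assumes "0 \<le> s" "s \<le> r" "ereal r \<le> S" "x \<in> M"
  shows "observed_ind I A s x S = observed_ind I A s x (ereal r) * observed_ind I A r (\<phi> s r x) S"
  unfolding observed_ind_def using observed_split[OF assms] by auto

lemma observed_ind_measurable:
  assumes "finite I"
  shows "(\<lambda>r. observed_ind I A s x (ereal r)) \<in> borel_measurable (restrict_space borel {s..T})"
proof -
  note observed_measurable[OF assms, of A s x, measurable]
  have "(\<lambda>r. observed_ind I A s x (ereal (max s r))) \<in> borel_measurable borel"
    unfolding observed_ind_def by measurable
  then have "(\<lambda>r. observed_ind I A s x (ereal (max s r))) \<in> borel_measurable (restrict_space borel {s..T})"
    by (rule measurable_restrict_space1)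
  then show ?thesis
    by (rule measurable_cong[THEN iffD1, rotated]) (auto simp: max_absorb2 space_restrict_space)
qed

lemma renewal_integrand:
  fixes A :: "real \<Rightarrow> 'a set"
  assumes s: "0 \<le> s" "x \<in> M" and I: "finite I"
    and u: "(\<lambda>(s, x). u s x) \<in> borel_measurable (state_space M)" "\<And>r y. u r y \<le> (1::ennreal)"
  defines "f \<equiv> \<lambda>r. observed_ind I A s x (ereal r) * jump_intensity u r (\<phi> s r x) * exp (- integral {s..r} (total_rate s x))"
  shows "f \<in> borel_measurable (restrict_space borel {s..T})" "\<exists>B. \<forall>r\<in>{s..T}. \<bar>f r\<bar> \<le> B"
    and "\<And>r. s \<le> r \<Longrightarrow> 0 \<le> f r"
proof -
  note a = total_rate_jump_rate[OF s]
  note q = jump_intensity_traj[OF s u]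
  have "(\<lambda>r. exp (- integral {s..r} (total_rate s x))) \<in> borel_measurable (restrict_space borel {s..T})"
    by (intro borel_measurable_continuous_on_restrict continuous_intros jump_rate_integral_continuous[OF a])
  then show "f \<in> borel_measurable (restrict_space borel {s..T})"
    unfolding f_def by (intro borel_measurable_times observed_ind_measurable I q(1))
  obtain B where B: "\<And>r. r \<in> {s..T} \<Longrightarrow> \<bar>total_rate s x r\<bar> \<le> B" using jump_rate_bounded[OF a] by blast
  have "\<bar>f r\<bar> \<le> 1 * \<bar>B\<bar> * 1" if r: "r \<in> {s..T}" for r
    unfolding f_def abs_mult
  proof (intro mult_mono)
    show "\<bar>jump_intensity u r (\<phi> s r x)\<bar> \<le> \<bar>B\<bar>" using q(2,3)[of r] B[OF r] r by auto
    show "\<bar>exp (- integral {s..r} (total_rate s x))\<bar> \<le> 1"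
      using jump_rate_integral_nonneg[OF a, of r] r by simp
  qed (auto simp: observed_ind_def)
  then show "\<exists>B. \<forall>r\<in>{s..T}. \<bar>f r\<bar> \<le> B" by blast
  show "0 \<le> f r" if "s \<le> r" for r
    unfolding f_def using q(2)[OF that] by (intro mult_nonneg_nonneg) (auto simp: observed_ind_def)
qed

text \<open>The bound \<open>u \<le> 1\<close> makes every term finite, so the extended integrals
  are real ones and the product rule for primitives becomes applicable.\<close>

lemma renewal_eq_real:
  assumes s: "0 \<le> s" "x \<in> M" and sT: "s \<le> T" and I: "finite I"
    and u: "(\<lambda>(s, x). u s x) \<in> borel_measurable (state_space M)" "\<And>r y. u r y \<le> (1::ennreal)"
  shows "renewal I A T u s x = ennreal (observed_ind I A s x \<infinity> * exp (- integral {s..T} (total_rate s x)) +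
     integral {s..T} (\<lambda>r. observed_ind I A s x (ereal r) * jump_intensity u r (\<phi> s r x) * exp (- integral {s..r} (total_rate s x))))"
proof -
  let ?f = "\<lambda>r. observed_ind I A s x (ereal r) * jump_intensity u r (\<phi> s r x) * exp (- integral {s..r} (total_rate s x))"
  let ?g = "\<lambda>j r. ((if observed I A s x (ereal r) then 1 else 0) * (\<integral>\<^sup>+ v. u r (G j r (\<phi> s r x) v) \<partial>uniform01)) *
        ennreal (traj_rate s x j r * exp (- (\<Sum>i=1..l. integral {s..r} (traj_rate s x i)))) * indicator {s..T} r"
  note f = renewal_integrand[OF s I u, where A = A]
  obtain B where B: "\<forall>r\<in>{s..T}. \<bar>?f r\<bar> \<le> B" using f(2) by blast
  have si: "set_integrable lborel {s..T} ?f"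
    by (rule set_integrable_bounded_interval[OF f(1) B order_refl order_refl])
  have g: "?g j \<in> borel_measurable lborel" if j: "j \<in> {1..l}" for j
  proof -
    note kernel_integral_measurable[OF s j u(1), measurable] observed_measurable[OF I, of A s x, measurable]
    have a: "(\<lambda>r. ennreal (traj_rate s x j r * exp (- integral {s..r} (total_rate s x)))) \<in> borel_measurable (restrict_space borel {s..T})"
      by (intro measurable_compose[OF _ measurable_ennreal] borel_measurable_times
          jump_rate_measurable[OF jump_rate_traj[OF s j]] borel_measurable_continuous_on_restrict continuous_intros
          jump_rate_integral_continuous[OF total_rate_jump_rate[OF s]])
    then have [measurable]: "(\<lambda>r. ennreal (traj_rate s x j r * exp (- integral {s..r} (total_rate s x))) * indicator {s..T} r) \<in> borel_measurable borel"
      by (subst (asm) borel_measurable_restrict_space_iff_ennreal) auto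
    have "(\<lambda>r. ((if observed I A s x (ereal (max s r)) then 1 else 0) *
          (\<integral>\<^sup>+ v. u (max s r) (G j (max s r) (\<phi> s (max s r) x) v) \<partial>uniform01)) *
        (ennreal (traj_rate s x j r * exp (- integral {s..r} (total_rate s x))) * indicator {s..T} r)) \<in> borel_measurable lborel"
      by measurable
    then show ?thesis
      by (rule measurable_cong[THEN iffD1, rotated])
        (auto simp: indicator_def max_absorb2 integral_total_rate[OF s order_refl] simp del: One_nat_def)
  qed
  have "(\<Sum>j=1..l. integral\<^sup>N lborel (?g j)) = (\<integral>\<^sup>+ r. (\<Sum>j=1..l. ?g j r) \<partial>lborel)"
    by (rule nn_integral_sum[symmetric]) (rule g)
  also have "\<dots> = (\<integral>\<^sup>+ r. ennreal (indicator {s..T} r *\<^sub>R ?f r) \<partial>lborel)"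
  proof (rule nn_integral_cong)
    fix r
    show "(\<Sum>j=1..l. ?g j r) = ennreal (indicator {s..T} r *\<^sub>R ?f r)"
    proof (cases "r \<in> {s..T} \<and> observed I A s x (ereal r)")
      case True
      have lam: "0 \<le> lam j r (\<phi> s r x)" if "j \<in> {1..l}" for j
        using lam_nonneg[OF that] flow_in_M[OF s(1) _ s(2)] s True by simp
      have K: "ennreal (enn2real (\<integral>\<^sup>+ v. u r (G j r (\<phi> s r x) v) \<partial>uniform01)) = (\<integral>\<^sup>+ v. u r (G j r (\<phi> s r x) v) \<partial>uniform01)" for j
        using kernel_integral_le_1[of u r j "\<phi> s r x", OF u(2)] by (intro ennreal_enn2real) (auto intro: le_less_trans)
      have "(\<Sum>j=1..l. ?g j r) = (\<Sum>j=1..l. ennreal (lam j r (\<phi> s r x) * enn2real (\<integral>\<^sup>+ v. u r (G j r (\<phi> s r x) v) \<partial>uniform01) *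
          exp (- integral {s..r} (total_rate s x))))"
      proof (rule sum.cong[OF refl])
        fix j assume j: "j \<in> {1..l}"
        have "?g j r = ennreal (enn2real (\<integral>\<^sup>+ v. u r (G j r (\<phi> s r x) v) \<partial>uniform01)) *
           ennreal (lam j r (\<phi> s r x) * exp (- integral {s..r} (total_rate s x)))"
          using True by (simp add: K integral_total_rate[OF s order_refl] del: One_nat_def)
        also have "\<dots> = ennreal (enn2real (\<integral>\<^sup>+ v. u r (G j r (\<phi> s r x) v) \<partial>uniform01) *
           (lam j r (\<phi> s r x) * exp (- integral {s..r} (total_rate s x))))"
          using lam[OF j] by (intro ennreal_mult[symmetric]) auto
        finally show "?g j r = ennreal (lam j r (\<phi> s r x) * enn2real (\<integral>\<^sup>+ v. u r (G j r (\<phi> s r x) v) \<partial>uniform01) *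
          exp (- integral {s..r} (total_rate s x)))" by (simp only: mult_ac)
      qed
      also have "\<dots> = ennreal (\<Sum>j=1..l. lam j r (\<phi> s r x) * enn2real (\<integral>\<^sup>+ v. u r (G j r (\<phi> s r x) v) \<partial>uniform01) *
          exp (- integral {s..r} (total_rate s x)))"
        using lam by (intro sum_ennreal) auto
      also have "\<dots> = ennreal (indicator {s..T} r *\<^sub>R ?f r)"
        using True unfolding jump_intensity_def observed_ind_def by (simp add: sum_distrib_right)
      finally show ?thesis .
    next
      case False
      then show ?thesis by (auto simp: observed_ind_def)
    qed
  qed
  also have "\<dots> = ennreal (integral {s..T} ?f)"
  proof -
    have "(\<integral>\<^sup>+ r. ennreal (indicator {s..T} r *\<^sub>R ?f r) \<partial>lborel) = ennreal (LBINT r:{s..T}. ?f r)"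
      unfolding set_lebesgue_integral_def
    proof (rule nn_integral_eq_integral[OF si[unfolded set_integrable_def]])
      show "AE r in lborel. 0 \<le> indicator {s..T} r *\<^sub>R ?f r"
        using f(3) by (intro AE_I2) (auto simp: indicator_def)
    qed
    then show ?thesis unfolding set_borel_integral_eq_integral(2)[OF si] .
  qed
  finally have 1: "(\<Sum>j=1..l. integral\<^sup>N lborel (?g j)) = ennreal (integral {s..T} ?f)" .
  have 2: "(if observed I A s x \<infinity> then 1 else 0) * ennreal (exp (- (\<Sum>j=1..l. integral {s..T} (traj_rate s x j)))) =
      ennreal (observed_ind I A s x \<infinity> * exp (- integral {s..T} (total_rate s x)))"
    by (simp add: observed_ind_def integral_total_rate[OF s order_refl] del: One_nat_def)
  have "0 \<le> integral {s..T} ?f"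
    by (rule integral_nonneg[OF set_borel_integral_eq_integral(1)[OF si]]) (use f(3) in auto)
  then show ?thesis
    unfolding renewal_def 1 2 by (intro ennreal_plus[symmetric]) (auto simp: observed_ind_def)
qed

end

section \<open>Changing the jump mechanisms\<close>

text \<open>Fix the starting state and read the fixed point equation at every point of its flow
  line. Multiplied by the observations made so far and by the survival factor up to
  \<open>r\<close>, the equations from all these points become one equation with data of the line
  from \<open>s\<close>, the premise \<open>eq\<close> of
  \<open>renewal_equation_change_rate\<close>.\<close>

lemma renewal_change_system:
  fixes M :: "'a::euclidean_space set"
  assumes S1: "pdmp_system M \<phi> l\<^sub>1 lam\<^sub>1 G\<^sub>1" and S2: "pdmp_system M \<phi> l\<^sub>2 lam\<^sub>2 G\<^sub>2"
    and gen: "\<And>t x. 0 \<le> t \<Longrightarrow> x \<in> M \<Longrightarrow>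
       pdmp_system.jump_intensity l\<^sub>1 lam\<^sub>1 G\<^sub>1 u t x - (\<Sum>j=1..l\<^sub>1. lam\<^sub>1 j t x) * enn2real (u t x) =
       pdmp_system.jump_intensity l\<^sub>2 lam\<^sub>2 G\<^sub>2 u t x - (\<Sum>j=1..l\<^sub>2. lam\<^sub>2 j t x) * enn2real (u t x)"
    and I: "finite I"
    and u: "(\<lambda>(s, x). u s x) \<in> borel_measurable (state_space M)" "\<And>r y. u r y \<le> (1::ennreal)"
    and fp: "\<And>s x. 0 \<le> s \<Longrightarrow> s \<le> T \<Longrightarrow> x \<in> M \<Longrightarrow> pdmp_system.renewal \<phi> l\<^sub>1 lam\<^sub>1 G\<^sub>1 I A T u s x = u s x"
    and s: "0 \<le> s" "s \<le> T" and x: "x \<in> M"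
  shows "pdmp_system.renewal \<phi> l\<^sub>2 lam\<^sub>2 G\<^sub>2 I A T u s x = u s x"
proof -
  interpret A: pdmp_system M \<phi> l\<^sub>1 lam\<^sub>1 G\<^sub>1 by (rule S1)
  interpret B: pdmp_system M \<phi> l\<^sub>2 lam\<^sub>2 G\<^sub>2 by (rule S2)
  let ?a1 = "A.total_rate s x" and ?a2 = "B.total_rate s x"
  let ?q1 = "\<lambda>r. A.jump_intensity u r (\<phi> s r x)" and ?q2 = "\<lambda>r. B.jump_intensity u r (\<phi> s r x)"
  let ?g = "\<lambda>r. enn2real (u r (\<phi> s r x))"
  let ?D = "\<lambda>r. A.observed_ind I A s x (ereal r)" and ?C = "A.observed_ind I A s x \<infinity>"
  note a1 = A.total_rate_jump_rate[OF s(1) x] and a2 = B.total_rate_jump_rate[OF s(1) x]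
  obtain B1 where B1: "\<And>r. r \<in> {s..T} \<Longrightarrow> \<bar>?a1 r\<bar> \<le> B1" using jump_rate_bounded[OF a1] by blast
  obtain B2 where B2: "\<And>r. r \<in> {s..T} \<Longrightarrow> \<bar>?a2 r\<bar> \<le> B2" using jump_rate_bounded[OF a2] by blast
  have ring1: "g = c * X + Y \<Longrightarrow> D * g * E = (D * c) * (E * X) + (D * E) * Y" for g c X Y D E :: real
    by (simp add: algebra_simps)
  have "?g s = ?C * exp (- integral {s..T} ?a2) + integral {s..T} (\<lambda>t. ?D t * ?q2 t * exp (- integral {s..t} ?a2))"
  proof (rule renewal_equation_change_rate[OF s(2) jump_rate_measurable[OF a1] jump_rate_measurable[OF a2]
        A.jump_intensity_traj(1)[OF s(1) x u] A.observed_ind_measurable[OF I], where B = "max B1 B2" and g = ?g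
        and C = ?C and q\<^sub>2 = ?q2])
    fix r assume r: "r \<in> {s..T}"
    then have r0: "0 \<le> r" "r \<le> T" "s \<le> r" using s by auto
    have xr: "\<phi> s r x \<in> M" by (rule A.flow_in_M[OF s(1) r0(3) x])
    show "\<bar>?a1 r\<bar> \<le> max B1 B2" "\<bar>?a2 r\<bar> \<le> max B1 B2" using B1[OF r] B2[OF r] by auto
    show "\<bar>?q1 r\<bar> \<le> max B1 B2"
      using A.jump_intensity_traj(2)[OF s(1) x u r0(3)] A.jump_intensity_traj(3)[OF s(1) x u r0(3)] B1[OF r] by linarith
    show "\<bar>?D r\<bar> \<le> 1" unfolding A.observed_ind_def by simp
    show "?q1 r - ?a1 r * ?g r = ?q2 r - ?a2 r * ?g r" by (rule gen[OF r0(1) xr])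
    \<comment> \<open>Restarting on the flow line gives the same line again, so rates and their
      integrals agree from \<open>r\<close> on.\<close>
    have same: "A.traj_rate r (\<phi> s r x) j t = A.traj_rate s x j t" if "r \<le> t" for j t
      using A.flow_flow[OF s(1) r0(3) that x] by simp
    have tot: "integral {r..t} (A.total_rate r (\<phi> s r x)) = integral {r..t} ?a1" for t
      by (rule Henstock_Kurzweil_Integration.integral_cong) (simp add: same)
    have comb: "integral {s..r} ?a1 + integral {r..t} ?a1 = integral {s..t} ?a1" if "r \<le> t" for t
      by (rule Henstock_Kurzweil_Integration.integral_combine[OF r0(3) that])
        (rule jump_rate_integrable(2)[OF a1 order_refl])
    let ?Dr = "A.observed_ind I A r (\<phi> s r x)"
    let ?f = "\<lambda>t. ?Dr (ereal t) * A.jump_intensity u t (\<phi> r t (\<phi> s r x)) * exp (- integral {r..t} (A.total_rate r (\<phi> s r x)))"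
    note f = A.renewal_integrand[OF r0(1) xr I u, where A = A]
    obtain Bf where Bf: "\<forall>t\<in>{r..T}. \<bar>?f t\<bar> \<le> Bf" using f(2) by blast
    have fi: "?f integrable_on {r..T}" by (rule integrable_bounded_interval[OF f(1) Bf order_refl order_refl])
    have "?g r = enn2real (A.renewal I A T u r (\<phi> s r x))" using fp[OF r0(1,2) xr] by simp
    also have "\<dots> = ?Dr \<infinity> * exp (- integral {r..T} (A.total_rate r (\<phi> s r x))) + integral {r..T} ?f"
    proof -
      have "0 \<le> integral {r..T} ?f" by (rule integral_nonneg[OF fi]) (use f(3) in auto)
      moreover have "0 \<le> ?Dr \<infinity> * exp (- integral {r..T} (A.total_rate r (\<phi> s r x)))"
        unfolding A.observed_ind_def by simp
      ultimately show ?thesis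
        unfolding A.renewal_eq_real[OF r0(1) xr r0(2) I u] by (intro enn2real_ennreal add_nonneg_nonneg)
    qed
    also have "\<dots> = ?Dr \<infinity> * exp (- integral {r..T} ?a1) + integral {r..T} ?f"
      unfolding tot[of T] ..
    finally have gr: "?g r = ?Dr \<infinity> * exp (- integral {r..T} ?a1) + integral {r..T} ?f" .
    have "?D r * ?g r * exp (- integral {s..r} ?a1) =
       (?D r * ?Dr \<infinity>) * (exp (- integral {s..r} ?a1) * exp (- integral {r..T} ?a1)) +
       (?D r * exp (- integral {s..r} ?a1)) * integral {r..T} ?f"
      by (rule ring1[OF gr])
    also have "?D r * ?Dr \<infinity> = ?C" by (rule A.observed_ind_split[OF s(1) r0(3) _ x, symmetric]) simp
    also have "exp (- integral {s..r} ?a1) * exp (- integral {r..T} ?a1) = exp (- integral {s..T} ?a1)"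
      using comb[OF r0(2)] by (simp add: exp_add[symmetric])
    also have "(?D r * exp (- integral {s..r} ?a1)) * integral {r..T} ?f =
        integral {r..T} (\<lambda>t. (?D r * exp (- integral {s..r} ?a1)) * ?f t)"
      by (rule integral_mult_right[symmetric])
    also have "\<dots> = integral {r..T} (\<lambda>t. ?D t * ?q1 t * exp (- integral {s..t} ?a1))"
    proof (rule Henstock_Kurzweil_Integration.integral_cong)
      fix t assume t: "t \<in> {r..T}"
      have "?D t = ?D r * ?Dr (ereal t)" by (rule A.observed_ind_split[OF s(1) r0(3) _ x]) (use t in simp)
      moreover have "exp (- integral {s..t} ?a1) = exp (- integral {s..r} ?a1) * exp (- integral {r..t} ?a1)"
        using comb[of t] t by (simp add: exp_add[symmetric])
      moreover have "\<phi> r t (\<phi> s r x) = \<phi> s t x" using A.flow_flow[OF s(1) r0(3) _ x] t by simp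
      ultimately show "(?D r * exp (- integral {s..r} ?a1)) * ?f t = ?D t * ?q1 t * exp (- integral {s..t} ?a1)"
        unfolding tot by (simp only: mult_ac)
    qed
    finally show "?D r * ?g r * exp (- integral {s..r} ?a1) = ?C * exp (- integral {s..T} ?a1) +
        integral {r..T} (\<lambda>t. ?D t * ?q1 t * exp (- integral {s..t} ?a1))" .
  next
    show "?D s = 1" unfolding A.observed_ind_def A.observed_def by auto
  qed
  moreover have "A.observed_ind I A = B.observed_ind I A"
    unfolding A.observed_ind_def B.observed_ind_def A.observed_def B.observed_def ..
  ultimately have "B.renewal I A T u s x = ennreal (?g s)"
    unfolding B.renewal_eq_real[OF s(1) x s(2) I u] by simp
  also have "\<dots> = u s x"
    unfolding A.flow_id[OF s(1) x] by (rule ennreal_enn2real[OF le_less_trans[OF u(2) ennreal_one_less_top]])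
  finally show ?thesis .
qed

text \<open>A finite mixture of image laws is realized as one image measure, of a weighted index
  together with a uniform variable. Equality of two mixtures can then be stated as equality of
  measures.\<close>

lemma nn_integral_mixture:
  fixes W :: "nat \<Rightarrow> real" and Y :: "nat \<Rightarrow> real \<Rightarrow> 'b"
  assumes Y: "\<And>j. j \<le> l \<Longrightarrow> Y j \<in> uniform01 \<rightarrow>\<^sub>M N" and f: "f \<in> borel_measurable N"
  shows "(\<integral>\<^sup>+ y. f y \<partial>distr (point_measure {..l} (\<lambda>j. ennreal (W j)) \<Otimes>\<^sub>M uniform01) N (\<lambda>(j, v). Y j v)) =
     (\<Sum>j\<le>l. ennreal (W j) * (\<integral>\<^sup>+ v. f (Y j v) \<partial>uniform01))"
proof -
  interpret U: prob_space uniform01 by (rule prob_space_uniform01)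
  let ?P = "point_measure {..l} (\<lambda>j. ennreal (W j))"
  have "(\<lambda>p. Y (fst p) (snd p)) \<in> count_space {..l} \<Otimes>\<^sub>M uniform01 \<rightarrow>\<^sub>M N"
    by (rule measurable_pair_measure_countable1) (use Y in auto)
  moreover have "sets (count_space {..l} \<Otimes>\<^sub>M uniform01) = sets (?P \<Otimes>\<^sub>M uniform01)"
    by (intro sets_pair_measure_cong) (auto simp: sets_point_measure)
  ultimately have m: "(\<lambda>(j, v). Y j v) \<in> ?P \<Otimes>\<^sub>M uniform01 \<rightarrow>\<^sub>M N"
    unfolding case_prod_beta' using measurable_cong_sets by blast
  have "(\<integral>\<^sup>+ y. f y \<partial>distr (?P \<Otimes>\<^sub>M uniform01) N (\<lambda>(j, v). Y j v)) =
      (\<integral>\<^sup>+ p. f (case p of (j, v) \<Rightarrow> Y j v) \<partial>(?P \<Otimes>\<^sub>M uniform01))"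
    by (subst nn_integral_distr[OF m]) (simp_all add: f)
  also have "\<dots> = (\<integral>\<^sup>+ j. (\<integral>\<^sup>+ v. f (Y j v) \<partial>uniform01) \<partial>?P)"
    by (subst U.nn_integral_fst[symmetric, OF measurable_compose[OF m f]]) simp
  also have "\<dots> = (\<Sum>j\<le>l. ennreal (W j) * (\<integral>\<^sup>+ v. f (Y j v) \<partial>uniform01))"
    by (subst nn_integral_point_measure_finite) (auto simp: mult.commute)
  finally show ?thesis .
qed

lemma mixture_ennreal:
  fixes W :: "nat \<Rightarrow> real" and a :: "nat \<Rightarrow> ennreal"
  assumes "\<And>j. j \<le> l \<Longrightarrow> 0 \<le> W j" "\<And>j. a j \<le> 1"
  shows "(\<Sum>j\<le>l. ennreal (W j) * a j) = ennreal (W 0 * enn2real (a 0) + (\<Sum>j=1..l. W j * enn2real (a j)))"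
proof -
  have "ennreal (W j) * a j = ennreal (W j * enn2real (a j))" if "j \<le> l" for j
  proof -
    have "a j = ennreal (enn2real (a j))"
      by (rule ennreal_enn2real[symmetric, OF le_less_trans[OF assms(2) ennreal_one_less_top]])
    then show ?thesis using assms(1)[OF that] by (metis enn2real_nonneg ennreal_mult)
  qed
  then have "(\<Sum>j\<le>l. ennreal (W j) * a j) = (\<Sum>j\<le>l. ennreal (W j * enn2real (a j)))" by simp
  also have "\<dots> = ennreal (\<Sum>j\<le>l. W j * enn2real (a j))"
    using assms(1) by (intro sum_ennreal) auto
  also have "(\<Sum>j\<le>l. W j * enn2real (a j)) = W 0 * enn2real (a 0) + (\<Sum>j=1..l. W j * enn2real (a j))"
  proof -
    have "{..l} = insert 0 {1..l}" by auto
    then show ?thesis by simp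
  qed
  finally show ?thesis .
qed

text \<open>Moving the diagonal terms to the other side turns the hypothesis into an equality of two
  positive mixtures, indexed from 0 with the Dirac mass at \<open>y\<close> as component 0.\<close>

lemma generator_extend:
  fixes w\<^sub>1 w\<^sub>2 :: "nat \<Rightarrow> real" and g\<^sub>1 g\<^sub>2 :: "nat \<Rightarrow> real \<Rightarrow> 'b"
  assumes y: "y \<in> space N"
    and w: "\<And>j. j \<in> {1..l\<^sub>1} \<Longrightarrow> 0 \<le> w\<^sub>1 j" "\<And>j. j \<in> {1..l\<^sub>2} \<Longrightarrow> 0 \<le> w\<^sub>2 j"
    and g: "\<And>j. j \<in> {1..l\<^sub>1} \<Longrightarrow> g\<^sub>1 j \<in> uniform01 \<rightarrow>\<^sub>M N" "\<And>j. j \<in> {1..l\<^sub>2} \<Longrightarrow> g\<^sub>2 j \<in> uniform01 \<rightarrow>\<^sub>M N"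
    and eq: "\<And>A. A \<in> sets N \<Longrightarrow>
      (\<Sum>j=1..l\<^sub>1. w\<^sub>1 j * (measure uniform01 {v \<in> {0..1}. g\<^sub>1 j v \<in> A} - indicator A y)) =
      (\<Sum>j=1..l\<^sub>2. w\<^sub>2 j * (measure uniform01 {v \<in> {0..1}. g\<^sub>2 j v \<in> A} - indicator A y))"
    and f: "f \<in> borel_measurable N" "\<And>z. f z \<le> (1::ennreal)"
  shows "(\<Sum>j=1..l\<^sub>1. w\<^sub>1 j * enn2real (\<integral>\<^sup>+ v. f (g\<^sub>1 j v) \<partial>uniform01)) - (\<Sum>j=1..l\<^sub>1. w\<^sub>1 j) * enn2real (f y) =
     (\<Sum>j=1..l\<^sub>2. w\<^sub>2 j * enn2real (\<integral>\<^sup>+ v. f (g\<^sub>2 j v) \<partial>uniform01)) - (\<Sum>j=1..l\<^sub>2. w\<^sub>2 j) * enn2real (f y)"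
proof -
  interpret U: prob_space uniform01 by (rule prob_space_uniform01)
  \<comment> \<open>Component 0 of each side carries the total rate of the other family: the
    negative diagonal term of a family becomes a positive mass on the opposite side.\<close>
  define W1 where "W1 j = (if j = 0 then \<Sum>i=1..l\<^sub>2. w\<^sub>2 i else w\<^sub>1 j)" for j
  define W2 where "W2 j = (if j = 0 then \<Sum>i=1..l\<^sub>1. w\<^sub>1 i else w\<^sub>2 j)" for j
  define Y1 where "Y1 j = (if j = 0 then (\<lambda>_. y) else g\<^sub>1 j)" for j
  define Y2 where "Y2 j = (if j = 0 then (\<lambda>_. y) else g\<^sub>2 j)" for j
  have W: "\<And>j. j \<le> l\<^sub>1 \<Longrightarrow> 0 \<le> W1 j" "\<And>j. j \<le> l\<^sub>2 \<Longrightarrow> 0 \<le> W2 j"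
    using w unfolding W1_def W2_def by (auto intro!: sum_nonneg)
  have Y1: "Y1 j \<in> uniform01 \<rightarrow>\<^sub>M N" if "j \<le> l\<^sub>1" for j
    using g(1)[of j] that y unfolding Y1_def by (cases "j = 0") auto
  have Y2: "Y2 j \<in> uniform01 \<rightarrow>\<^sub>M N" if "j \<le> l\<^sub>2" for j
    using g(2)[of j] that y unfolding Y2_def by (cases "j = 0") auto
  let ?m1 = "distr (point_measure {..l\<^sub>1} (\<lambda>j. ennreal (W1 j)) \<Otimes>\<^sub>M uniform01) N (\<lambda>(j, v). Y1 j v)"
  let ?m2 = "distr (point_measure {..l\<^sub>2} (\<lambda>j. ennreal (W2 j)) \<Otimes>\<^sub>M uniform01) N (\<lambda>(j, v). Y2 j v)"
  have le1: "(\<integral>\<^sup>+ v. h (Y v) \<partial>uniform01) \<le> 1" if "\<And>z. h z \<le> (1::ennreal)" for h and Y :: "real \<Rightarrow> 'b"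
  proof -
    have "(\<integral>\<^sup>+ v. h (Y v) \<partial>uniform01) \<le> (\<integral>\<^sup>+ v. 1 \<partial>uniform01)" by (intro nn_integral_mono that)
    then show ?thesis using U.emeasure_space_1 by simp
  qed
  have m1: "(\<integral>\<^sup>+ z. h z \<partial>?m1) = ennreal ((\<Sum>i=1..l\<^sub>2. w\<^sub>2 i) * enn2real (h y) +
      (\<Sum>j=1..l\<^sub>1. w\<^sub>1 j * enn2real (\<integral>\<^sup>+ v. h (g\<^sub>1 j v) \<partial>uniform01)))"
    if "h \<in> borel_measurable N" "\<And>z. h z \<le> 1" for h
  proof -
    have "(\<integral>\<^sup>+ z. h z \<partial>?m1) = (\<Sum>j\<le>l\<^sub>1. ennreal (W1 j) * (\<integral>\<^sup>+ v. h (Y1 j v) \<partial>uniform01))"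
      by (rule nn_integral_mixture[OF Y1 that(1)])
    also have "\<dots> = ennreal (W1 0 * enn2real (\<integral>\<^sup>+ v. h (Y1 0 v) \<partial>uniform01) +
        (\<Sum>j=1..l\<^sub>1. W1 j * enn2real (\<integral>\<^sup>+ v. h (Y1 j v) \<partial>uniform01)))"
      by (rule mixture_ennreal[OF W(1) le1[OF that(2)]])
    finally show ?thesis using U.emeasure_space_1 by (simp add: W1_def Y1_def)
  qed
  have m2: "(\<integral>\<^sup>+ z. h z \<partial>?m2) = ennreal ((\<Sum>i=1..l\<^sub>1. w\<^sub>1 i) * enn2real (h y) +
      (\<Sum>j=1..l\<^sub>2. w\<^sub>2 j * enn2real (\<integral>\<^sup>+ v. h (g\<^sub>2 j v) \<partial>uniform01)))"
    if "h \<in> borel_measurable N" "\<And>z. h z \<le> 1" for h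
  proof -
    have "(\<integral>\<^sup>+ z. h z \<partial>?m2) = (\<Sum>j\<le>l\<^sub>2. ennreal (W2 j) * (\<integral>\<^sup>+ v. h (Y2 j v) \<partial>uniform01))"
      by (rule nn_integral_mixture[OF Y2 that(1)])
    also have "\<dots> = ennreal (W2 0 * enn2real (\<integral>\<^sup>+ v. h (Y2 0 v) \<partial>uniform01) +
        (\<Sum>j=1..l\<^sub>2. W2 j * enn2real (\<integral>\<^sup>+ v. h (Y2 j v) \<partial>uniform01)))"
      by (rule mixture_ennreal[OF W(2) le1[OF that(2)]])
    finally show ?thesis using U.emeasure_space_1 by (simp add: W2_def Y2_def)
  qed
  \<comment> \<open>The hypothesis on sets identifies the two measures; integrating \<open>f\<close>
    against them then extends it to functions.\<close>
  have "?m1 = ?m2"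
  proof (rule measure_eqI)
    fix A assume "A \<in> sets ?m1"
    then have A: "A \<in> sets N" by simp
    have ind: "indicator A \<in> borel_measurable N" "\<And>z. indicator A z \<le> (1::ennreal)"
      using A by (auto simp: indicator_def)
    have K: "enn2real (\<integral>\<^sup>+ v. indicator A (h v) \<partial>uniform01) = measure uniform01 {v \<in> {0..1}. h v \<in> A}"
      if "h \<in> uniform01 \<rightarrow>\<^sub>M N" for h
    proof -
      have "(\<integral>\<^sup>+ v. indicator A (h v) \<partial>uniform01) = (\<integral>\<^sup>+ v. indicator {v \<in> {0..1}. h v \<in> A} v \<partial>uniform01)"
        by (intro nn_integral_cong) (auto simp: indicator_def)
      also have "\<dots> = emeasure uniform01 {v \<in> {0..1}. h v \<in> A}"
        using measurable_sets[OF that A] by (intro nn_integral_indicator) (simp add: vimage_def Int_def conj_commute)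
      finally show ?thesis by (simp add: measure_def)
    qed
    have e: "enn2real (indicator A y) = indicator A y" by (simp add: indicator_def)
    have "(\<Sum>i=1..l\<^sub>2. w\<^sub>2 i) * indicator A y + (\<Sum>j=1..l\<^sub>1. w\<^sub>1 j * measure uniform01 {v \<in> {0..1}. g\<^sub>1 j v \<in> A}) =
       (\<Sum>i=1..l\<^sub>1. w\<^sub>1 i) * indicator A y + (\<Sum>j=1..l\<^sub>2. w\<^sub>2 j * measure uniform01 {v \<in> {0..1}. g\<^sub>2 j v \<in> A})"
      using eq[OF A] by (simp add: right_diff_distrib sum_subtractf sum_distrib_right)
    then have "(\<integral>\<^sup>+ z. indicator A z \<partial>?m1) = (\<integral>\<^sup>+ z. indicator A z \<partial>?m2)"
      unfolding m1[OF ind] m2[OF ind] e using K g by simp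
    then show "emeasure ?m1 A = emeasure ?m2 A" using A by simp
  qed simp
  then have "ennreal ((\<Sum>i=1..l\<^sub>2. w\<^sub>2 i) * enn2real (f y) + (\<Sum>j=1..l\<^sub>1. w\<^sub>1 j * enn2real (\<integral>\<^sup>+ v. f (g\<^sub>1 j v) \<partial>uniform01))) =
     ennreal ((\<Sum>i=1..l\<^sub>1. w\<^sub>1 i) * enn2real (f y) + (\<Sum>j=1..l\<^sub>2. w\<^sub>2 j * enn2real (\<integral>\<^sup>+ v. f (g\<^sub>2 j v) \<partial>uniform01)))"
    using m1[OF f] m2[OF f] by simp
  then show ?thesis
    using w by (subst (asm) ennreal_inj) (auto intro!: add_nonneg_nonneg mult_nonneg_nonneg sum_nonneg)
qed

lemma observed_path_prob_le:
  assumes S1: "pdmp_system M \<phi> l\<^sub>1 lam\<^sub>1 G\<^sub>1" and S2: "pdmp_system M \<phi> l\<^sub>2 lam\<^sub>2 G\<^sub>2"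
    and gen: "\<And>u t x. (\<lambda>(s, x). u s x) \<in> borel_measurable (state_space M) \<Longrightarrow> (\<And>r y. u r y \<le> (1::ennreal)) \<Longrightarrow>
       0 \<le> t \<Longrightarrow> x \<in> M \<Longrightarrow>
       pdmp_system.jump_intensity l\<^sub>1 lam\<^sub>1 G\<^sub>1 u t x - (\<Sum>j=1..l\<^sub>1. lam\<^sub>1 j t x) * enn2real (u t x) =
       pdmp_system.jump_intensity l\<^sub>2 lam\<^sub>2 G\<^sub>2 u t x - (\<Sum>j=1..l\<^sub>2. lam\<^sub>2 j t x) * enn2real (u t x)"
    and I: "finite I" "I \<subseteq> {0..T}" and A: "\<And>t. t \<in> I \<Longrightarrow> A t \<in> sets borel"
    and s: "0 \<le> s" "s \<le> T" and x: "x \<in> M"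
  shows "noise_prob l\<^sub>2 (pdmp_system.observed_path \<phi> l\<^sub>2 lam\<^sub>2 G\<^sub>2 I A T) s x \<le>
     noise_prob l\<^sub>1 (pdmp_system.observed_path \<phi> l\<^sub>1 lam\<^sub>1 G\<^sub>1 I A T) s x"
proof -
  interpret A: pdmp_system M \<phi> l\<^sub>1 lam\<^sub>1 G\<^sub>1 by (rule S1)
  interpret B: pdmp_system M \<phi> l\<^sub>2 lam\<^sub>2 G\<^sub>2 by (rule S2)
  let ?u = "noise_prob l\<^sub>1 (A.observed_path I A T)"
  have I': "I \<subseteq> {0..}" using I(2) by auto
  have um: "(\<lambda>(s, x). ?u s x) \<in> borel_measurable (state_space M)"
    by (rule noise_prob_measurable[OF A.observed_path_measurable[OF I(1) I']]) (rule A)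
  have fpA: "A.renewal I A T ?u s x = ?u s x" if "0 \<le> s" "s \<le> T" "x \<in> M" for s x
    by (rule A.observed_path_fixpoint[OF I _ that]) (rule A)
  have fpB: "B.renewal I A T ?u s x = ?u s x" if "0 \<le> s" "s \<le> T" "x \<in> M" for s x
    by (rule renewal_change_system[OF S1 S2 _ I(1) um noise_prob_le_1 fpA that])
      (rule gen[OF um noise_prob_le_1], assumption+)
  show ?thesis
    by (rule B.observed_path_minimal[OF I _ fpB s x]) (rule A)
qed

section \<open>Paths of the process\<close>

definition advance :: "(real \<Rightarrow> real \<Rightarrow> 'a \<Rightarrow> 'a::euclidean_space) \<Rightarrow> nat \<Rightarrow> (nat \<Rightarrow> real \<Rightarrow> 'a \<Rightarrow> real) \<Rightarrow>
    (nat \<Rightarrow> real \<Rightarrow> 'a \<Rightarrow> real \<Rightarrow> 'a) \<Rightarrow> (nat \<Rightarrow> real) \<times> real \<Rightarrow> (real \<times> 'a) option \<Rightarrow> (real \<times> 'a) option" where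
  "advance \<phi> l lam G \<nu> z = (case z of None \<Rightarrow> None | Some (s, x) \<Rightarrow>
     (let e = fst \<nu>; u = snd \<nu>; S = next_time \<phi> l lam e s x in
      if S = \<infinity> then None
      else let t = real_of_ereal S in Some (t, G (next_index \<phi> l lam e s x) t (\<phi> s t x) u)))"

primrec skeleton_from :: "(real \<Rightarrow> real \<Rightarrow> 'a \<Rightarrow> 'a::euclidean_space) \<Rightarrow> nat \<Rightarrow> (nat \<Rightarrow> real \<Rightarrow> 'a \<Rightarrow> real) \<Rightarrow>
    (nat \<Rightarrow> real \<Rightarrow> 'a \<Rightarrow> real \<Rightarrow> 'a) \<Rightarrow> (real \<times> 'a) option \<Rightarrow> (nat \<Rightarrow> (nat \<Rightarrow> real) \<times> real) \<Rightarrow> nat \<Rightarrow> (real \<times> 'a) option" where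
  "skeleton_from \<phi> l lam G z \<eta> 0 = z"
| "skeleton_from \<phi> l lam G z \<eta> (Suc k) = advance \<phi> l lam G (\<eta> (Suc k)) (skeleton_from \<phi> l lam G z \<eta> k)"

lemma skeleton_eq_skeleton_from: "skeleton \<phi> l lam G w \<eta> k = skeleton_from \<phi> l lam G (Some (0, w)) \<eta> k"
  by (induction k) (simp_all add: advance_def)

text \<open>The skeleton recursion peels off the last round, whereas \<open>first_step\<close> peels
  off the first. This identity reconciles the two.\<close>

lemma skeleton_from_shift:
  "skeleton_from \<phi> l lam G z \<eta> (Suc k) = skeleton_from \<phi> l lam G (advance \<phi> l lam G (\<eta> 1) z) (noise_shift \<eta>) k"
proof (induction k)
  case (Suc k)
  have "noise_shift \<eta> (Suc k) = \<eta> (Suc (Suc k))" by (simp add: noise_shift_def)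
  then show ?case using Suc by (simp only: skeleton_from.simps(2))
qed simp

definition time_of :: "(real \<times> 'a) option \<Rightarrow> ereal" where
  "time_of z = (case z of None \<Rightarrow> \<infinity> | Some (s, x) \<Rightarrow> ereal s)"

lemma time_of_simps [simp]: "time_of None = \<infinity>" "time_of (Some (s, x)) = ereal s"
  by (simp_all add: time_of_def)

lemma jump_time_eq_time_of: "jump_time \<phi> l lam G w \<eta> k = time_of (skeleton \<phi> l lam G w \<eta> k)"
  unfolding jump_time_def time_of_def ..

lemma advance_None [simp]: "advance \<phi> l lam G \<nu> None = None"
  by (simp add: advance_def)

section \<open>Observation events in terms of the skeleton\<close>

context pdmp_system begin

abbreviation "adv \<equiv> advance \<phi> l lam G"
abbreviation "skel \<equiv> skeleton_from \<phi> l lam G"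

lemma time_of_advance:
  "time_of (adv \<nu> (Some (s, x))) = first_ring l s (traj_rate s x) (fst \<nu>)"
proof -
  have "first_ring l s (traj_rate s x) (fst \<nu>) \<noteq> - \<infinity>"
    using first_ring_ge[of s "traj_rate s x" "fst \<nu>"] by auto
  then show ?thesis
    unfolding advance_def Let_def next_time_eq_first_ring
    by (cases "first_ring l s (traj_rate s x) (fst \<nu>)") auto
qed

lemma time_of_advance_ge: "time_of z \<le> time_of (adv \<nu> z)"
proof (cases z)
  case (Some p)
  then obtain s x where "z = Some (s, x)" by (cases p) auto
  then show ?thesis using first_ring_ge by (simp add: time_of_advance)
qed simp

lemma advance_Some:
  assumes "first_ring l s (traj_rate s x) (fst \<nu>) \<le> ereal T"
  shows "adv \<nu> (Some (s, x)) = Some (real_of_ereal (first_ring l s (traj_rate s x) (fst \<nu>)),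
     G (first_ringer l s (traj_rate s x) (fst \<nu>)) (real_of_ereal (first_ring l s (traj_rate s x) (fst \<nu>)))
       (\<phi> s (real_of_ereal (first_ring l s (traj_rate s x) (fst \<nu>))) x) (snd \<nu>))"
  using assms unfolding advance_def Let_def next_time_eq_first_ring next_index_eq_first_ringer by auto

text \<open>The non-recursive counterpart of \<open>observed_within\<close>, sorted by the exact
  number \<open>m\<close> of jumps up to \<open>T\<close>.\<close>

definition observed_skeleton :: "real set \<Rightarrow> (real \<Rightarrow> 'a set) \<Rightarrow> real \<Rightarrow> nat \<Rightarrow> (real \<times> 'a) option \<Rightarrow>
    (nat \<Rightarrow> (nat \<Rightarrow> real) \<times> real) \<Rightarrow> bool" where
  "observed_skeleton I A T m z \<eta> \<longleftrightarrow> (\<forall>k<m. time_of (skel z \<eta> (Suc k)) \<le> ereal T) \<and>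
     ereal T < time_of (skel z \<eta> (Suc m)) \<and>
     (\<forall>k\<le>m. \<forall>s x. skel z \<eta> k = Some (s, x) \<longrightarrow> observed I A s x (time_of (skel z \<eta> (Suc k))))"

lemma observed_skeleton_0:
  "observed_skeleton I A T 0 (Some (s, x)) \<eta> \<longleftrightarrow>
     ereal T < first_ring l s (traj_rate s x) (fst (\<eta> 1)) \<and> observed I A s x (first_ring l s (traj_rate s x) (fst (\<eta> 1)))"
  unfolding observed_skeleton_def by (simp add: time_of_advance)

lemma observed_skeleton_Suc:
  "observed_skeleton I A T (Suc m) (Some (s, x)) \<eta> \<longleftrightarrow>
     first_ring l s (traj_rate s x) (fst (\<eta> 1)) \<le> ereal T \<and>
     observed I A s x (first_ring l s (traj_rate s x) (fst (\<eta> 1))) \<and>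
     observed_skeleton I A T m (adv (\<eta> 1) (Some (s, x))) (noise_shift \<eta>)"
proof -
  let ?z = "Some (s, x)" and ?z' = "adv (\<eta> 1) (Some (s, x))"
  have sk: "skel ?z \<eta> (Suc k) = skel ?z' (noise_shift \<eta>) k" for k by (rule skeleton_from_shift)
  have 0: "skel ?z \<eta> 0 = ?z" "skel ?z' (noise_shift \<eta>) 0 = ?z'" by simp_all
  have all_less: "(\<forall>k<Suc m. Q k) \<longleftrightarrow> Q 0 \<and> (\<forall>k<m. Q (Suc k))" for Q by (metis less_Suc_eq_0_disj not_less_eq)
  have all_le: "(\<forall>k\<le>Suc m. Q k) \<longleftrightarrow> Q 0 \<and> (\<forall>k\<le>m. Q (Suc k))" for Q by (metis Suc_le_mono le0 not0_implies_Suc)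
  have t: "time_of ?z' = first_ring l s (traj_rate s x) (fst (\<eta> 1))" by (rule time_of_advance)
  show ?thesis
    unfolding observed_skeleton_def all_less all_le sk 0 t by auto
qed

lemma observed_within_iff:
  "observed_within I A T n s x \<eta> \<longleftrightarrow> (\<exists>m<n. observed_skeleton I A T m (Some (s, x)) \<eta>)"
proof (induction n arbitrary: s x \<eta>)
  case (Suc n)
  let ?S = "first_ring l s (traj_rate s x) (fst (\<eta> 1))"
  have ex: "(\<exists>m<Suc n. Q m) \<longleftrightarrow> Q 0 \<or> (\<exists>m<n. Q (Suc m))" for Q by (metis less_Suc_eq_0_disj not_less_eq)
  show ?case
  proof (cases "?S \<le> ereal T")
    case True
    show ?thesis
      unfolding ex observed_skeleton_0 observed_skeleton_Suc advance_Some[OF True] Suc[symmetric]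
      using True by (auto simp: first_step_def Let_def Suc)
  next
    case False
    then show ?thesis
      unfolding ex observed_skeleton_0 observed_skeleton_Suc by (auto simp: first_step_def Let_def)
  qed
qed simp

end

section \<open>Properties of a single path\<close>

lemma pdmp_path_eq:
  assumes "0 \<le> t"
  shows "pdmp_path \<phi> l lam G w \<eta> t =
     (if (SUP k. jump_time \<phi> l lam G w \<eta> k) \<le> ereal t then None
      else map_option (\<lambda>(s, x). \<phi> s t x) (skeleton \<phi> l lam G w \<eta> (LEAST k. ereal t < jump_time \<phi> l lam G w \<eta> (Suc k))))"
  using assms unfolding pdmp_path_def by simp

locale pdmp_path_point = pdmp_system +
  fixes w :: 'a and \<eta> :: "nat \<Rightarrow> (nat \<Rightarrow> real) \<times> real"
  assumes w: "w \<in> M" and \<eta>: "\<eta> \<in> space (noise l)"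
begin

abbreviation "sk \<equiv> skeleton \<phi> l lam G w \<eta>"
abbreviation "jt \<equiv> jump_time \<phi> l lam G w \<eta>"
abbreviation "pth \<equiv> pdmp_path \<phi> l lam G w \<eta>"

lemma sk_Suc: "sk (Suc k) = adv (\<eta> (Suc k)) (sk k)"
  by (simp add: skeleton_eq_skeleton_from)

lemma jt_0: "jt 0 = 0"
  by (simp add: jump_time_eq_time_of)

lemma jt_Suc_ge: "jt k \<le> jt (Suc k)"
  unfolding jump_time_eq_time_of sk_Suc by (rule time_of_advance_ge)

lemma jt_mono: "j \<le> k \<Longrightarrow> jt j \<le> jt k"
  by (rule lift_Suc_mono_le[of jt]) (rule jt_Suc_ge)

lemma jt_finite_Some:
  assumes "jt k < \<infinity>" obtains s x where "sk k = Some (s, x)" "jt k = ereal s"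
  using assms unfolding jump_time_eq_time_of by (cases "sk k") auto

lemma sk_in_M: "sk k = Some (s, x) \<Longrightarrow> 0 \<le> s \<and> x \<in> M"
proof (induction k arbitrary: s x)
  case 0
  then show ?case using w by simp
next
  case (Suc k)
  then obtain s' x' where k: "sk k = Some (s', x')" by (cases "sk k") (auto simp: sk_Suc)
  note IH = Suc.IH[OF k]
  let ?S = "first_ring l s' (traj_rate s' x') (fst (\<eta> (Suc k)))"
  have "time_of (sk (Suc k)) = ?S" unfolding sk_Suc k by (rule time_of_advance)
  then have S: "?S = ereal s" using Suc.prems by simp
  have s: "s' \<le> s" using first_ring_ge[of s' "traj_rate s' x'" "fst (\<eta> (Suc k))"] unfolding S by simp
  have "sk (Suc k) = Some (s, G (first_ringer l s' (traj_rate s' x') (fst (\<eta> (Suc k)))) s (\<phi> s' s x') (snd (\<eta> (Suc k))))"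
    unfolding sk_Suc k using advance_Some[of s' x' "\<eta> (Suc k)" s] S by simp
  then have x: "x = G (first_ringer l s' (traj_rate s' x') (fst (\<eta> (Suc k)))) s (\<phi> s' s x') (snd (\<eta> (Suc k)))"
    using Suc.prems by simp
  have "\<eta> (Suc k) \<in> space (round_noise l)" using \<eta> unfolding noise_eq space_PiM by auto
  then have u: "snd (\<eta> (Suc k)) \<in> {0..1}" by (auto simp: space_pair_measure)
  have "first_ringer l s' (traj_rate s' x') (fst (\<eta> (Suc k))) \<in> {1..l}"
    by (rule first_ringer(1)) (use S in simp)
  then show ?case unfolding x using IH s u by (intro conjI G_in_M flow_in_M) auto
qed

lemma path_at:
  assumes k: "sk k = Some (s, x)" and t: "s \<le> t" "ereal t < jt (Suc k)"
  shows "pth t = Some (\<phi> s t x)"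
proof -
  have t0: "0 \<le> t" using sk_in_M[OF k] t by simp
  have "jt k = ereal s" unfolding jump_time_eq_time_of k by simp
  then have "\<not> ereal t < jt (Suc j)" if "j < k" for j
    using jt_mono[of "Suc j" k] that t(1) by (simp add: not_less) (metis ereal_less_eq(3) order_trans)
  then have "(LEAST k. ereal t < jt (Suc k)) = k"
    using t(2) by (intro Least_equality) (auto simp: not_less[symmetric])
  moreover have "\<not> (SUP k. jt k) \<le> ereal t"
    using t(2) SUP_upper[of "Suc k" UNIV jt] by (meson UNIV_I leD less_le_trans)
  ultimately show ?thesis unfolding pdmp_path_eq[OF t0] using k by simp
qed

lemma path_cases:
  assumes t: "0 \<le> t" "ereal t < jt (Suc m)"
  obtains k s x where "k \<le> m" "sk k = Some (s, x)" "s \<le> t" "ereal t < jt (Suc k)"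
    "\<And>j. j < k \<Longrightarrow> jt (Suc j) \<le> ereal t"
proof -
  define k where "k = (LEAST k. ereal t < jt (Suc k))"
  have k: "ereal t < jt (Suc k)" "k \<le> m"
    unfolding k_def using t(2) by (auto intro: LeastI[of "\<lambda>k. ereal t < jt (Suc k)"] Least_le)
  have less: "jt (Suc j) \<le> ereal t" if "j < k" for j
    using not_less_Least[of j "\<lambda>k. ereal t < jt (Suc k)"] that unfolding k_def by (simp add: not_less)
  have "jt k \<le> ereal t"
    using less[of "k - 1"] jt_0 t(1) by (cases k) auto
  then have "jt k < \<infinity>" by auto
  then obtain s x where "sk k = Some (s, x)" "jt k = ereal s" by (rule jt_finite_Some)
  then show thesis using that[of k s x] k less \<open>jt k \<le> ereal t\<close> by simp
qed

text \<open>The successor fits the index in \<open>pdmp_path\<close>, which looks for the first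
  round whose next jump comes after \<open>t\<close>.\<close>

lemma less_explosion_iff: "0 \<le> t \<Longrightarrow> ereal t < (SUP k. jt k) \<longleftrightarrow> (\<exists>m. ereal t < jt (Suc m))"
proof
  assume t: "0 \<le> t" "ereal t < (SUP k. jt k)"
  then obtain k where "ereal t < jt k" unfolding less_SUP_iff by blast
  then show "\<exists>m. ereal t < jt (Suc m)" using jt_Suc_ge less_le_trans by blast
next
  assume "\<exists>m. ereal t < jt (Suc m)"
  then show "ereal t < (SUP k. jt k)" unfolding less_SUP_iff by blast
qed

lemma path_None_iff: "0 \<le> t \<Longrightarrow> pth t = None \<longleftrightarrow> (SUP k. jt k) \<le> ereal t"
proof -
  assume t: "0 \<le> t"
  show ?thesis
  proof (cases "ereal t < (SUP k. jt k)")
    case True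
    then obtain m where "ereal t < jt (Suc m)" using less_explosion_iff[OF t] by blast
    from path_cases[OF t this] obtain k s x where "sk k = Some (s, x)" "s \<le> t" "ereal t < jt (Suc k)" by metis
    from path_at[OF this] True show ?thesis by simp
  next
    case False
    then show ?thesis unfolding pdmp_path_eq[OF t] by (simp add: not_less)
  qed
qed

lemma flow_stereo_continuous:
  assumes "0 \<le> s" "x \<in> M"
  shows "continuous_on {s..} (\<lambda>r. stereo (Some (\<phi> s r x)))"
  by (rule continuous_on_compose2[OF continuous_on_stereo_Some[of UNIV] flow_continuous[OF assms]]) auto

text \<open>Before the explosion the path runs along a flow line on each interval between jumps,
  which gives right continuity and, at the right end of an interval, the left limit. From the
  explosion on it is constant.\<close>

lemma path_regular: "regular_path M pth"
  unfolding regular_path_def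
proof (intro conjI allI impI)
  have val: "pth t \<in> topspace (with_cemetery M)" if t: "0 \<le> t" for t
  proof (cases "ereal t < (SUP k. jt k)")
    case True
    then obtain m where "ereal t < jt (Suc m)" using less_explosion_iff[OF t] by blast
    from path_cases[OF t this] obtain k s x where k: "sk k = Some (s, x)" "s \<le> t" "ereal t < jt (Suc k)" by metis
    have "\<phi> s t x \<in> M" using sk_in_M[OF k(1)] k(2) by (intro flow_in_M) auto
    then show ?thesis using path_at[OF k] by simp
  next
    case False
    then show ?thesis using path_None_iff[OF t] by (simp add: not_less)
  qed
  show "pth \<in> {0..} \<rightarrow>\<^sub>E topspace (with_cemetery M)"
  proof (rule PiE_I)
    show "pth t \<in> topspace (with_cemetery M)" if "t \<in> {0..}" for t
      by (rule val) (use that in simp)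
    show "pth t = undefined" if "t \<notin> {0..}" for t
      using that unfolding pdmp_path_def by simp
  qed
  show "((\<lambda>s. stereo (pth s)) \<longlongrightarrow> stereo (pth t)) (at_right t)" if t: "0 \<le> t" for t
  proof (cases "ereal t < (SUP k. jt k)")
    case True
    then obtain m where "ereal t < jt (Suc m)" using less_explosion_iff[OF t] by blast
    from path_cases[OF t this] obtain k s x where k: "sk k = Some (s, x)" "s \<le> t" "ereal t < jt (Suc k)" by metis
    obtain b where b: "t < b" "ereal b < jt (Suc k)"
      using ereal_dense2[OF k(3)] by auto
    have "((\<lambda>r. stereo (Some (\<phi> s r x))) \<longlongrightarrow> stereo (Some (\<phi> s t x))) (at t within {s..})"
      using flow_stereo_continuous[of s x] sk_in_M[OF k(1)] k(2) by (simp add: continuous_on_def)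
    then have "((\<lambda>r. stereo (Some (\<phi> s r x))) \<longlongrightarrow> stereo (Some (\<phi> s t x))) (at_right t)"
      by (rule tendsto_within_subset) (use k(2) in auto)
    moreover have "\<forall>\<^sub>F r in at_right t. stereo (Some (\<phi> s r x)) = stereo (pth r)"
      unfolding eventually_at_right_field
    proof (intro exI[of _ b] conjI allI impI b)
      fix r assume r: "t < r" "r < b"
      have "ereal r < jt (Suc k)" using b(2) r(2) by (meson ereal_less_eq(3) le_less_trans less_imp_le)
      then show "stereo (Some (\<phi> s r x)) = stereo (pth r)" using path_at[OF k(1)] k(2) r(1) by simp
    qed
    ultimately show ?thesis unfolding path_at[OF k] by (rule Lim_transform_eventually)
  next
    case False
    have "pth r = None" if "t \<le> r" for r
      using path_None_iff[of r] False t that by (simp add: not_less) (meson ereal_less_eq(3) order_trans)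
    then have "\<forall>\<^sub>F r in at_right t. stereo (pth r) = stereo (pth t)"
      unfolding eventually_at_right_field by (intro exI[of _ "t + 1"]) auto
    then show ?thesis by (rule tendsto_eventually)
  qed
  show "\<exists>\<zeta>::ereal. (\<forall>t\<ge>0. (pth t = None) = (\<zeta> \<le> ereal t)) \<and>
        (\<forall>t>0. ereal t \<noteq> \<zeta> \<longrightarrow> (\<exists>z. ((\<lambda>s. stereo (pth s)) \<longlongrightarrow> z) (at_left t)))"
  proof (intro exI[of _ "SUP k. jt k"] conjI allI impI)
    show "(pth t = None) = ((SUP k. jt k) \<le> ereal t)" if "0 \<le> t" for t by (rule path_None_iff[OF that])
    fix t :: real assume t: "0 < t" "ereal t \<noteq> (SUP k. jt k)"
    show "\<exists>z. ((\<lambda>s. stereo (pth s)) \<longlongrightarrow> z) (at_left t)"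
    proof (cases "ereal t < (SUP k. jt k)")
      case True
      then obtain m where m: "ereal t < jt (Suc m)" using less_explosion_iff[of t] t(1) by auto
      \<comment> \<open>The weak inequality selects the interval ending at \<open>t\<close> when
        \<open>t\<close> is a jump time: left limits concern the flow line before the jump.\<close>
      define k where "k = (LEAST k. ereal t \<le> jt (Suc k))"
      have k: "ereal t \<le> jt (Suc k)"
        unfolding k_def using m by (intro LeastI[of "\<lambda>k. ereal t \<le> jt (Suc k)" m]) simp
      have jk: "jt k < ereal t"
      proof (cases k)
        case 0 then show ?thesis using jt_0 t(1) by simp
      next
        case (Suc j)
        then have "\<not> ereal t \<le> jt (Suc j)" using not_less_Least[of j "\<lambda>k. ereal t \<le> jt (Suc k)"] unfolding k_def by simp
        then show ?thesis using Suc by simp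
      qed
      then have "jt k < \<infinity>" by auto
      then obtain s x where sx: "sk k = Some (s, x)" "jt k = ereal s" by (rule jt_finite_Some)
      then have st: "s < t" using jk by simp
      have "((\<lambda>r. stereo (Some (\<phi> s r x))) \<longlongrightarrow> stereo (Some (\<phi> s t x))) (at t within {s..})"
        using flow_stereo_continuous[of s x] sk_in_M[OF sx(1)] st by (simp add: continuous_on_def)
      then have "((\<lambda>r. stereo (Some (\<phi> s r x))) \<longlongrightarrow> stereo (Some (\<phi> s t x))) (at t within {s..t})"
        by (rule tendsto_within_subset) auto
      then have "((\<lambda>r. stereo (Some (\<phi> s r x))) \<longlongrightarrow> stereo (Some (\<phi> s t x))) (at_left t)"
        using at_within_Icc_at_left[OF st] by simp
      moreover have "\<forall>\<^sub>F r in at_left t. stereo (Some (\<phi> s r x)) = stereo (pth r)"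
        unfolding eventually_at_left_field
      proof (intro exI[of _ s] conjI allI impI st)
        fix r assume r: "s < r" "r < t"
        have "ereal r < jt (Suc k)" using k r(2) by (meson ereal_less_eq(3) less_ereal.simps(1) less_le_trans)
        then show "stereo (Some (\<phi> s r x)) = stereo (pth r)" using path_at[OF sx(1)] r(1) by simp
      qed
      ultimately show ?thesis by (intro exI) (rule Lim_transform_eventually)
    next
      case False
      then have "(SUP k. jt k) < ereal t" using t(2) by auto
      then obtain a where a: "(SUP k. jt k) < ereal a" "a < t"
        using ereal_dense2[OF \<open>(SUP k. jt k) < ereal t\<close>] by auto
      have "pth r = None" if "a < r" "0 \<le> r" for r
      proof -
        have "(SUP k. jt k) \<le> ereal r" using a(1) that(1) by (meson ereal_less_eq(3) less_imp_le order_trans)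
        then show ?thesis using path_None_iff[OF that(2)] by simp
      qed
      then have "\<forall>\<^sub>F r in at_left t. stereo (pth r) = 0"
        unfolding eventually_at_left_field using a(2) t(1)
        by (intro exI[of _ "max a 0"]) (auto simp: stereo_simps)
      then show ?thesis by (intro exI[of _ 0] tendsto_eventually)
    qed
  qed
qed

text \<open>The recursion on jumps and the path constructed from the skeleton describe the same
  event once the horizon is the last observation time.\<close>

lemma path_in_cylinder_iff:
  assumes I: "finite I" "I \<noteq> {}" "I \<subseteq> {0..}"
  shows "pth \<in> cylinder I A \<longleftrightarrow> observed_path I A (Max I) 0 w \<eta>"
proof
  let ?T = "Max I"
  have TI: "?T \<in> I" and T: "\<And>t. t \<in> I \<Longrightarrow> t \<le> ?T" using I by auto
  have sk: "skel (Some (0, w)) \<eta> k = sk k" for k by (simp add: skeleton_eq_skeleton_from)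
  have jt: "time_of (sk k) = jt k" for k by (simp add: jump_time_eq_time_of)
  note skel_iff = observed_skeleton_def[of I A ?T _ "Some (0, w)" \<eta>, unfolded sk jt]
  show "pth \<in> cylinder I A" if ob: "observed_path I A ?T 0 w \<eta>"
    unfolding cylinder_def
  proof (intro CollectI ballI)
    fix t assume t: "t \<in> I"
    then have t0: "0 \<le> t" using I by auto
    obtain m where "observed_skeleton I A ?T m (Some (0, w)) \<eta>"
      using ob unfolding observed_path_def observed_within_iff by blast
    then have m: "ereal ?T < jt (Suc m)"
      "\<And>k s x. k \<le> m \<Longrightarrow> sk k = Some (s, x) \<Longrightarrow> observed I A s x (jt (Suc k))"
      unfolding skel_iff by auto
    have "ereal t < jt (Suc m)" using T[OF t] m(1) by (meson ereal_less_eq(3) le_less_trans)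
    from path_cases[OF t0 this] obtain k s x where
      k: "k \<le> m" "sk k = Some (s, x)" "s \<le> t" "ereal t < jt (Suc k)" by metis
    then have "\<phi> s t x \<in> A t" using m(2)[OF k(1,2)] t unfolding observed_def by blast
    then show "pth t \<in> Some ` A t" using path_at[OF k(2-4)] by simp
  qed
  show "observed_path I A ?T 0 w \<eta>" if c: "pth \<in> cylinder I A"
  proof -
    have T0: "0 \<le> ?T" using subsetD[OF I(3) TI] by (simp del: Max_ge_iff)
    \<comment> \<open>Being alive at the last observation time is what bounds the number of jumps up
      to it, so that some finite \<open>m\<close> can be found.\<close>
    have "pth ?T \<noteq> None" using c TI unfolding cylinder_def by auto
    then have "ereal ?T < (SUP k. jt k)" using path_None_iff[OF T0] by (simp add: not_le)
    then obtain m' where "ereal ?T < jt (Suc m')" using less_explosion_iff[OF T0] by blast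
    then obtain m where m: "ereal ?T < jt (Suc m)" "\<And>j. j < m \<Longrightarrow> jt (Suc j) \<le> ereal ?T"
      using path_cases[OF T0] by metis
    have "observed I A s x (jt (Suc k))" if k: "sk k = Some (s, x)" for k s x
      unfolding observed_def
    proof (intro ballI impI)
      fix t assume t: "t \<in> I" "s \<le> t \<and> ereal t < jt (Suc k)"
      then have "pth t = Some (\<phi> s t x)" using path_at[OF k] by blast
      then show "\<phi> s t x \<in> A t" using c t(1) unfolding cylinder_def by auto
    qed
    then have "observed_skeleton I A ?T m (Some (0, w)) \<eta>" unfolding skel_iff using m by blast
    then show ?thesis unfolding observed_path_def observed_within_iff by blast
  qed
qed

end

section \<open>The law of the process\<close>

lemma space_borel_sigma: "space (borel_sigma X) = topspace X"
  unfolding borel_sigma_def by (rule space_measure_of) (auto dest: openin_subset)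

context pdmp_system begin

abbreviation process_law :: "'a measure \<Rightarrow> (real \<Rightarrow> 'a option) measure" where
  "process_law \<mu>\<^sub>0 \<equiv> distr (\<mu>\<^sub>0 \<Otimes>\<^sub>M noise l) path_sigma (\<lambda>(w, \<eta>). pdmp_path \<phi> l lam G w \<eta>)"

lemma pdmp_path_pointI: "w \<in> M \<Longrightarrow> \<eta> \<in> space (noise l) \<Longrightarrow> pdmp_path_point M \<phi> l lam G w \<eta>"
  by unfold_locales

text \<open>Preimages of cylinders are observation events, so the measurability of the process is
  inherited from the recursion over jumps.\<close>

lemma cylinder_vimage:
  assumes \<mu>: "sets \<mu>\<^sub>0 = sets (borel_on M)"
    and I: "finite I" "I \<noteq> {}" "I \<subseteq> {0..}" and A: "\<And>t. t \<in> I \<Longrightarrow> A t \<in> sets borel"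
  shows "(\<lambda>(w, \<eta>). pdmp_path \<phi> l lam G w \<eta>) -` cylinder I A \<inter> space (\<mu>\<^sub>0 \<Otimes>\<^sub>M noise l) =
      {p \<in> space (\<mu>\<^sub>0 \<Otimes>\<^sub>M noise l). observed_path I A (Max I) 0 (fst p) (snd p)}"
    and "{p \<in> space (\<mu>\<^sub>0 \<Otimes>\<^sub>M noise l). observed_path I A (Max I) 0 (fst p) (snd p)} \<in> sets (\<mu>\<^sub>0 \<Otimes>\<^sub>M noise l)"
proof -
  have sp: "space \<mu>\<^sub>0 = M" using sets_eq_imp_space_eq[OF \<mu>] by simp
  show "(\<lambda>(w, \<eta>). pdmp_path \<phi> l lam G w \<eta>) -` cylinder I A \<inter> space (\<mu>\<^sub>0 \<Otimes>\<^sub>M noise l) =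
      {p \<in> space (\<mu>\<^sub>0 \<Otimes>\<^sub>M noise l). observed_path I A (Max I) 0 (fst p) (snd p)}"
    using pdmp_path_point.path_in_cylinder_iff[OF pdmp_path_pointI I, of _ _ A] by (auto simp: space_pair_measure sp)
  have "(\<lambda>p. ((0, fst p), snd p)) \<in> borel_on M \<Otimes>\<^sub>M noise l \<rightarrow>\<^sub>M state_space M \<Otimes>\<^sub>M noise l"
    by (intro measurable_Pair measurable_half_line measurable_fst measurable_snd) auto
  moreover have "sets (\<mu>\<^sub>0 \<Otimes>\<^sub>M noise l) = sets (borel_on M \<Otimes>\<^sub>M noise l)"
    by (intro sets_pair_measure_cong \<mu> refl)
  ultimately have m: "(\<lambda>p. ((0, fst p), snd p)) \<in> \<mu>\<^sub>0 \<Otimes>\<^sub>M noise l \<rightarrow>\<^sub>M state_space M \<Otimes>\<^sub>M noise l"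
    using measurable_cong_sets by blast
  have "Measurable.pred (state_space M \<Otimes>\<^sub>M noise l) (\<lambda>((s, x), \<eta>). observed_path I A (Max I) s x \<eta>)"
    by (rule observed_path_measurable[OF I(1,3)]) (rule A)
  from measurable_compose[OF m this]
  show "{p \<in> space (\<mu>\<^sub>0 \<Otimes>\<^sub>M noise l). observed_path I A (Max I) 0 (fst p) (snd p)} \<in> sets (\<mu>\<^sub>0 \<Otimes>\<^sub>M noise l)"
    by (simp add: pred_def)
qed

lemma process_measurable:
  assumes \<mu>: "sets \<mu>\<^sub>0 = sets (borel_on M)"
  shows "(\<lambda>(w, \<eta>). pdmp_path \<phi> l lam G w \<eta>) \<in> \<mu>\<^sub>0 \<Otimes>\<^sub>M noise l \<rightarrow>\<^sub>M path_sigma"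
  unfolding path_sigma_def
proof (rule measurable_measure_of)
  fix C :: "(real \<Rightarrow> 'a option) set" assume "C \<in> cylinders"
  then obtain I A where C: "C = cylinder I A" "finite I" "I \<subseteq> {0..}" "\<And>t. t \<in> I \<Longrightarrow> A t \<in> sets borel"
    unfolding cylinders_def by blast
  show "(\<lambda>(w, \<eta>). pdmp_path \<phi> l lam G w \<eta>) -` C \<inter> space (\<mu>\<^sub>0 \<Otimes>\<^sub>M noise l) \<in> sets (\<mu>\<^sub>0 \<Otimes>\<^sub>M noise l)"
  proof (cases "I = {}")
    case True
    then have "C = UNIV" unfolding C(1) cylinder_def by auto
    then show ?thesis by simp
  next
    case False
    from cylinder_vimage[OF \<mu> C(2) this C(3,4)] show ?thesis unfolding C(1) by simp
  qed
qed auto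

lemma emeasure_process_law_cylinder:
  assumes \<mu>: "sets \<mu>\<^sub>0 = sets (borel_on M)"
    and I: "finite I" "I \<noteq> {}" "I \<subseteq> {0..}" and A: "\<And>t. t \<in> I \<Longrightarrow> A t \<in> sets borel"
  shows "emeasure (process_law \<mu>\<^sub>0) (cylinder I A) = (\<integral>\<^sup>+ w. noise_prob l (observed_path I A (Max I)) 0 w \<partial>\<mu>\<^sub>0)"
proof -
  interpret N: prob_space "noise l" by (rule prob_space_noise)
  let ?E = "{p \<in> space (\<mu>\<^sub>0 \<Otimes>\<^sub>M noise l). observed_path I A (Max I) 0 (fst p) (snd p)}"
  have C: "cylinder I A \<in> sets path_sigma"
    unfolding sets_path_sigma cylinders_def using I A by (intro sigma_sets.Basic) blast
  note vim = cylinder_vimage[OF \<mu> I A]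
  have "emeasure (process_law \<mu>\<^sub>0) (cylinder I A) = emeasure (\<mu>\<^sub>0 \<Otimes>\<^sub>M noise l) ?E"
    unfolding emeasure_distr[OF process_measurable[OF \<mu>] C] by (subst vim(1)) simp_all
  also have "\<dots> = (\<integral>\<^sup>+ w. (\<integral>\<^sup>+ \<eta>. indicator ?E (w, \<eta>) \<partial>noise l) \<partial>\<mu>\<^sub>0)"
    by (rule N.emeasure_pair_measure[OF vim(2)])
  also have "\<dots> = (\<integral>\<^sup>+ w. noise_prob l (observed_path I A (Max I)) 0 w \<partial>\<mu>\<^sub>0)"
    unfolding noise_prob_def
    by (intro nn_integral_cong) (auto simp: space_pair_measure indicator_def)
  finally show ?thesis .
qed

text \<open>On the sample space all paths are regular, so \<open>U\<close> and \<open>A\<close> have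
  the same preimage. The same matching applied to every Skorokhod event shows that the modified
  process is measurable, on which the evaluation of \<open>distr\<close> rests.\<close>

lemma emeasure_PDMP:
  assumes \<mu>: "sets \<mu>\<^sub>0 = sets (borel_on M)"
    and U: "U \<in> sets (borel_sigma (skorokhod_topology (with_cemetery M)))"
    and A: "A \<in> sets path_sigma" "\<And>X. regular_path M X \<Longrightarrow> cadlag_version M X \<in> U \<longleftrightarrow> X \<in> A"
  shows "emeasure (PDMP M \<phi> l lam G \<mu>\<^sub>0) U = emeasure (process_law \<mu>\<^sub>0) A"
proof -
  let ?Sk = "borel_sigma (skorokhod_topology (with_cemetery M))" and ?P = "\<mu>\<^sub>0 \<Otimes>\<^sub>M noise l"
  let ?X = "\<lambda>(w, \<eta>). pdmp_path \<phi> l lam G w \<eta>"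
  let ?F = "\<lambda>p. cadlag_version M (?X p)"
  have sp: "space \<mu>\<^sub>0 = M" using sets_eq_imp_space_eq[OF \<mu>] by simp
  have reg: "regular_path M (?X p)" if "p \<in> space ?P" for p
    using that pdmp_path_point.path_regular[OF pdmp_path_pointI] by (auto simp: space_pair_measure sp)
  have PDMP: "PDMP M \<phi> l lam G \<mu>\<^sub>0 = distr ?P ?Sk ?F"
    unfolding PDMP_def cadlag_version_def by (rule arg_cong[where f = "distr _ _"]) (auto simp: Let_def)
  have vim: "?F -` V \<inter> space ?P = ?X -` B \<inter> space ?P"
    if "\<And>X. regular_path M X \<Longrightarrow> cadlag_version M X \<in> V \<longleftrightarrow> X \<in> B" for V B
    using that[OF reg] by blast
  have F: "?F \<in> ?P \<rightarrow>\<^sub>M ?Sk"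
  proof (rule measurableI)
    show "?F p \<in> space ?Sk" for p
      unfolding space_borel_sigma topspace_skorokhod_topology by (rule cadlag_version_cadlag)
    fix V assume "V \<in> sets ?Sk"
    from skorokhod_event_in_path_sigma[OF closed_M this] obtain B where
      B: "B \<in> sets path_sigma" "\<And>X. regular_path M X \<Longrightarrow> cadlag_version M X \<in> V \<longleftrightarrow> X \<in> B" by blast
    have "?F -` V \<inter> space ?P = ?X -` B \<inter> space ?P" by (rule vim) (rule B(2))
    then show "?F -` V \<inter> space ?P \<in> sets ?P"
      using measurable_sets[OF process_measurable[OF \<mu>] B(1)] by simp
  qed
  have "emeasure (PDMP M \<phi> l lam G \<mu>\<^sub>0) U = emeasure ?P (?F -` U \<inter> space ?P)"
    unfolding PDMP by (rule emeasure_distr[OF F U])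
  also have "?F -` U \<inter> space ?P = ?X -` A \<inter> space ?P" by (rule vim) (rule A(2))
  also have "emeasure ?P \<dots> = emeasure (process_law \<mu>\<^sub>0) A"
    by (rule emeasure_distr[OF process_measurable[OF \<mu>] A(1), symmetric])
  finally show ?thesis .
qed

end

lemma process_law_eq:
  assumes S1: "pdmp_system M \<phi> l\<^sub>1 lam\<^sub>1 G\<^sub>1" and S2: "pdmp_system M \<phi> l\<^sub>2 lam\<^sub>2 G\<^sub>2"
    and gen: "\<And>u t x. (\<lambda>(s, x). u s x) \<in> borel_measurable (state_space M) \<Longrightarrow> (\<And>r y. u r y \<le> (1::ennreal)) \<Longrightarrow>
       0 \<le> t \<Longrightarrow> x \<in> M \<Longrightarrow>
       pdmp_system.jump_intensity l\<^sub>1 lam\<^sub>1 G\<^sub>1 u t x - (\<Sum>j=1..l\<^sub>1. lam\<^sub>1 j t x) * enn2real (u t x) =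
       pdmp_system.jump_intensity l\<^sub>2 lam\<^sub>2 G\<^sub>2 u t x - (\<Sum>j=1..l\<^sub>2. lam\<^sub>2 j t x) * enn2real (u t x)"
    and \<mu>: "prob_space \<mu>\<^sub>0" "sets \<mu>\<^sub>0 = sets (borel_on M)"
  shows "distr (\<mu>\<^sub>0 \<Otimes>\<^sub>M noise l\<^sub>1) path_sigma (\<lambda>(w, \<eta>). pdmp_path \<phi> l\<^sub>1 lam\<^sub>1 G\<^sub>1 w \<eta>) =
     distr (\<mu>\<^sub>0 \<Otimes>\<^sub>M noise l\<^sub>2) path_sigma (\<lambda>(w, \<eta>). pdmp_path \<phi> l\<^sub>2 lam\<^sub>2 G\<^sub>2 w \<eta>)"
proof -
  interpret A: pdmp_system M \<phi> l\<^sub>1 lam\<^sub>1 G\<^sub>1 by (rule S1)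
  interpret B: pdmp_system M \<phi> l\<^sub>2 lam\<^sub>2 G\<^sub>2 by (rule S2)
  have sp: "space \<mu>\<^sub>0 = M" using sets_eq_imp_space_eq[OF \<mu>(2)] by simp
  have PA: "prob_space (A.process_law \<mu>\<^sub>0)"
    by (intro prob_space.prob_space_distr prob_space_pair \<mu>(1) prob_space_noise A.process_measurable \<mu>(2))
  have PB: "prob_space (B.process_law \<mu>\<^sub>0)"
    by (intro prob_space.prob_space_distr prob_space_pair \<mu>(1) prob_space_noise B.process_measurable \<mu>(2))
  have U: "emeasure (A.process_law \<mu>\<^sub>0) UNIV = 1" "emeasure (B.process_law \<mu>\<^sub>0) UNIV = 1"
    using prob_space.emeasure_space_1[OF PA] prob_space.emeasure_space_1[OF PB] by simp_all
  have UC: "UNIV \<in> (cylinders :: (real \<Rightarrow> 'a option) set set)"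
  proof -
    have "UNIV = cylinder {} (\<lambda>_. {} :: 'a set)" unfolding cylinder_def by simp
    then show ?thesis unfolding cylinders_def by blast
  qed
  show ?thesis
  proof (rule measure_eqI_generator_eq[OF Int_stable_cylinders, where \<Omega> = UNIV and A = "\<lambda>_. UNIV"])
    fix C :: "(real \<Rightarrow> 'a option) set" assume "C \<in> cylinders"
    then obtain I E where C: "C = cylinder I E" "finite I" "I \<subseteq> {0..}" "\<And>t. t \<in> I \<Longrightarrow> E t \<in> sets borel"
      unfolding cylinders_def by blast
    show "emeasure (A.process_law \<mu>\<^sub>0) C = emeasure (B.process_law \<mu>\<^sub>0) C"
    proof (cases "I = {}")
      case True
      then have "C = UNIV" unfolding C(1) cylinder_def by auto
      then show ?thesis using U by simp
    next
      case False
      \<comment> \<open>The horizon of the renewal equation is the last observation time, as in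
        \<open>path_in_cylinder_iff\<close>.\<close>
      have I: "I \<subseteq> {0..Max I}" using C(2,3) by auto
      have M0: "0 \<le> Max I" using False I by fastforce
      have le1: "noise_prob l\<^sub>2 (B.observed_path I E (Max I)) 0 w \<le> noise_prob l\<^sub>1 (A.observed_path I E (Max I)) 0 w"
        if "w \<in> M" for w
        by (rule observed_path_prob_le[OF S1 S2 _ C(2) I _ order_refl M0 that])
          (rule gen C(4); assumption)+
      have le2: "noise_prob l\<^sub>1 (A.observed_path I E (Max I)) 0 w \<le> noise_prob l\<^sub>2 (B.observed_path I E (Max I)) 0 w"
        if "w \<in> M" for w
        by (rule observed_path_prob_le[OF S2 S1 _ C(2) I _ order_refl M0 that])
          (rule gen[symmetric] C(4); assumption)+
      have "(\<integral>\<^sup>+ w. noise_prob l\<^sub>1 (A.observed_path I E (Max I)) 0 w \<partial>\<mu>\<^sub>0) =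
          (\<integral>\<^sup>+ w. noise_prob l\<^sub>2 (B.observed_path I E (Max I)) 0 w \<partial>\<mu>\<^sub>0)"
        by (intro nn_integral_cong antisym le1 le2) (simp_all add: sp)
      moreover have "emeasure (A.process_law \<mu>\<^sub>0) C = (\<integral>\<^sup>+ w. noise_prob l\<^sub>1 (A.observed_path I E (Max I)) 0 w \<partial>\<mu>\<^sub>0)"
        unfolding C(1) by (rule A.emeasure_process_law_cylinder[OF \<mu>(2) C(2) False C(3)]) (rule C(4))
      moreover have "emeasure (B.process_law \<mu>\<^sub>0) C = (\<integral>\<^sup>+ w. noise_prob l\<^sub>2 (B.observed_path I E (Max I)) 0 w \<partial>\<mu>\<^sub>0)"
        unfolding C(1) by (rule B.emeasure_process_law_cylinder[OF \<mu>(2) C(2) False C(3)]) (rule C(4))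
      ultimately show ?thesis by simp
    qed
  qed (use UC U in \<open>auto simp: sets_path_sigma\<close>)
qed

lemma pdmp_systemI:
  assumes "smooth_closed_submanifold M" "differential_flow M \<phi>"
    and "\<And>i. i \<in> {1..l} \<Longrightarrow> jump_mechanism M (lam i) (Q i)"
    and "\<And>i. i \<in> {1..l} \<Longrightarrow> represents_kernel M (G i) (Q i)"
  shows "pdmp_system M \<phi> l lam G"
proof
  show "closed M" using assms(1) unfolding smooth_closed_submanifold_def by blast
  show "differential_flow M \<phi>" by (rule assms(2))
  fix j assume j: "j \<in> {1..l}"
  note J = assms(3)[OF j, unfolded jump_mechanism_def]
  show "(\<lambda>(t, x). lam j t x) \<in> borel_measurable (state_space M)" by (rule J[THEN conjunct1])
  show "0 \<le> lam j t x" if "0 \<le> t" "x \<in> M" for t x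
    using J[THEN conjunct2, THEN conjunct1] that by blast
  show "bounded ((\<lambda>(t, x). lam j t x) ` K)" if "compact K" "K \<subseteq> {0..} \<times> M" for K
    using J[THEN conjunct2, THEN conjunct2, THEN conjunct1] that by blast
  show "(\<lambda>(t, x, u). G j t x u) \<in> half_line \<Otimes>\<^sub>M borel_on M \<Otimes>\<^sub>M borel_on {0..1} \<rightarrow>\<^sub>M borel_on M"
    using assms(4)[OF j] unfolding represents_kernel_def by (rule conjunct1)
qed

theorem theorem5:
  fixes M :: "'a::euclidean_space set"
    and l\<^sub>1 l\<^sub>2 :: nat
    and lam\<^sub>1 lam\<^sub>2 :: "nat \<Rightarrow> real \<Rightarrow> 'a \<Rightarrow> real"
    and Q\<^sub>1 Q\<^sub>2 :: "nat \<Rightarrow> real \<Rightarrow> 'a \<Rightarrow> 'a measure"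
    and G\<^sub>1 G\<^sub>2 :: "nat \<Rightarrow> real \<Rightarrow> 'a \<Rightarrow> real \<Rightarrow> 'a"
    and \<phi> :: "real \<Rightarrow> real \<Rightarrow> 'a \<Rightarrow> 'a"
    and \<mu>\<^sub>0 :: "'a measure"
  assumes "smooth_closed_submanifold M"
    and "\<And>i. i \<in> {1..l\<^sub>1} \<Longrightarrow> jump_mechanism M (lam\<^sub>1 i) (Q\<^sub>1 i)"
    and "\<And>i. i \<in> {1..l\<^sub>2} \<Longrightarrow> jump_mechanism M (lam\<^sub>2 i) (Q\<^sub>2 i)"
    and "\<And>t x A. t \<ge> 0 \<Longrightarrow> x \<in> M \<Longrightarrow> A \<in> sets (borel_on M) \<Longrightarrow>
           (\<Sum>i=1..l\<^sub>1. lam\<^sub>1 i t x * (measure (Q\<^sub>1 i t x) A - indicator A x)) =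
           (\<Sum>i=1..l\<^sub>2. lam\<^sub>2 i t x * (measure (Q\<^sub>2 i t x) A - indicator A x))"
    and "differential_flow M \<phi>"
    and "\<mu>\<^sub>0 \<in> space (prob_algebra (borel_on M))"
    and "\<And>i. i \<in> {1..l\<^sub>1} \<Longrightarrow> represents_kernel M (G\<^sub>1 i) (Q\<^sub>1 i)"
    and "\<And>i. i \<in> {1..l\<^sub>2} \<Longrightarrow> represents_kernel M (G\<^sub>2 i) (Q\<^sub>2 i)"
  shows "PDMP M \<phi> l\<^sub>1 lam\<^sub>1 G\<^sub>1 \<mu>\<^sub>0 = PDMP M \<phi> l\<^sub>2 lam\<^sub>2 G\<^sub>2 \<mu>\<^sub>0"
proof -
  have S1: "pdmp_system M \<phi> l\<^sub>1 lam\<^sub>1 G\<^sub>1"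
    by (rule pdmp_systemI[OF assms(1,5) assms(2) assms(7)])
  have S2: "pdmp_system M \<phi> l\<^sub>2 lam\<^sub>2 G\<^sub>2"
    by (rule pdmp_systemI[OF assms(1,5) assms(3) assms(8)])
  interpret A: pdmp_system M \<phi> l\<^sub>1 lam\<^sub>1 G\<^sub>1 by (rule S1)
  interpret B: pdmp_system M \<phi> l\<^sub>2 lam\<^sub>2 G\<^sub>2 by (rule S2)
  have \<mu>: "prob_space \<mu>\<^sub>0" "sets \<mu>\<^sub>0 = sets (borel_on M)"
    using assms(6) by (auto simp: space_prob_algebra)
  \<comment> \<open>The hypothesis, which concerns the kernels on sets, becomes an identity for
    functions bounded by 1 and the representing maps \<open>G\<^sub>1\<close>,
    \<open>G\<^sub>2\<close>.\<close>
  have gen: "A.jump_intensity u t x - (\<Sum>j=1..l\<^sub>1. lam\<^sub>1 j t x) * enn2real (u t x) =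
       B.jump_intensity u t x - (\<Sum>j=1..l\<^sub>2. lam\<^sub>2 j t x) * enn2real (u t x)"
    if u: "(\<lambda>(s, x). u s x) \<in> borel_measurable (state_space M)" "\<And>r y. u r y \<le> (1::ennreal)"
      and t: "0 \<le> t" and x: "x \<in> M" for u t x
    unfolding A.jump_intensity_def B.jump_intensity_def
  proof (rule generator_extend[where N = "borel_on M" and f = "u t"])
    show "x \<in> space (borel_on M)" using x by simp
    show "0 \<le> lam\<^sub>1 j t x" if "j \<in> {1..l\<^sub>1}" for j by (rule A.lam_nonneg[OF that t x])
    show "0 \<le> lam\<^sub>2 j t x" if "j \<in> {1..l\<^sub>2}" for j by (rule B.lam_nonneg[OF that t x])
    show "G\<^sub>1 j t x \<in> uniform01 \<rightarrow>\<^sub>M borel_on M" if "j \<in> {1..l\<^sub>1}" for j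
      by (rule A.G_compose_measurable[OF that]) (use t x in \<open>auto intro: measurable_const_borel_on measurable_uniform01\<close>)
    show "G\<^sub>2 j t x \<in> uniform01 \<rightarrow>\<^sub>M borel_on M" if "j \<in> {1..l\<^sub>2}" for j
      by (rule B.G_compose_measurable[OF that]) (use t x in \<open>auto intro: measurable_const_borel_on measurable_uniform01\<close>)
    have "(\<lambda>y. (t, y)) \<in> borel_on M \<rightarrow>\<^sub>M state_space M"
      by (intro measurable_Pair measurable_half_line) (use t in auto)
    from measurable_compose[OF this u(1)] show "u t \<in> borel_measurable (borel_on M)" by simp
    show "u t z \<le> 1" for z by (rule u(2))
    fix A assume A: "A \<in> sets (borel_on M)"
    have "measure (Q\<^sub>1 j t x) A = measure uniform01 {v \<in> {0..1}. G\<^sub>1 j t x v \<in> A}" if "j \<in> {1..l\<^sub>1}" for j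
      using assms(7)[OF that, unfolded represents_kernel_def] t x A by blast
    moreover have "measure (Q\<^sub>2 j t x) A = measure uniform01 {v \<in> {0..1}. G\<^sub>2 j t x v \<in> A}" if "j \<in> {1..l\<^sub>2}" for j
      using assms(8)[OF that, unfolded represents_kernel_def] t x A by blast
    ultimately show "(\<Sum>j=1..l\<^sub>1. lam\<^sub>1 j t x * (measure uniform01 {v \<in> {0..1}. G\<^sub>1 j t x v \<in> A} - indicator A x)) =
      (\<Sum>j=1..l\<^sub>2. lam\<^sub>2 j t x * (measure uniform01 {v \<in> {0..1}. G\<^sub>2 j t x v \<in> A} - indicator A x))"
      using assms(4)[OF t x A] by simp
  qed
  show ?thesis
  proof (rule measure_eqI)
    fix U assume "U \<in> sets (PDMP M \<phi> l\<^sub>1 lam\<^sub>1 G\<^sub>1 \<mu>\<^sub>0)"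
    then have U: "U \<in> sets (borel_sigma (skorokhod_topology (with_cemetery M)))"
      unfolding PDMP_def by simp
    \<comment> \<open>One event \<open>E\<close> serves both processes, because it depends only on
      \<open>U\<close>; equality of the laws on the coordinates is then enough.\<close>
    from skorokhod_event_in_path_sigma[OF A.closed_M U] obtain E where
      E: "E \<in> sets path_sigma" "\<And>X. regular_path M X \<Longrightarrow> cadlag_version M X \<in> U \<longleftrightarrow> X \<in> E" by blast
    have "emeasure (PDMP M \<phi> l\<^sub>1 lam\<^sub>1 G\<^sub>1 \<mu>\<^sub>0) U = emeasure (A.process_law \<mu>\<^sub>0) E"
      by (rule A.emeasure_PDMP[OF \<mu>(2) U E(1)]) (rule E(2))
    also have "A.process_law \<mu>\<^sub>0 = B.process_law \<mu>\<^sub>0"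
      by (rule process_law_eq[OF S1 S2 _ \<mu>]) (rule gen)
    also have "emeasure (B.process_law \<mu>\<^sub>0) E = emeasure (PDMP M \<phi> l\<^sub>2 lam\<^sub>2 G\<^sub>2 \<mu>\<^sub>0) U"
      by (rule B.emeasure_PDMP[OF \<mu>(2) U E(1), symmetric]) (rule E(2))
    finally show "emeasure (PDMP M \<phi> l\<^sub>1 lam\<^sub>1 G\<^sub>1 \<mu>\<^sub>0) U = emeasure (PDMP M \<phi> l\<^sub>2 lam\<^sub>2 G\<^sub>2 \<mu>\<^sub>0) U" .
  qed (simp add: PDMP_def)
qed

end
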